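(* Let $L_1$ and $L_2$ be maximal dissipative operators on a Hilbert space $\mathscr H$ (no assumption that $L_1-L_2$ is bounded), and let $f\in\mathrm{OL}_{\mathrm A}(\mathbb C_+)$. Suppose that $\varphi_n,\psi_n$, $n\ge1$, are functions in $\mathrm C_{\mathrm A}(\mathbb C_+)$ such that $$(\mathfrak D f)(z,w)=\sum_{n\ge1}\varphi_n(z)\psi_n(w),\qquad z,w\in\operatorname{clos}\mathbb C_+,$$ and $$\Big(\sup_{z\in\mathbb C_+}\sum_{n\ge1}|\varphi_n(z)|^2\Big)^{1/2}\Big(\sup_{w\in\mathbb C_+}\sum_{n\ge1}|\psi_n(w)|^2\Big)^{1/2}<\infty .$$ Then \begin{align*} f_{\mathrm i}(L_1)(L_2+{\mathrm i} I)^{-1}-(L_1+{\mathrm i} I)^{-1}f_{\mathrm i}(L_2) &=f(L_1)(L_1+{\mathrm i} I)^{-1}(L_2+{\mathrm i} I)^{-1}-(L_1+{\mathrm i} I)^{-1}f(L_2)(L_2+{\mathrm i} I)^{-1}\\ &=\sum_{n=1}^\infty\varphi_n(L_1)\big((L_2+{\mathrm i} I)^{-1}-(L_1+{\mathrm i} I)^{-1}\big)\psi_n(L_2), \end{align*} and the series on the right converges in the weak operator topology.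
   Context: An operator $L$ with dense domain $\mathscr D_L$ in a Hilbert space $\mathscr H$ is dissipative if $\operatorname{Im}(Lu,u)\ge0$ for $u\in\mathscr D_L$; it is maximal dissipative if it has no proper dissipative extension. Its Cayley transform $T=(L-{\mathrm i}I)(L+{\mathrm i}I)^{-1}$ is then a contraction defined on all of $\mathscr H$ without eigenvalue $1$. $\mathbb C_+=\{\zeta:\operatorname{Im}\zeta>0\}$. Functional calculus: for $g$ bounded analytic in $\mathbb C_+$ and continuous on $\mathbb R$, $g(L)\stackrel{\mathrm{def}}{=}(g\circ\omega)(T)$ via the Sz.-Nagy–Foiaş calculus, where $\omega(\zeta)={\mathrm i}(1+\zeta)(1-\zeta)^{-1}$; equivalently $g(L)=P_{\mathscr H}g(A)|\mathscr H$ where $A$ is the minimal self-adjoint resolvent dilation of $L$ (i.e. $(L-\lambda I)^{-1}=P_{\mathscr H}(A-\lambda I)^{-1}|\mathscr H$ for $\operatorname{Im}\lambda<0$). For $f$ Lipschitz on $\operatorname{clos}\mathbb C_+$ and analytic in $\mathbb C_+$, put $f_{\mathrm i}(\zeta)=f(\zeta)/(\zeta+{\mathrm i})$ (bounded analytic, continuous on $\mathbb R$) and define the possibly unbounded operator $f(L)\stackrel{\mathrm{def}}{=}(L+{\mathrm i}I)f_{\mathrm i}(L)$; then $f(L)(L+{\mathrm i}I)^{-1}=f_{\mathrm i}(L)$. $\mathrm C_{\mathrm A}(\mathbb C_+)$ is the set of functions analytic in $\mathbb C_+$, continuous on $\operatorname{clos}\mathbb C_+$, with a finite limit at infinity. $\mathrm{OL}_{\mathrm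 A}(\mathbb C_+)$ is the class of functions $f$ continuous on $\operatorname{clos}\mathbb C_+$, analytic in $\mathbb C_+$, which are operator Lipschitz on $\operatorname{clos}\mathbb C_+$: $\|f(N_1)-f(N_2)\|\le \mathrm{const}\,\|N_1-N_2\|$ for all normal operators $N_1,N_2$ with spectra in $\operatorname{clos}\mathbb C_+$ and bounded $N_1-N_2$; such $f$ are differentiable on $\operatorname{clos}\mathbb C_+$. The divided difference is $(\mathfrak Df)(z,w)=\frac{f(z)-f(w)}{z-w}$ for $z\ne w$ and $f'(z)$ for $z=w$. *)

theory Defs
  imports "HOL-Analysis.Analysis"
begin

class cinner_space = real_normed_vector +
  fixes cscale :: "complex \<Rightarrow> 'a \<Rightarrow> 'a"
    and cinner :: "'a \<Rightarrow> 'a \<Rightarrow> complex"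
  assumes cscale_add_right: "cscale a (x + y) = cscale a x + cscale a y"
    and cscale_add_left: "cscale (a + b) x = cscale a x + cscale b x"
    and cscale_cscale: "cscale a (cscale b x) = cscale (a * b) x"
    and cscale_one: "cscale 1 x = x"
    and cscale_of_real: "cscale (complex_of_real r) x = scaleR r x"
    and cinner_add_left: "cinner (x + y) z = cinner x z + cinner y z"
    and cinner_cscale_left: "cinner (cscale a x) y = a * cinner x y"
    and cinner_commute: "cinner y x = cnj (cinner x y)"
    and cinner_self: "cinner x x = complex_of_real ((norm x)\<^sup>2)"

class chilbert_space = cinner_space + complete_space

text \<open>An operator is given by a domain \<open>D\<close> and a map \<open>L\<close> (only its values on \<open>D\<close> matter).\<close>

definition csubspace :: "'h::chilbert_space set \<Rightarrow> bool" where
  "csubspace D \<longleftrightarrow> 0 \<in> D \<and> (\<forall>x\<in>D. \<forall>y\<in>D. x + y \<in> D) \<and> (\<forall>a. \<forall>x\<in>D. cscale a x \<in> D)"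

definition clinear_on :: "'h::chilbert_space set \<Rightarrow> ('h \<Rightarrow> 'h) \<Rightarrow> bool" where
  "clinear_on D L \<longleftrightarrow> csubspace D \<and>
     (\<forall>x\<in>D. \<forall>y\<in>D. L (x + y) = L x + L y) \<and> (\<forall>a. \<forall>x\<in>D. L (cscale a x) = cscale a (L x))"

definition dissipative :: "'h::chilbert_space set \<Rightarrow> ('h \<Rightarrow> 'h) \<Rightarrow> bool" where
  "dissipative D L \<longleftrightarrow> clinear_on D L \<and> closure D = UNIV \<and>
     (\<forall>u\<in>D. Im (cinner (L u) u) \<ge> 0)"

definition max_dissipative :: "'h::chilbert_space set \<Rightarrow> ('h \<Rightarrow> 'h) \<Rightarrow> bool" where
  "max_dissipative D L \<longleftrightarrow> dissipative D L \<and>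
     (\<forall>D' L'. dissipative D' L' \<and> D \<subseteq> D' \<and> (\<forall>u\<in>D. L' u = L u) \<longrightarrow> D' = D)"

definition res_i :: "'h::chilbert_space set \<Rightarrow> ('h \<Rightarrow> 'h) \<Rightarrow> 'h \<Rightarrow> 'h" where
  "res_i D L y = (THE u. u \<in> D \<and> L u + cscale \<i> u = y)"

text \<open>Cayley transform \<open>T = (L - iI)(L + iI)\<^sup>-\<^sup>1 = I - 2i (L+iI)\<^sup>-\<^sup>1\<close>.\<close>
definition cayley :: "'h::chilbert_space set \<Rightarrow> ('h \<Rightarrow> 'h) \<Rightarrow> 'h \<Rightarrow> 'h" where
  "cayley D L x = x - cscale (2 * \<i>) (res_i D L x)"

text \<open>Sz.-Nagy--Foias calculus of a contraction \<open>T\<close> for a bounded analytic function \<open>h\<close>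
on the unit disc: \<open>h(T) x = lim_{r\<rightarrow>1-} h(rT) x\<close>, where \<open>h(rT) = \<Sum> c_n r^n T^n\<close>
and \<open>c_n\<close> are the Taylor coefficients of \<open>h\<close> at 0.\<close>
definition taylor_coeff :: "(complex \<Rightarrow> complex) \<Rightarrow> nat \<Rightarrow> complex" where
  "taylor_coeff h n = (deriv ^^ n) h 0 / of_nat (fact n)"

definition snf_calc :: "(complex \<Rightarrow> complex) \<Rightarrow> ('h::chilbert_space \<Rightarrow> 'h) \<Rightarrow> 'h \<Rightarrow> 'h" where
  "snf_calc h T x = Lim (at_left (1::real))
     (\<lambda>r. \<Sum>n. cscale (taylor_coeff h n * complex_of_real (r ^ n)) ((T ^^ n) x))"

text \<open>\<open>\<omega>(\<zeta>) = i(1+\<zeta>)(1-\<zeta>)\<^sup>-\<^sup>1\<close>, mapping the unit disc onto \<open>\<complex>\<^sub>+\<close>.\<close>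
definition omega :: "complex \<Rightarrow> complex" where
  "omega \<zeta> = \<i> * (1 + \<zeta>) / (1 - \<zeta>)"

definition fcalc :: "(complex \<Rightarrow> complex) \<Rightarrow> 'h::chilbert_space set \<Rightarrow> ('h \<Rightarrow> 'h) \<Rightarrow> 'h \<Rightarrow> 'h" where
  "fcalc g D L = snf_calc (g \<circ> omega) (cayley D L)"

definition f_i :: "(complex \<Rightarrow> complex) \<Rightarrow> complex \<Rightarrow> complex" where
  "f_i f \<zeta> = f \<zeta> / (\<zeta> + \<i>)"

text \<open>The (possibly unbounded) operator \<open>f(L) = (L + iI) f\<^sub>i(L)\<close>: domain and values.\<close>
definition fop_dom :: "(complex \<Rightarrow> complex) \<Rightarrow> 'h::chilbert_space set \<Rightarrow> ('h \<Rightarrow> 'h) \<Rightarrow> 'h set" where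
  "fop_dom f D L = {x. fcalc (f_i f) D L x \<in> D}"

definition fop :: "(complex \<Rightarrow> complex) \<Rightarrow> 'h::chilbert_space set \<Rightarrow> ('h \<Rightarrow> 'h) \<Rightarrow> 'h \<Rightarrow> 'h" where
  "fop f D L x = L (fcalc (f_i f) D L x) + cscale \<i> (fcalc (f_i f) D L x)"

definition cuhp :: "complex set" where
  "cuhp = {z. Im z > 0}"

definition cuhp_clos :: "complex set" where
  "cuhp_clos = {z. Im z \<ge> 0}"

definition CA :: "(complex \<Rightarrow> complex) set" where
  "CA = {g. g holomorphic_on cuhp \<and> continuous_on cuhp_clos g \<and>
            (\<exists>l. (g \<longlongrightarrow> l) (inf at_infinity (principal cuhp_clos)))}"

definition adj_dom :: "'h::chilbert_space set \<Rightarrow> ('h \<Rightarrow> 'h) \<Rightarrow> 'h set" where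
  "adj_dom D L = {y. \<exists>z. \<forall>x\<in>D. cinner (L x) y = cinner x z}"

definition adj :: "'h::chilbert_space set \<Rightarrow> ('h \<Rightarrow> 'h) \<Rightarrow> 'h \<Rightarrow> 'h" where
  "adj D L y = (THE z. \<forall>x\<in>D. cinner (L x) y = cinner x z)"

definition normal_op :: "'h::chilbert_space set \<Rightarrow> ('h \<Rightarrow> 'h) \<Rightarrow> bool" where
  "normal_op D L \<longleftrightarrow> clinear_on D L \<and> closure D = UNIV \<and>
     closed ((\<lambda>x. (x, L x)) ` D) \<and> adj_dom D L = D \<and>
     (\<forall>x\<in>D. norm (L x) = norm (adj D L x))"

definition spec_in_clos_uhp :: "'h::chilbert_space set \<Rightarrow> ('h \<Rightarrow> 'h) \<Rightarrow> bool" where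
  "spec_in_clos_uhp D L \<longleftrightarrow> (\<forall>\<mu>. Im \<mu> < 0 \<longrightarrow>
     bij_betw (\<lambda>x. L x - cscale \<mu> x) D UNIV \<and>
     (\<exists>C. \<forall>x\<in>D. norm x \<le> C * norm (L x - cscale \<mu> x)))"

text \<open>\<open>OL\<^sub>A(\<complex>\<^sub>+)\<close> (tested on normal operators on the Hilbert space of type \<open>'h\<close>):
\<open>\<parallel>f(N\<^sub>1) - f(N\<^sub>2)\<parallel> \<le> c \<parallel>N\<^sub>1 - N\<^sub>2\<parallel>\<close> whenever \<open>N\<^sub>1 - N\<^sub>2\<close> is bounded.\<close>
definition OLA :: "'h::chilbert_space itself \<Rightarrow> (complex \<Rightarrow> complex) \<Rightarrow> bool" where
  "OLA _ f \<longleftrightarrow> f holomorphic_on cuhp \<and> continuous_on cuhp_clos f \<and>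
     (\<exists>c. \<forall>(D1::'h set) N1 D2 N2 K.
        normal_op D1 N1 \<and> spec_in_clos_uhp D1 N1 \<and>
        normal_op D2 N2 \<and> spec_in_clos_uhp D2 N2 \<and> D1 = D2 \<and>
        (\<forall>x\<in>D1. norm (N1 x - N2 x) \<le> K * norm x) \<longrightarrow>
        (\<forall>x\<in>fop_dom f D1 N1 \<inter> fop_dom f D2 N2.
            norm (fop f D1 N1 x - fop f D2 N2 x) \<le> c * K * norm x))"

end

theory Submission
  imports Defs "HOL-Complex_Analysis.Complex_Analysis"
begin

text \<open>
  Let \<open>T\<^sub>j\<close> be the Cayley transform of \<open>L\<^sub>j\<close>, a contraction with \<open>(L\<^sub>j + iI)\<^sup>-\<^sup>1 = (I - T\<^sub>j)/(2i)\<close>.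
  On the disc the hypothesis becomes
  \<open>\<Sum>\<^sub>n \<phi>\<^sub>n(z) (z - w) \<psi>\<^sub>n(w) = h(z)(1 - w) - (1 - z)h(w)\<close> with \<open>h = f\<^sub>i \<circ> \<omega>\<close>, and comparing Taylor
  coefficients allows one to substitute \<open>rT\<^sub>1\<close> and \<open>sT\<^sub>2\<close> for \<open>z\<close> and \<open>w\<close> when \<open>r, s < 1\<close>.
  The limits are then taken one after the other, first \<open>s \<rightarrow> 1\<close>, then \<open>r \<rightarrow> 1\<close>: the tails of the
  series need not be small uniformly in both parameters at once.
  Both limits rest on von Neumann's inequality for columns, \<open>\<Sum>\<parallel>\<psi>\<^sub>n(T)x\<parallel>\<^sup>2 \<le> B\<parallel>x\<parallel>\<^sup>2\<close>, and for
  rows, \<open>\<parallel>\<Sum>\<phi>\<^sub>n(T)x\<^sub>n\<parallel>\<^sup>2 \<le> A\<Sum>\<parallel>x\<^sub>n\<parallel>\<^sup>2\<close>, obtained by averaging the positive forms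
  \<open>\<parallel>Vx\<parallel>\<^sup>2 - \<parallel>TVx\<parallel>\<^sup>2\<close>, where \<open>V \<approx> (I - \<theta>\<^sup>-\<^sup>1T)\<^sup>-\<^sup>1\<close>, over roots of unity \<open>\<theta>\<close>.
\<close>

section \<open>Complex inner product spaces\<close>

\<comment> \<open>The function \<open>h\<close> is bounded on the disc but may have no limit at 1,
  since \<open>f_i f\<close> may oscillate at infinity. Hence \<open>h(rT)\<close> need not converge
  in norm as r tends to 1. It converges strongly, because \<open>(1 - z) h(z)\<close> extends
  continuously to the closed disc with value 0 at 1 and \<open>I - T\<close> has dense range; this
  is where the density of the domain enters. The two Cayley transforms need not commute, so an
  identity in z and w can be applied to them only coefficient by coefficient, with the powers of
  \<open>T\<^sub>1\<close> to the left of those of \<open>T\<^sub>2\<close>. Each of the two limits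
  is controlled by one fixed square summable sequence in n: the j-th Taylor coefficients of
  \<open>\<phi>\<^sub>n\<close> while s varies, the vectors
  \<open>\<psi>\<^sub>n(T\<^sub>2) x\<close> while r varies. The other factor is merely bounded, by
  the column or the row inequality. Boundedness of \<open>f_i f\<close> is drawn from the
  factorization itself, which makes \<open>f\<close> Lipschitz on the half-plane. The series is
  shown to converge in norm at every vector, and weak convergence is read off at the end.\<close>
subclass (in chilbert_space) banach ..

lemma cscale_zero_right [simp]: "cscale a (0::'h::cinner_space) = 0"
  using cscale_add_right[of a "0::'h" 0] by simp

lemma cscale_zero_left [simp]: "cscale 0 (x::'h::cinner_space) = 0"
  using cscale_add_left[of 0 0 x] by simp

lemma cscale_minus_right: "cscale a (- x) = - cscale a (x::'h::cinner_space)"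
  using cscale_add_right[of a x "- x"] by (simp add: eq_neg_iff_add_eq_0 add.commute)

lemma cscale_minus_left: "cscale (- a) x = - cscale a (x::'h::cinner_space)"
  using cscale_add_left[of a "- a" x] by (simp add: eq_neg_iff_add_eq_0 add.commute)

lemma cscale_diff_right: "cscale a (x - y) = cscale a x - cscale a (y::'h::cinner_space)"
  using cscale_add_right[of a x "- y"] by (simp add: cscale_minus_right)

lemma cscale_diff_left: "cscale (a - b) x = cscale a x - cscale b (x::'h::cinner_space)"
  using cscale_add_left[of a "- b" x] by (simp add: cscale_minus_left)

lemma cinner_add_right: "cinner x (y + z) = cinner x y + cinner x (z::'h::cinner_space)"
  by (metis cinner_add_left cinner_commute complex_cnj_add)

lemma cinner_cscale_right: "cinner x (cscale a y) = cnj a * cinner x (y::'h::cinner_space)"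
  by (metis cinner_cscale_left cinner_commute complex_cnj_mult)

lemma cinner_zero_left [simp]: "cinner 0 (y::'h::cinner_space) = 0"
  using cinner_cscale_left[of 0 y y] by simp

lemma cinner_zero_right [simp]: "cinner (y::'h::cinner_space) 0 = 0"
  using cinner_cscale_right[of y 0 y] by simp

lemma cinner_minus_left: "cinner (- x) y = - cinner x (y::'h::cinner_space)"
  using cinner_add_left[of x "- x" y] by (simp add: eq_neg_iff_add_eq_0 add.commute)

lemma cinner_minus_right: "cinner x (- y) = - cinner x (y::'h::cinner_space)"
  using cinner_add_right[of x y "- y"] by (simp add: eq_neg_iff_add_eq_0 add.commute)

lemma cinner_diff_left: "cinner (x - z) y = cinner x y - cinner z (y::'h::cinner_space)"
  using cinner_add_left[of x "- z" y] by (simp add: cinner_minus_left)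

lemma cinner_diff_right: "cinner x (y - z) = cinner x y - cinner x (z::'h::cinner_space)"
  using cinner_add_right[of x y "- z"] by (simp add: cinner_minus_right)

lemmas cinner_simps = cinner_add_left cinner_add_right cinner_diff_left cinner_diff_right
  cinner_cscale_left cinner_cscale_right cinner_minus_left cinner_minus_right

lemma Re_cinner_self: "Re (cinner x x) = (norm (x::'h::cinner_space))\<^sup>2"
  by (simp add: cinner_self)

lemma Re_cinner_commute: "Re (cinner y x) = Re (cinner x (y::'h::cinner_space))"
  by (metis cinner_commute complex_cnj(1) cnj.sel(1))

lemma norm_cscale: "norm (cscale a x) = cmod a * norm (x::'h::cinner_space)"
proof -
  have "complex_of_real ((norm (cscale a x))\<^sup>2) = a * cnj a * complex_of_real ((norm x)\<^sup>2)"
    by (simp only: cinner_self[symmetric] cinner_simps) (simp add: mult.assoc)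
  also have "\<dots> = complex_of_real ((cmod a * norm x)\<^sup>2)"
    by (simp only: complex_norm_square[symmetric] power_mult_distrib of_real_mult)
  finally have "(norm (cscale a x))\<^sup>2 = (cmod a * norm x)\<^sup>2"
    using of_real_eq_iff by blast
  then show ?thesis by simp
qed

lemma norm_add_sq:
  "(norm (x + y))\<^sup>2 = (norm x)\<^sup>2 + (norm y)\<^sup>2 + 2 * Re (cinner x (y::'h::cinner_space))"
  using Re_cinner_commute[of y x]
  by (simp add: Re_cinner_self[symmetric] cinner_simps)

lemma norm_diff_sq:
  "(norm (x - y))\<^sup>2 = (norm x)\<^sup>2 + (norm y)\<^sup>2 - 2 * Re (cinner x (y::'h::cinner_space))"
  using Re_cinner_commute[of y x]
  by (simp add: Re_cinner_self[symmetric] cinner_simps)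

text \<open>Subtracting the orthogonal projection onto the line through \<open>w\<close> is the
  common source of the Cauchy-Schwarz inequality and of the orthogonality of a distance
  minimizer.\<close>

lemma norm_diff_projection_sq:
  fixes x w :: "'h::cinner_space"
  assumes "w \<noteq> 0"
  shows "(norm (x - cscale (cinner x w / (norm w)\<^sup>2) w))\<^sup>2
    = (norm x)\<^sup>2 - (cmod (cinner x w))\<^sup>2 / (norm w)\<^sup>2"
proof -
  define c where "c = cinner x w / (norm w)\<^sup>2"
  have nw: "norm w > 0" using assms by simp
  have "(norm (x - cscale c w))\<^sup>2 = (norm x)\<^sup>2 + (cmod c * norm w)\<^sup>2 - 2 * Re (cnj c * cinner x w)"
    by (simp add: norm_diff_sq norm_cscale cinner_simps)
  moreover have "cnj c * cinner x w = complex_of_real ((cmod (cinner x w))\<^sup>2 / (norm w)\<^sup>2)"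
    unfolding of_real_divide complex_norm_square by (simp add: c_def)
  moreover have "(cmod c * norm w)\<^sup>2 = (cmod (cinner x w))\<^sup>2 / (norm w)\<^sup>2"
    using nw by (simp add: c_def norm_divide norm_mult norm_power field_simps power2_eq_square)
  ultimately have "(norm (x - cscale c w))\<^sup>2 = (norm x)\<^sup>2 - (cmod (cinner x w))\<^sup>2 / (norm w)\<^sup>2"
    by (simp only: Re_complex_of_real)
  then show ?thesis by (simp only: c_def)
qed

lemma cinner_Cauchy_Schwarz: "cmod (cinner x y) \<le> norm x * norm (y::'h::cinner_space)"
proof (cases "y = 0")
  case False
  then have "(cmod (cinner x y))\<^sup>2 / (norm y)\<^sup>2 \<le> (norm x)\<^sup>2"
    using norm_diff_projection_sq[OF False, of x] zero_le_power2 diff_ge_0_iff_ge by metis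
  then have "(cmod (cinner x y))\<^sup>2 \<le> (norm x * norm y)\<^sup>2"
    using False by (simp add: pos_divide_le_eq power_mult_distrib)
  then show ?thesis by (rule power2_le_imp_le) simp
qed simp

lemma scaleR_cscale: "r *\<^sub>R x = cscale (complex_of_real r) (x::'h::cinner_space)"
  by (simp add: cscale_of_real)

lemma bounded_bilinear_cscale: "bounded_bilinear (cscale :: complex \<Rightarrow> 'h \<Rightarrow> 'h::cinner_space)"
proof (standard, goal_cases)
  case 5
  show ?case by (rule exI[of _ 1]) (simp add: norm_cscale)
qed (simp_all add: cscale_add_left cscale_add_right scaleR_cscale cscale_cscale scaleR_conv_of_real mult.commute)

lemma bounded_bilinear_cinner: "bounded_bilinear (cinner :: 'h \<Rightarrow> 'h \<Rightarrow> complex)"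
  for dummy :: "'h::cinner_space"
proof (standard, goal_cases)
  case 5
  show ?case by (rule exI[of _ 1]) (simp add: cinner_Cauchy_Schwarz)
qed (simp_all add: cinner_simps scaleR_cscale scaleR_conv_of_real)

lemmas bounded_linear_cscale_right = bounded_bilinear.bounded_linear_right[OF bounded_bilinear_cscale]
lemmas bounded_linear_cinner_left = bounded_bilinear.bounded_linear_left[OF bounded_bilinear_cinner]
lemmas tendsto_cscale = bounded_bilinear.tendsto[OF bounded_bilinear_cscale]
lemmas tendsto_cinner = bounded_bilinear.tendsto[OF bounded_bilinear_cinner]

lemma cinner_sum_left: "cinner (\<Sum>i\<in>F. x i) y = (\<Sum>i\<in>F. cinner (x i) y)"
  by (rule bounded_bilinear.sum_left[OF bounded_bilinear_cinner])

lemma cinner_sum_right: "cinner y (\<Sum>i\<in>F. x i) = (\<Sum>i\<in>F. cinner y (x i))"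
  by (rule bounded_bilinear.sum_right[OF bounded_bilinear_cinner])

section \<open>Orthogonality to dense and to closed subspaces\<close>

lemma cinner_zero_on_dense:
  fixes g :: "'h::cinner_space"
  assumes D: "closure D = UNIV" and 0: "\<And>w. w \<in> D \<Longrightarrow> cinner g w = 0"
  shows "g = 0"
proof -
  have "g \<in> closure D" using D by simp
  then obtain u where u: "\<And>n. u n \<in> D" "u \<longlonglongrightarrow> g" unfolding closure_sequential by blast
  have "(\<lambda>n. cinner g (u n)) \<longlonglongrightarrow> cinner g g"
    by (intro tendsto_cinner tendsto_const u)
  then have "cinner g g = 0" using 0 u(1) by (simp add: LIMSEQ_const_iff)
  then show "g = 0" by (simp add: cinner_self)
qed

text \<open>A sequence in \<open>M\<close> that minimizes the distance to \<open>y\<close> is Cauchy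
  by the parallelogram law; its limit \<open>p\<close> is the nearest point, and the residual
  \<open>y - p\<close> is orthogonal to \<open>M\<close>.\<close>

lemma orthogonal_to_closed_csubspace:
  fixes M :: "'h::chilbert_space set"
  assumes M: "csubspace M" and cl: "closed M" and y: "y \<notin> M"
  obtains v where "v \<noteq> 0" "\<And>m. m \<in> M \<Longrightarrow> cinner v m = 0"
proof -
  define d where "d = infdist y M"
  have ne: "M \<noteq> {}" using M by (auto simp: csubspace_def)
  have d0: "d \<ge> 0" by (simp add: d_def infdist_nonneg)
  have dle: "d \<le> norm (y - m)" if "m \<in> M" for m
    using infdist_le[OF that, of y] by (simp add: d_def dist_norm)
  have "\<exists>m\<in>M. norm (y - m) < d + 1 / Suc n" for n :: nat
  proof -
    have "infdist y M < d + 1 / Suc n" by (simp add: d_def)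
    then show ?thesis
      using ne cInf_lessD[of "(\<lambda>a. dist y a) ` M"] by (auto simp: infdist_def dist_norm)
  qed
  then obtain m where m: "\<And>n. m n \<in> M" "\<And>n::nat. norm (y - m n) < d + 1 / Suc n" by metis
  \<comment> \<open>Parallelogram law: the midpoint of \<open>m i\<close> and \<open>m j\<close>
    lies in \<open>M\<close>, so its distance to \<open>y\<close> is at least \<open>d\<close>. The
    constant comes from \<open>4 (d + t)^2 - 4 d^2 = (8 d + 4 t) t\<close> with
    \<open>t = 1 / Suc n \<le> 1\<close>.\<close>
  have sq: "(norm (m i - m j))\<^sup>2 \<le> (8 * d + 4) * (1 / Suc n)" if "n \<le> i" "n \<le> j" for i j n
  proof -
    have mid: "cscale (1/2) (m i + m j) \<in> M" using M m(1) by (auto simp: csubspace_def)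
    have lt: "(norm (y - m k))\<^sup>2 \<le> (d + 1 / Suc n)\<^sup>2" if "n \<le> k" for k
    proof (rule power_mono)
      have "1 / real (Suc k) \<le> 1 / Suc n" using that by (simp add: field_simps)
      then show "norm (y - m k) \<le> d + 1 / Suc n" using m(2)[of k] by linarith
    qed simp
    have "(norm ((y - m i) - (y - m j)))\<^sup>2 = 2 * (norm (y - m i))\<^sup>2 + 2 * (norm (y - m j))\<^sup>2
        - (norm ((y - m i) + (y - m j)))\<^sup>2"
      using norm_add_sq[of "y - m i" "y - m j"] norm_diff_sq[of "y - m i" "y - m j"] by linarith
    also have "(y - m i) + (y - m j) = cscale 2 (y - cscale (1/2) (m i + m j))"
      using cscale_of_real[of 2 y] by (simp add: cscale_diff_right cscale_cscale cscale_one scaleR_2)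
    finally have "(norm (m i - m j))\<^sup>2 = 2 * (norm (y - m i))\<^sup>2 + 2 * (norm (y - m j))\<^sup>2
        - (norm (cscale 2 (y - cscale (1/2) (m i + m j))))\<^sup>2"
      by (simp add: norm_minus_commute)
    moreover have "(norm (cscale 2 (y - cscale (1/2) (m i + m j))))\<^sup>2 \<ge> 4 * d\<^sup>2"
      using dle[OF mid] d0 by (simp add: norm_cscale power_mult_distrib power_mono)
    ultimately have "(norm (m i - m j))\<^sup>2 \<le> 4 * (d + 1 / Suc n)\<^sup>2 - 4 * d\<^sup>2"
      using lt[OF that(1)] lt[OF that(2)] by linarith
    also have "\<dots> = (8 * d + 4 * (1 / Suc n)) * (1 / Suc n)"
      by (simp add: power2_eq_square algebra_simps)
    also have "\<dots> \<le> (8 * d + 4) * (1 / Suc n)"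
      using d0 by (intro mult_right_mono add_mono) (auto simp: field_simps)
    finally show ?thesis .
  qed
  have "Cauchy m"
  proof (rule metric_CauchyI)
    fix e :: real assume e: "e > 0"
    have "(\<lambda>n. (8 * d + 4) * (1 / Suc n)) \<longlonglongrightarrow> (8 * d + 4) * 0"
      by (intro tendsto_mult tendsto_const LIMSEQ_Suc[OF lim_1_over_n])
    then have "\<forall>\<^sub>F n in sequentially. (8 * d + 4) * (1 / Suc n) < e\<^sup>2"
      using e by (intro order_tendstoD(2)) auto
    then obtain n where n: "(8 * d + 4) * (1 / Suc n) < e\<^sup>2"
      by (auto simp: eventually_sequentially)
    have "dist (m i) (m j) < e" if "n \<le> i" "n \<le> j" for i j
    proof -
      have "(norm (m i - m j))\<^sup>2 < e\<^sup>2" using sq[OF that] n by linarith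
      then show ?thesis using e by (simp add: dist_norm power2_less_imp_less)
    qed
    then show "\<exists>N. \<forall>i\<ge>N. \<forall>j\<ge>N. dist (m i) (m j) < e" by blast
  qed
  then obtain p where p: "m \<longlonglongrightarrow> p" using Cauchy_convergent_iff convergent_def by blast
  have pM: "p \<in> M" using cl m(1) p closed_sequentially by blast
  have np: "norm (y - p) \<le> d"
  proof (rule LIMSEQ_le[of "\<lambda>n. norm (y - m n)" _ "\<lambda>n. d + 1 / Suc n"])
    show "(\<lambda>n. norm (y - m n)) \<longlonglongrightarrow> norm (y - p)" by (intro tendsto_intros p)
    have "(\<lambda>n. d + 1 / Suc n) \<longlonglongrightarrow> d + 0"
      by (intro tendsto_add tendsto_const LIMSEQ_Suc[OF lim_1_over_n])
    then show "(\<lambda>n. d + 1 / Suc n) \<longlonglongrightarrow> d" by simp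
    show "\<exists>N. \<forall>n\<ge>N. norm (y - m n) \<le> d + 1 / Suc n" using m(2) less_imp_le by blast
  qed
  define v where "v = y - p"
  have "v \<noteq> 0" using pM y by (auto simp: v_def)
  moreover have "cinner v w = 0" if w: "w \<in> M" for w
  proof (cases "w = 0")
    case False
    \<comment> \<open>Moving \<open>p\<close> by the projection of \<open>v\<close> onto
      \<open>w\<close> stays in \<open>M\<close> and would shorten the residual unless
      \<open>cinner v w = 0\<close>.\<close>
    define c where "c = cinner v w / (norm w)\<^sup>2"
    have nw: "norm w > 0" using False by simp
    have "p + cscale c w \<in> M" using M pM w by (auto simp: csubspace_def)
    from dle[OF this] have "(norm v)\<^sup>2 \<le> (norm (v - cscale c w))\<^sup>2"
      using np d0 by (intro power_mono) (auto simp: v_def algebra_simps)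
    also have "\<dots> = (norm v)\<^sup>2 - (cmod (cinner v w))\<^sup>2 / (norm w)\<^sup>2"
      unfolding c_def by (rule norm_diff_projection_sq[OF False])
    finally have "(cmod (cinner v w))\<^sup>2 / (norm w)\<^sup>2 \<le> 0" by simp
    then show ?thesis using nw by (simp add: divide_le_0_iff)
  qed simp
  ultimately show ?thesis using that by blast
qed

section \<open>The Cayley transform of a maximal dissipative operator\<close>

lemma csubspace_diff: "csubspace M \<Longrightarrow> x \<in> M \<Longrightarrow> y \<in> M \<Longrightarrow> x - y \<in> M"
  unfolding csubspace_def
  by (metis cscale_minus_left cscale_one uminus_add_conv_diff add.commute)

lemma clinear_on_diff:
  assumes "clinear_on D L" "x \<in> D" "y \<in> D"
  shows "L (x - y) = L x - L y"
proof -
  have "L (x + cscale (-1) y) = L x + cscale (-1) (L y)"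
    using assms by (auto simp: clinear_on_def csubspace_def)
  then show ?thesis by (simp add: cscale_minus_left cscale_one)
qed

text \<open>The assumption \<open>ge\<close> says that adjoining the pair \<open>(u, g)\<close> to
  the graph keeps it dissipative. Replacing \<open>d\<close> by \<open>w - cscale c u\<close>
  cancels \<open>u\<close> and leaves a real expression affine in \<open>c\<close> that is bounded
  below for all complex \<open>c\<close>; its linear part \<open>cinner (g - L u) w\<close> must
  vanish, and \<open>w\<close> runs over a dense set.\<close>

lemma dissipative_limit_in_graph:
  fixes D :: "'h::chilbert_space set"
  assumes diss: "dissipative D L" and u: "u \<in> D"
    and ge: "\<And>d c. d \<in> D \<Longrightarrow> Im (cinner (L d + cscale c g) (d + cscale c u)) \<ge> 0"
  shows "L u = g"
proof -
  have lin: "clinear_on D L" and dense: "closure D = UNIV"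
    and pos: "\<And>u. u \<in> D \<Longrightarrow> Im (cinner (L u) u) \<ge> 0"
    using diss by (auto simp: dissipative_def)
  have sub: "csubspace D" using lin by (simp add: clinear_on_def)
  have "cinner (g - L u) w = 0" if w: "w \<in> D" for w
  proof -
    define p where "p = cinner (g - L u) w"
    have "Im (cinner (L w) w) + Im (c * p) \<ge> 0" for c
    proof -
      have cu: "cscale c u \<in> D" using sub u by (simp add: csubspace_def)
      have "L (w - cscale c u) = L w - cscale c (L u)"
        using clinear_on_diff[OF lin w cu] lin u by (simp add: clinear_on_def)
      then have "Im (cinner (L w + cscale c (g - L u)) w) \<ge> 0"
        using ge[OF csubspace_diff[OF sub w cu], of c]
        by (simp add: cscale_diff_right cinner_simps)
      then show ?thesis by (simp add: cinner_simps p_def)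
    qed
    note * = this
    have "p = 0"
    proof (rule ccontr)
      assume "p \<noteq> 0"
      \<comment> \<open>Chosen so that the left-hand side of the inequality becomes -1.\<close>
      define c where "c = - \<i> * complex_of_real (Im (cinner (L w) w) + 1) / p"
      have "c * p = - \<i> * complex_of_real (Im (cinner (L w) w) + 1)"
        using \<open>p \<noteq> 0\<close> by (simp add: c_def)
      then have "Im (c * p) = - (Im (cinner (L w) w) + 1)" by simp
      then show False using *[of c] by linarith
    qed
    then show ?thesis by (simp add: p_def)
  qed
  then have "g - L u = 0" using cinner_zero_on_dense[OF dense] by blast
  then show ?thesis by simp
qed

text \<open>Otherwise \<open>L\<close> extends dissipatively to \<open>D + \<complex>u\<close> by \<open>u \<mapsto> g\<close>.\<close>
lemma max_dissipative_criterion: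
  fixes D :: "'h::chilbert_space set"
  assumes max: "max_dissipative D L"
    and ge: "\<And>d c. d \<in> D \<Longrightarrow> Im (cinner (L d + cscale c g) (d + cscale c u)) \<ge> 0"
  shows "u \<in> D \<and> L u = g"
proof -
  have diss: "dissipative D L" using max by (simp add: max_dissipative_def)
  have lin: "clinear_on D L" and dense: "closure D = UNIV"
    using diss by (auto simp: dissipative_def)
  have sub: "csubspace D" using lin by (simp add: clinear_on_def)
  have 0: "0 \<in> D" using sub by (simp add: csubspace_def)
  have "u \<in> D"
  proof (rule ccontr)
    assume nu: "u \<notin> D"
    define D' where "D' = {d + cscale c u | d c. d \<in> D}"
    define P where "P = (\<lambda>x p. fst p \<in> D \<and> x = fst p + cscale (snd p) u)"
    \<comment> \<open>The decomposition \<open>d + cscale c u\<close> is selected by choice; since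
      \<open>u\<close> is outside \<open>D\<close> it is unique, which makes \<open>L'\<close>
      linear.\<close>
    define L' where "L' x = (let p = (SOME p. P x p) in L (fst p) + cscale (snd p) g)" for x
    have uniq: "d = d' \<and> c = c'" if d: "d \<in> D" "d' \<in> D" "d + cscale c u = d' + cscale c' u" for d d' c c'
    proof -
      have eq: "cscale (c - c') u = d' - d" using d(3) by (simp add: cscale_diff_left algebra_simps)
      have "c = c'"
      proof (rule ccontr)
        assume "c \<noteq> c'"
        then have "u = cscale (1 / (c - c')) (cscale (c - c') u)"
          by (simp add: cscale_cscale cscale_one)
        then have "u = cscale (1 / (c - c')) (d' - d)" using eq by simp
        then show False using nu sub csubspace_diff[OF sub d(2,1)] by (simp add: csubspace_def)
      qed
      then show ?thesis using d(3) by simp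
    qed
    have L': "L' (d + cscale c u) = L d + cscale c g" if "d \<in> D" for d c
    proof -
      have "P (d + cscale c u) (d, c)" using that by (simp add: P_def)
      then have "P (d + cscale c u) (SOME p. P (d + cscale c u) p)" by (rule someI)
      moreover obtain d' c' where dc: "(SOME p. P (d + cscale c u) p) = (d', c')" by fastforce
      ultimately have "d' \<in> D" "d + cscale c u = d' + cscale c' u" by (auto simp: P_def)
      then have "(SOME p. P (d + cscale c u) p) = (d, c)" using uniq[OF that] dc by blast
      then show ?thesis by (simp add: L'_def)
    qed
    have DD': "D \<subseteq> D'"
    proof
      fix d assume "d \<in> D"
      then show "d \<in> D'" unfolding D'_def
        by (intro CollectI exI[of _ d] exI[of _ 0]) simp
    qed
    have sub': "csubspace D'"
      unfolding csubspace_def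
    proof (intro conjI ballI allI)
      show "0 \<in> D'" using 0 DD' by blast
    next
      fix x y assume "x \<in> D'" "y \<in> D'"
      then obtain d c d' c' where "d \<in> D" "d' \<in> D" "x = d + cscale c u" "y = d' + cscale c' u"
        by (auto simp: D'_def)
      then show "x + y \<in> D'" unfolding D'_def using sub
        by (auto intro!: exI[of _ "d + d'"] exI[of _ "c + c'"] simp: csubspace_def cscale_add_left)
    next
      fix a x assume "x \<in> D'"
      then obtain d c where "d \<in> D" "x = d + cscale c u" by (auto simp: D'_def)
      then show "cscale a x \<in> D'" unfolding D'_def using sub
        by (auto intro!: exI[of _ "cscale a d"] exI[of _ "a * c"]
            simp: csubspace_def cscale_add_right cscale_cscale)
    qed
    have lin': "clinear_on D' L'"
      unfolding clinear_on_def
    proof (intro conjI ballI allI sub')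
      fix x y assume "x \<in> D'" "y \<in> D'"
      then obtain d c d' c' where d: "d \<in> D" "d' \<in> D" "x = d + cscale c u" "y = d' + cscale c' u"
        by (auto simp: D'_def)
      have "x + y = (d + d') + cscale (c + c') u" by (simp add: d cscale_add_left)
      moreover have "d + d' \<in> D" using d sub by (simp add: csubspace_def)
      ultimately have "L' (x + y) = L (d + d') + cscale (c + c') g" using L' by simp
      then show "L' (x + y) = L' x + L' y"
        using lin d by (simp add: L' cscale_add_left clinear_on_def)
    next
      fix a x assume "x \<in> D'"
      then obtain d c where d: "d \<in> D" "x = d + cscale c u" by (auto simp: D'_def)
      have "cscale a x = cscale a d + cscale (a * c) u" by (simp add: d cscale_add_right cscale_cscale)
      moreover have "cscale a d \<in> D" using d sub by (simp add: csubspace_def)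
      ultimately have "L' (cscale a x) = L (cscale a d) + cscale (a * c) g" using L' by simp
      then show "L' (cscale a x) = cscale a (L' x)"
        using lin d by (simp add: L' cscale_add_right cscale_cscale clinear_on_def)
    qed
    have "dissipative D' L'"
      unfolding dissipative_def
    proof (intro conjI lin' ballI)
      show "closure D' = UNIV" using closure_mono[OF DD'] dense by auto
      fix x assume "x \<in> D'"
      then obtain d c where "d \<in> D" "x = d + cscale c u" by (auto simp: D'_def)
      then show "Im (cinner (L' x) x) \<ge> 0" using ge L' by simp
    qed
    moreover have "\<forall>d\<in>D. L' d = L d" using L'[of _ 0] by simp
    ultimately have "D' = D" using max DD' unfolding max_dissipative_def by blast
    moreover have "u \<in> D'" unfolding D'_def using 0
      by (auto intro!: exI[of _ 0] exI[of _ 1] simp: cscale_one)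
    ultimately show False using nu by simp
  qed
  then show ?thesis using dissipative_limit_in_graph[OF diss _ ge] by blast
qed

text \<open>Expanding the squares, the cross term is \<open>2 Im (Lu, u)\<close> with the sign of
  the shift. The first bound yields injectivity and closed range of \<open>L + iI\<close>, the
  second contractivity of the Cayley transform.\<close>

lemma dissipative_norm_plus_i:
  assumes "dissipative D L" "u \<in> D"
  shows "norm u \<le> norm (L u + cscale \<i> u)" "norm (L u - cscale \<i> u) \<le> norm (L u + cscale \<i> u)"
proof -
  have "Im (cinner (L u) u) \<ge> 0" using assms by (simp add: dissipative_def)
  then have "(norm u)\<^sup>2 \<le> (norm (L u + cscale \<i> u))\<^sup>2"
    "(norm (L u - cscale \<i> u))\<^sup>2 \<le> (norm (L u + cscale \<i> u))\<^sup>2"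
    by (simp_all add: norm_add_sq norm_diff_sq cinner_simps norm_cscale)
  then show "norm u \<le> norm (L u + cscale \<i> u)" "norm (L u - cscale \<i> u) \<le> norm (L u + cscale \<i> u)"
    by (auto intro: power2_le_imp_le)
qed

lemma dissipative_plus_i_linear:
  assumes "dissipative D L" "u \<in> D" "v \<in> D"
  shows "L (u + v) + cscale \<i> (u + v) = (L u + cscale \<i> u) + (L v + cscale \<i> v)"
    "L (u - v) + cscale \<i> (u - v) = (L u + cscale \<i> u) - (L v + cscale \<i> v)"
    "L (cscale a u) + cscale \<i> (cscale a u) = cscale a (L u + cscale \<i> u)"
proof -
  have lin: "clinear_on D L" using assms by (simp add: dissipative_def)
  show "L (u + v) + cscale \<i> (u + v) = (L u + cscale \<i> u) + (L v + cscale \<i> v)"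
    "L (cscale a u) + cscale \<i> (cscale a u) = cscale a (L u + cscale \<i> u)"
    using lin assms by (simp_all add: clinear_on_def cscale_add_right cscale_cscale mult.commute)
  show "L (u - v) + cscale \<i> (u - v) = (L u + cscale \<i> u) - (L v + cscale \<i> v)"
    using clinear_on_diff[OF lin assms(2,3)] by (simp add: cscale_diff_right)
qed

text \<open>Both halves use maximality. The range is closed because \<open>L + iI\<close> is bounded
  below and limits of graph points may be adjoined to the graph. A vector \<open>v\<close>
  orthogonal to the range could be adjoined with value \<open>iv\<close>, so it would lie in
  \<open>D\<close> with \<open>L v = iv\<close>, whereas orthogonality forces
  \<open>(L v, v) = -i (v, v)\<close>.\<close>

lemma max_dissipative_plus_i_surj:
  fixes D :: "'h::chilbert_space set"
  assumes max: "max_dissipative D L"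
  shows "\<exists>u\<in>D. L u + cscale \<i> u = y"
proof -
  have diss: "dissipative D L" using max by (simp add: max_dissipative_def)
  have lin: "clinear_on D L" and dense: "closure D = UNIV"
    and pos: "\<And>u. u \<in> D \<Longrightarrow> Im (cinner (L u) u) \<ge> 0"
    using diss by (auto simp: dissipative_def)
  have sub: "csubspace D" using lin by (simp add: clinear_on_def)
  define M where "M = (\<lambda>u. L u + cscale \<i> u) ` D"
  have subM: "csubspace M"
    unfolding csubspace_def
  proof (intro conjI ballI allI)
    have "0 \<in> D" using sub by (simp add: csubspace_def)
    moreover have "L 0 = 0" using clinear_on_diff[OF lin \<open>0 \<in> D\<close> \<open>0 \<in> D\<close>] by simp
    ultimately show "0 \<in> M" by (auto simp: M_def intro!: image_eqI[of _ _ 0])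
  next
    fix x y assume "x \<in> M" "y \<in> M"
    then obtain u v where "u \<in> D" "v \<in> D" "x = L u + cscale \<i> u" "y = L v + cscale \<i> v"
      by (auto simp: M_def)
    then show "x + y \<in> M"
      using dissipative_plus_i_linear(1)[OF diss] sub by (auto simp: M_def csubspace_def intro!: image_eqI[of _ _ "u + v"])
  next
    fix a x assume "x \<in> M"
    then obtain u where "u \<in> D" "x = L u + cscale \<i> u" by (auto simp: M_def)
    then show "cscale a x \<in> M"
      using dissipative_plus_i_linear(3)[OF diss] sub
      by (auto simp: M_def csubspace_def intro!: image_eqI[of _ _ "cscale a u"])
  qed
  have "closed M"
    unfolding closed_sequential_limits
  proof (intro allI impI, elim conjE)
    fix s y assume s: "\<forall>n. s n \<in> M" and lim: "s \<longlonglongrightarrow> y"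
    obtain v where v: "\<And>n. v n \<in> D" "\<And>n. s n = L (v n) + cscale \<i> (v n)"
      using s unfolding M_def image_iff by metis
    have "Cauchy v"
    proof (rule metric_CauchyI)
      fix e :: real assume "e > 0"
      moreover have "Cauchy s" using lim LIMSEQ_imp_Cauchy by blast
      ultimately obtain N where N: "\<And>m n. m \<ge> N \<Longrightarrow> n \<ge> N \<Longrightarrow> dist (s m) (s n) < e"
        by (meson metric_CauchyD)
      have "dist (v m) (v n) \<le> dist (s m) (s n)" for m n
        using dissipative_norm_plus_i(1)[OF diss csubspace_diff[OF sub v(1) v(1)], of m n]
        by (simp add: dissipative_plus_i_linear(2)[OF diss v(1) v(1)] v(2) dist_norm)
      then show "\<exists>N. \<forall>m\<ge>N. \<forall>n\<ge>N. dist (v m) (v n) < e"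
        using N by (meson le_less_trans)
    qed
    then obtain u where u: "v \<longlonglongrightarrow> u" using Cauchy_convergent_iff convergent_def by blast
    define g where "g = y - cscale \<i> u"
    have "(\<lambda>n. s n - cscale \<i> (v n)) \<longlonglongrightarrow> g"
      unfolding g_def by (intro tendsto_diff tendsto_cscale tendsto_const lim u)
    then have g: "(\<lambda>n. L (v n)) \<longlonglongrightarrow> g" by (simp add: v(2))
    \<comment> \<open>Dissipativity at \<open>d + cscale c (v n)\<close> passes to the limit, so the
      criterion places \<open>(u, g)\<close> in the graph.\<close>
    have "Im (cinner (L d + cscale c g) (d + cscale c u)) \<ge> 0" if d: "d \<in> D" for d c
    proof (rule LIMSEQ_le_const)
      show "(\<lambda>n. Im (cinner (L d + cscale c (L (v n))) (d + cscale c (v n))))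
          \<longlonglongrightarrow> Im (cinner (L d + cscale c g) (d + cscale c u))"
        by (intro tendsto_Im tendsto_cinner tendsto_add tendsto_cscale tendsto_const g u)
      have "L d + cscale c (L (v n)) = L (d + cscale c (v n))" "d + cscale c (v n) \<in> D" for n
        using lin d v(1) by (auto simp: clinear_on_def csubspace_def)
      then show "\<exists>N. \<forall>n\<ge>N. 0 \<le> Im (cinner (L d + cscale c (L (v n))) (d + cscale c (v n)))"
        using pos by simp
    qed
    from max_dissipative_criterion[OF max this] have "u \<in> D" "L u = g" by auto
    then show "y \<in> M" by (auto simp: M_def g_def intro!: image_eqI[of _ _ u])
  qed
  have "y \<in> M"
  proof (rule ccontr)
    assume "y \<notin> M"
    then obtain v where v: "v \<noteq> 0" "\<And>m. m \<in> M \<Longrightarrow> cinner v m = 0"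
      using orthogonal_to_closed_csubspace[OF subM \<open>closed M\<close>] by blast
    have orth: "cinner (L d) v = - \<i> * cinner d v" if "d \<in> D" for d
    proof -
      have "cinner v (L d + cscale \<i> d) = 0" using v(2) that by (auto simp: M_def)
      then have "cinner (L d + cscale \<i> d) v = 0" by (metis cinner_commute complex_cnj_zero)
      then show ?thesis by (simp add: cinner_simps add_eq_0_iff)
    qed
    have "Im (cinner (L d + cscale c (cscale \<i> v)) (d + cscale c v)) \<ge> 0" if d: "d \<in> D" for d c
    proof -
      define p where "p = cinner d v"
      have p': "cinner v d = cnj p" by (simp add: p_def cinner_commute[of v d])
      have "cinner (L d + cscale c (cscale \<i> v)) (d + cscale c v)
        = cinner (L d) d + \<i> * (c * cnj p - cnj (c * cnj p)) + \<i> * (c * cnj c) * cinner v v"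
        by (simp add: cinner_simps orth[OF d] p' p_def[symmetric] algebra_simps)
      \<comment> \<open>The cross terms combine to a real number and drop out of the imaginary part,
        which leaves \<open>Im (L d, d)\<close> plus the square of
        \<open>cmod c * norm v\<close>.\<close>
      also have "\<i> * (c * cnj p - cnj (c * cnj p)) = complex_of_real (- 2 * Im (c * cnj p))"
        by (rule complex_eqI) simp_all
      also have "\<i> * (c * cnj c) * cinner v v = \<i> * complex_of_real ((cmod c * norm v)\<^sup>2)"
        by (simp only: complex_norm_square[symmetric] cinner_self power_mult_distrib of_real_mult mult.assoc)
      finally show ?thesis using pos[OF d] by simp
    qed
    from max_dissipative_criterion[OF max this] have "v \<in> D" "L v = cscale \<i> v" by auto
    then have "cinner (cscale \<i> v) v = - \<i> * cinner v v" using orth by metis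
    then show False using v(1) by (simp add: cinner_simps cinner_self)
  qed
  then show ?thesis by (auto simp: M_def)
qed

lemma res_i_works:
  fixes D :: "'h::chilbert_space set"
  assumes max: "max_dissipative D L"
  shows "res_i D L y \<in> D" "L (res_i D L y) + cscale \<i> (res_i D L y) = y"
    and res_i_left_inverse: "u \<in> D \<Longrightarrow> res_i D L (L u + cscale \<i> u) = u"
proof -
  have diss: "dissipative D L" using max by (simp add: max_dissipative_def)
  have sub: "csubspace D" using diss by (simp add: dissipative_def clinear_on_def)
  have inj: "u = v" if "u \<in> D" "v \<in> D" "L u + cscale \<i> u = L v + cscale \<i> v" for u v
    using dissipative_norm_plus_i(1)[OF diss csubspace_diff[OF sub that(1,2)]]
      dissipative_plus_i_linear(2)[OF diss that(1,2)] that(3) by simp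
  have ex: "\<exists>!u. u \<in> D \<and> L u + cscale \<i> u = y" for y
    using max_dissipative_plus_i_surj[OF max, of y] inj by blast
  show "res_i D L y \<in> D" "L (res_i D L y) + cscale \<i> (res_i D L y) = y"
    unfolding res_i_def using theI'[OF ex[of y]] by auto
  show "res_i D L (L u + cscale \<i> u) = u" if "u \<in> D"
    unfolding res_i_def using that inj by (intro the_equality) auto
qed

definition ccontraction :: "('h::cinner_space \<Rightarrow> 'h) \<Rightarrow> bool" where
  "ccontraction T \<longleftrightarrow> (\<forall>x y. T (x + y) = T x + T y) \<and> (\<forall>a x. T (cscale a x) = cscale a (T x)) \<and>
     (\<forall>x. norm (T x) \<le> norm x)"

lemma res_i_eq_cayley: "res_i D L x = cscale (1 / (2 * \<i>)) (x - cayley D L x)"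
  by (simp add: cayley_def cscale_cscale cscale_one)

lemma ccontraction_cayley:
  fixes D :: "'h::chilbert_space set"
  assumes max: "max_dissipative D L"
  shows "ccontraction (cayley D L)"
proof -
  let ?R = "res_i D L"
  have diss: "dissipative D L" using max by (simp add: max_dissipative_def)
  have sub: "csubspace D" using diss by (simp add: dissipative_def clinear_on_def)
  note R = res_i_works[OF max]
  have add: "?R (x + y) = ?R x + ?R y" for x y
    using R(3)[of "?R x + ?R y"] sub R(1) dissipative_plus_i_linear(1)[OF diss R(1) R(1)] R(2)
    by (simp add: csubspace_def)
  have scale: "?R (cscale a x) = cscale a (?R x)" for a x
    using R(3)[of "cscale a (?R x)"] sub R(1) dissipative_plus_i_linear(3)[OF diss R(1) R(1)] R(2)
    by (simp add: csubspace_def)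
  have "norm (cayley D L x) \<le> norm x" for x
  proof -
    have "cayley D L x = (L (?R x) + cscale \<i> (?R x)) - cscale (2 * \<i>) (?R x)"
      by (simp add: cayley_def R(2))
    also have "cscale (2 * \<i>) (?R x) = cscale \<i> (?R x) + cscale \<i> (?R x)"
      by (simp add: cscale_add_left[symmetric])
    finally have "cayley D L x = L (?R x) - cscale \<i> (?R x)" by simp
    then show ?thesis using dissipative_norm_plus_i(2)[OF diss R(1), of x] R(2)[of x] by simp
  qed
  then show ?thesis
    unfolding ccontraction_def cayley_def add scale
    by (simp add: cscale_add_right cscale_diff_right cscale_cscale mult.commute)
qed

text \<open>\<open>I - T\<close> equals \<open>2i\<close> times the resolvent, whose range is
  \<open>D\<close>. This is the quantitative substitute for the absence of the eigenvalue 1.\<close>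

lemma dense_range_one_minus_cayley:
  fixes D :: "'h::chilbert_space set"
  assumes max: "max_dissipative D L"
  shows "closure (range (\<lambda>x. x - cayley D L x)) = UNIV"
proof -
  have "D \<subseteq> range (\<lambda>x. x - cayley D L x)"
  proof
    fix u assume u: "u \<in> D"
    have sub: "csubspace D" using max by (simp add: max_dissipative_def dissipative_def clinear_on_def)
    define v where "v = cscale (1 / (2 * \<i>)) u"
    have "v \<in> D" using sub u by (simp add: v_def csubspace_def)
    then have "res_i D L (L v + cscale \<i> v) = v" by (rule res_i_left_inverse[OF max])
    then have "(L v + cscale \<i> v) - cayley D L (L v + cscale \<i> v) = u"
      by (simp add: cayley_def v_def cscale_cscale cscale_one)
    then show "u \<in> range (\<lambda>x. x - cayley D L x)" by (metis rangeI)
  qed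
  moreover have "closure D = UNIV" using max by (simp add: max_dissipative_def dissipative_def)
  ultimately show ?thesis using closure_mono by blast
qed

section \<open>Von Neumann's inequality for rows and columns\<close>

lemma ccontractionD:
  assumes "ccontraction T"
  shows "T (x + y) = T x + T y" "T (cscale a x) = cscale a (T x)" "norm (T x) \<le> norm x"
    "T (x - y) = T x - T y" "T 0 = 0"
proof -
  show *: "T (x + y) = T x + T y" "T (cscale a x) = cscale a (T x)" "norm (T x) \<le> norm x" for x y a
    using assms by (auto simp: ccontraction_def)
  show "T (x - y) = T x - T y" using *(1)[of "x - y" y] by simp
  show "T 0 = 0" using *(2)[of 0 0] by simp
qed

lemma ccontraction_bounded_linear:
  assumes "ccontraction T" shows "bounded_linear T"
  by (rule bounded_linear_intro[of _ 1])
    (use ccontractionD[OF assms] in \<open>auto simp: scaleR_cscale\<close>)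

lemma ccontraction_funpow: "ccontraction T \<Longrightarrow> ccontraction (T ^^ n)"
proof (induction n)
  case (Suc n)
  then show ?case by (auto simp: ccontraction_def intro: order_trans)
qed (simp add: ccontraction_def)

text \<open>Discrete orthogonality of characters, in place of integration over the circle. Since
  \<open>\<theta> l ^ c = \<theta> c ^ l\<close>, the summands are the powers of a single N-th root
  of unity \<open>q\<close>, which differs from 1 unless \<open>a = b\<close>.\<close>

lemma sum_roots_unity_orthogonal:
  assumes "a < N" "b < N"
  shows "(\<Sum>l<N. cis (2 * pi * real l / real N) ^ a * cnj (cis (2 * pi * real l / real N)) ^ b)
    = (if a = b then of_nat N else 0)"
proof -
  define \<theta> where "\<theta> l = cis (2 * pi * real l / real N)" for l :: nat
  have N: "N > 0" using assms by simp
  have cnj1: "\<theta> l * cnj (\<theta> l) = 1" for l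
    by (simp add: \<theta>_def cis_cnj cis_mult)
  define q where "q = \<theta> a * cnj (\<theta> b)"
  have "\<theta> l ^ c = \<theta> c ^ l" for l c
    unfolding \<theta>_def Complex.DeMoivre by (intro arg_cong[where f = cis]) (simp add: mult_ac)
  then have q: "\<theta> l ^ a * cnj (\<theta> l) ^ b = q ^ l" for l
    by (simp add: q_def power_mult_distrib flip: complex_cnj_power)
  have "q ^ N = 1"
  proof -
    have "\<theta> c ^ N = 1" for c
      unfolding \<theta>_def Complex.DeMoivre using N by (simp add: cis_multiple_2pi)
    then show ?thesis by (simp add: q_def power_mult_distrib flip: complex_cnj_power)
  qed
  show ?thesis
  proof (cases "a = b")
    case True
    then show ?thesis using cnj1 by (simp flip: \<theta>_def power_mult_distrib)
  next
    case False
    have "\<theta> a \<noteq> \<theta> b"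
      using Complex.bij_betw_roots_unity[OF N] False assms
      by (auto simp: bij_betw_def inj_on_def \<theta>_def)
    have "q \<noteq> 1"
    proof
      assume "q = 1"
      then have "\<theta> a * (cnj (\<theta> b) * \<theta> b) = \<theta> b" by (simp add: q_def mult.assoc[symmetric])
      then show False using cnj1[of b] \<open>\<theta> a \<noteq> \<theta> b\<close> by (simp add: mult.commute)
    qed
    then have "(\<Sum>l<N. q ^ l) = 0" using \<open>q ^ N = 1\<close> by (simp add: geometric_sum)
    then show ?thesis using False q by (simp flip: \<theta>_def)
  qed
qed

text \<open>Up to the cut-off \<open>M\<close>, these forms are the densities of the semi-spectral measure of \<open>T\<close>:
  positive semidefinite, with \<open>k\<close>-th moment \<open>cinner (T\<^sup>k x) y\<close>.\<close>

definition trunc_resolvent :: "('h::cinner_space \<Rightarrow> 'h) \<Rightarrow> nat \<Rightarrow> complex \<Rightarrow> 'h \<Rightarrow> 'h" where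
  "trunc_resolvent T M \<theta> x = (\<Sum>m<M. cscale (cnj \<theta> ^ m) ((T ^^ m) x))"

definition defect_form :: "('h::cinner_space \<Rightarrow> 'h) \<Rightarrow> 'h \<Rightarrow> 'h \<Rightarrow> complex" where
  "defect_form T p q = cinner p q - cinner (T p) (T q)"

definition poisson_form :: "('h::cinner_space \<Rightarrow> 'h) \<Rightarrow> nat \<Rightarrow> complex \<Rightarrow> 'h \<Rightarrow> 'h \<Rightarrow> complex" where
  "poisson_form T M \<theta> x y = defect_form T (trunc_resolvent T M \<theta> x) (trunc_resolvent T M \<theta> y)"

lemma defect_form_self:
  "Re (defect_form T p p) = (norm p)\<^sup>2 - (norm (T p))\<^sup>2"
  by (simp add: defect_form_def Re_cinner_self)

lemma defect_form_nonneg: "ccontraction T \<Longrightarrow> Re (defect_form T p p) \<ge> 0"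
  by (simp add: defect_form_self ccontractionD(3) power_mono)

text \<open>Positivity of the defect form at \<open>g p - q\<close> and at
  \<open>p - cnj g q\<close>. Being able to charge the scalar to either argument is what gives both
  the column and the row inequality.\<close>

lemma defect_form_bound:
  assumes T: "ccontraction T"
  shows "2 * Re (g * defect_form T p q) \<le> (cmod g)\<^sup>2 * Re (defect_form T p p) + Re (defect_form T q q)"
    and "2 * Re (g * defect_form T p q) \<le> Re (defect_form T p p) + (cmod g)\<^sup>2 * Re (defect_form T q q)"
proof -
  have "0 \<le> Re (defect_form T (cscale g p - q) (cscale g p - q))"
    by (rule defect_form_nonneg[OF T])
  also have "\<dots> = (cmod g)\<^sup>2 * Re (defect_form T p p) + Re (defect_form T q q)
      - 2 * Re (g * defect_form T p q)"
    unfolding defect_form_self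
    by (simp add: defect_form_def ccontractionD[OF T] norm_diff_sq norm_cscale cinner_simps algebra_simps
        power_mult_distrib del: times_complex.sel)
  finally show "2 * Re (g * defect_form T p q) \<le> (cmod g)\<^sup>2 * Re (defect_form T p p) + Re (defect_form T q q)"
    by simp
  have "0 \<le> Re (defect_form T (p - cscale (cnj g) q) (p - cscale (cnj g) q))"
    by (rule defect_form_nonneg[OF T])
  also have "\<dots> = Re (defect_form T p p) + (cmod g)\<^sup>2 * Re (defect_form T q q)
      - 2 * Re (g * defect_form T p q)"
    unfolding defect_form_self
    by (simp add: defect_form_def ccontractionD[OF T] norm_diff_sq norm_cscale cinner_simps algebra_simps
        power_mult_distrib del: times_complex.sel)
  finally show "2 * Re (g * defect_form T p q) \<le> Re (defect_form T p p) + (cmod g)\<^sup>2 * Re (defect_form T q q)"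
    by simp
qed

lemma poisson_form_expand:
  assumes T: "ccontraction T"
  shows "poisson_form T M \<theta> x y = (\<Sum>m<M. \<Sum>m'<M. cnj \<theta> ^ m * \<theta> ^ m' *
    (cinner ((T ^^ m) x) ((T ^^ m') y) - cinner ((T ^^ Suc m) x) ((T ^^ Suc m') y)))"
proof -
  interpret T: bounded_linear T by (rule ccontraction_bounded_linear[OF T])
  show ?thesis
    unfolding poisson_form_def defect_form_def trunc_resolvent_def T.sum
    by (subst sum.swap) (simp add: cinner_sum_left cinner_sum_right cinner_simps ccontractionD[OF T] sum_subtractf[symmetric]
        sum_distrib_left algebra_simps)
qed

text \<open>Averaging keeps only the terms with \<open>m = m' + k\<close>, and along this diagonal
  the differences telescope. The condition \<open>M + k \<le> N\<close> keeps all exponents below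
  \<open>N\<close>, so that no two of them agree modulo \<open>N\<close>; the cut-off leaves one
  boundary term at the power \<open>M\<close>.\<close>

lemma poisson_form_moment:
  assumes T: "ccontraction T" and k: "k \<le> M" and N: "M + k \<le> N"
  shows "(\<Sum>l<N. cis (2 * pi * real l / real N) ^ k * poisson_form T M (cis (2 * pi * real l / real N)) x y)
    = of_nat N * (cinner ((T ^^ k) x) y - cinner ((T ^^ M) x) ((T ^^ (M - k)) y))"
proof -
  define \<theta> where "\<theta> l = cis (2 * pi * real l / real N)" for l :: nat
  define \<Delta> where "\<Delta> m m' = cinner ((T ^^ m) x) ((T ^^ m') y) - cinner ((T ^^ Suc m) x) ((T ^^ Suc m') y)" for m m'
  define t where "t i = cinner ((T ^^ (i + k)) x) ((T ^^ i) y)" for i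
  have "(\<Sum>l<N. \<theta> l ^ k * poisson_form T M (\<theta> l) x y)
    = (\<Sum>l<N. \<Sum>m<M. \<Sum>m'<M. \<Delta> m m' * (\<theta> l ^ (m' + k) * cnj (\<theta> l) ^ m))"
    unfolding poisson_form_expand[OF T] \<Delta>_def[symmetric]
    by (simp add: sum_distrib_left power_add mult_ac)
  also have "\<dots> = (\<Sum>m<M. \<Sum>l<N. \<Sum>m'<M. \<Delta> m m' * (\<theta> l ^ (m' + k) * cnj (\<theta> l) ^ m))"
    by (rule sum.swap)
  also have "\<dots> = (\<Sum>m<M. \<Sum>m'<M. \<Sum>l<N. \<Delta> m m' * (\<theta> l ^ (m' + k) * cnj (\<theta> l) ^ m))"
    by (intro sum.cong refl sum.swap)
  also have "\<dots> = (\<Sum>m<M. \<Sum>m'<M. if m = m' + k then of_nat N * \<Delta> m m' else 0)"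
  proof (intro sum.cong refl)
    fix m m' assume "m \<in> {..<M}" "m' \<in> {..<M}"
    then have "m' + k < N" "m < N" using N by auto
    from sum_roots_unity_orthogonal[OF this]
    show "(\<Sum>l<N. \<Delta> m m' * (\<theta> l ^ (m' + k) * cnj (\<theta> l) ^ m))
        = (if m = m' + k then of_nat N * \<Delta> m m' else 0)"
      by (auto simp: \<theta>_def sum_distrib_left[symmetric])
  qed
  also have "\<dots> = (\<Sum>m'<M. \<Sum>m<M. if m = m' + k then of_nat N * \<Delta> m m' else 0)"
    by (rule sum.swap)
  \<comment> \<open>The inner sum has its single nonzero term only if \<open>m' + k < M\<close>,
    which is why the telescope ends at \<open>M - k\<close>.\<close>
  also have "\<dots> = (\<Sum>m'<M. if m' < M - k then of_nat N * (t m' - t (Suc m')) else 0)"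
    using k by (intro sum.cong refl) (auto simp: \<Delta>_def t_def)
  also have "\<dots> = (\<Sum>m'<M - k. of_nat N * (t m' - t (Suc m')))"
    by (intro sum.mono_neutral_cong_right) auto
  also have "\<dots> = of_nat N * (t 0 - t (M - k))"
    by (simp add: sum_distrib_left[symmetric] sum_lessThan_telescope')
  finally show ?thesis using k by (simp add: \<theta>_def t_def)
qed

section \<open>Power series in a contraction and their vector-valued bounds\<close>

definition pser :: "(nat \<Rightarrow> complex) \<Rightarrow> ('h::chilbert_space \<Rightarrow> 'h) \<Rightarrow> 'h \<Rightarrow> 'h" where
  "pser d T x = (\<Sum>k. cscale (d k) ((T ^^ k) x))"

lemma pser_summable:
  fixes T :: "'h::chilbert_space \<Rightarrow> 'h"
  assumes T: "ccontraction T" and d: "summable (\<lambda>k. cmod (d k))"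
  shows "summable (\<lambda>k. norm (cscale (d k) ((T ^^ k) x)))" "summable (\<lambda>k. cscale (d k) ((T ^^ k) x))"
proof -
  show "summable (\<lambda>k. norm (cscale (d k) ((T ^^ k) x)))"
  proof (rule summable_comparison_test')
    show "summable (\<lambda>k. cmod (d k) * norm x)" using d by (rule summable_mult2)
    show "norm (norm (cscale (d k) ((T ^^ k) x))) \<le> cmod (d k) * norm x" for k
      using ccontractionD(3)[OF ccontraction_funpow[OF T]] by (simp add: norm_cscale mult_left_mono)
  qed
  then show "summable (\<lambda>k. cscale (d k) ((T ^^ k) x))" by (rule summable_norm_cancel)
qed

lemma pser_sums:
  assumes "ccontraction T" "summable (\<lambda>k. cmod (d k))"
  shows "(\<lambda>k. cscale (d k) ((T ^^ k) x)) sums pser d T x"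
  unfolding pser_def using pser_summable(2)[OF assms] by (rule summable_sums)

text \<open>The pairing is an average over roots of unity of \<open>p n l * b l (x n) (y n)\<close>.
  The pointwise bound for the form turns the sum over \<open>n\<close> of squared scalars into
  \<open>A\<close>, and the averaged forms have total mass at most the squared norm. Decay of the
  powers removes the cut-off term. The two alternatives in \<open>xy\<close> lead to columns and to
  rows respectively.\<close>

lemma von_Neumann_poly_decaying:
  fixes T :: "'h::chilbert_space \<Rightarrow> 'h"
  assumes T: "ccontraction T" and F: "finite F"
    and decay: "\<And>x. (\<lambda>M. norm ((T ^^ M) x)) \<longlonglongrightarrow> 0"
    and bound: "\<And>\<zeta>. cmod \<zeta> = 1 \<Longrightarrow> (\<Sum>n\<in>F. (cmod (\<Sum>k<K. d n k * \<zeta> ^ k))\<^sup>2) \<le> A"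
    and xy: "(\<forall>n. x n = x0 \<and> y n = z n) \<or> (\<forall>n. x n = z n \<and> y n = x0)"
  shows "2 * Re (\<Sum>n\<in>F. \<Sum>k<K. d n k * cinner ((T ^^ k) (x n)) (y n))
    \<le> A * (norm x0)\<^sup>2 + (\<Sum>n\<in>F. (norm (z n))\<^sup>2)"
proof -
  \<comment> \<open>The boundary term that the moment formula leaves at cut-off
    \<open>M\<close>.\<close>
  define err where "err M = (\<Sum>n\<in>F. \<Sum>k<K. d n k * cinner ((T ^^ M) (x n)) ((T ^^ (M - k)) (y n)))" for M
  let ?X = "\<Sum>n\<in>F. \<Sum>k<K. d n k * cinner ((T ^^ k) (x n)) (y n)"
  let ?Y = "A * (norm x0)\<^sup>2 + (\<Sum>n\<in>F. (norm (z n))\<^sup>2)"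
  have A: "A \<ge> 0"
  proof -
    have "0 \<le> (\<Sum>n\<in>F. (cmod (\<Sum>k<K. d n k * 1 ^ k))\<^sup>2)" by (intro sum_nonneg) simp
    then show ?thesis using bound[of 1] by simp
  qed
  have main: "2 * Re (?X - err M) \<le> ?Y" if M: "K \<le> M" "0 < M" for M
  proof -
    define N where "N = M + K"
    have N0: "real N > 0" using M by (simp add: N_def)
    define \<theta> where "\<theta> l = cis (2 * pi * real l / real N)" for l :: nat
    define p where "p n l = (\<Sum>k<K. d n k * \<theta> l ^ k)" for n l
    define b where "b l u v = poisson_form T M (\<theta> l) u v" for l u v
    \<comment> \<open>The zeroth moment: the total mass is the squared norm of \<open>u\<close>
      minus that of \<open>(T ^^ M) u\<close>.\<close>
    have mass: "(\<Sum>l<N. Re (b l u u)) \<le> N * (norm u)\<^sup>2" for u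
    proof -
      have "(\<Sum>l<N. \<theta> l ^ 0 * b l u u)
          = of_nat N * (cinner ((T ^^ 0) u) u - cinner ((T ^^ M) u) ((T ^^ (M - 0)) u))"
        unfolding b_def \<theta>_def using M N_def by (intro poisson_form_moment[OF T]) auto
      then have "Re (\<Sum>l<N. b l u u) = N * ((norm u)\<^sup>2 - (norm ((T ^^ M) u))\<^sup>2)"
        by (simp add: Re_cinner_self)
      also have "\<dots> \<le> N * (norm u)\<^sup>2" by (intro mult_left_mono) auto
      finally show ?thesis by simp
    qed
    have "of_nat N * (?X - err M) = (\<Sum>n\<in>F. \<Sum>k<K. d n k * (\<Sum>l<N. \<theta> l ^ k * b l (x n) (y n)))"
    proof -
      have "(\<Sum>l<N. \<theta> l ^ k * b l (x n) (y n)) = of_nat N *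
          (cinner ((T ^^ k) (x n)) (y n) - cinner ((T ^^ M) (x n)) ((T ^^ (M - k)) (y n)))" if "k < K" for k n
        unfolding b_def \<theta>_def using that M by (intro poisson_form_moment[OF T]) (auto simp: N_def)
      then have "(\<Sum>n\<in>F. \<Sum>k<K. d n k * (\<Sum>l<N. \<theta> l ^ k * b l (x n) (y n)))
          = (\<Sum>n\<in>F. \<Sum>k<K. d n k * (of_nat N *
          (cinner ((T ^^ k) (x n)) (y n) - cinner ((T ^^ M) (x n)) ((T ^^ (M - k)) (y n)))))"
        by (intro sum.cong refl) simp
      then show ?thesis
        by (simp add: err_def sum_subtractf[symmetric] sum_distrib_left algebra_simps)
    qed
    also have "\<dots> = (\<Sum>n\<in>F. \<Sum>l<N. p n l * b l (x n) (y n))"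
    proof (rule sum.cong[OF refl])
      fix n
      have "(\<Sum>k<K. d n k * (\<Sum>l<N. \<theta> l ^ k * b l (x n) (y n)))
          = (\<Sum>k<K. \<Sum>l<N. d n k * \<theta> l ^ k * b l (x n) (y n))"
        by (simp add: sum_distrib_left mult.assoc)
      also have "\<dots> = (\<Sum>l<N. \<Sum>k<K. d n k * \<theta> l ^ k * b l (x n) (y n))" by (rule sum.swap)
      finally show "(\<Sum>k<K. d n k * (\<Sum>l<N. \<theta> l ^ k * b l (x n) (y n))) = (\<Sum>l<N. p n l * b l (x n) (y n))"
        by (simp add: p_def sum_distrib_right)
    qed
    also have "\<dots> = (\<Sum>l<N. \<Sum>n\<in>F. p n l * b l (x n) (y n))" by (rule sum.swap)
    finally have eq: "of_nat N * (?X - err M) = (\<Sum>l<N. \<Sum>n\<in>F. p n l * b l (x n) (y n))" .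
    have "real N * (2 * Re (?X - err M)) = 2 * Re (of_nat N * (?X - err M))" by simp
    also have "\<dots> = (\<Sum>l<N. \<Sum>n\<in>F. 2 * Re (p n l * b l (x n) (y n)))"
      unfolding eq by (simp add: sum_distrib_left del: times_complex.sel)
    also have "\<dots> \<le> (\<Sum>l<N. A * Re (b l x0 x0) + (\<Sum>n\<in>F. Re (b l (z n) (z n))))"
    proof (rule sum_mono)
      fix l
      have nn: "Re (b l x0 x0) \<ge> 0" unfolding b_def poisson_form_def by (rule defect_form_nonneg[OF T])
      have "(\<Sum>n\<in>F. 2 * Re (p n l * b l (x n) (y n)))
          \<le> (\<Sum>n\<in>F. (cmod (p n l))\<^sup>2 * Re (b l x0 x0) + Re (b l (z n) (z n)))"
      proof (rule sum_mono)
        fix n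
        show "2 * Re (p n l * b l (x n) (y n)) \<le> (cmod (p n l))\<^sup>2 * Re (b l x0 x0) + Re (b l (z n) (z n))"
          using xy defect_form_bound[OF T, of "p n l"]
          unfolding b_def poisson_form_def by (auto simp: add.commute)
      qed
      also have "\<dots> = (\<Sum>n\<in>F. (cmod (p n l))\<^sup>2) * Re (b l x0 x0) + (\<Sum>n\<in>F. Re (b l (z n) (z n)))"
        by (simp add: sum.distrib sum_distrib_right)
      also have "\<dots> \<le> A * Re (b l x0 x0) + (\<Sum>n\<in>F. Re (b l (z n) (z n)))"
        using bound[of "\<theta> l"] nn by (intro add_right_mono mult_right_mono) (auto simp: p_def \<theta>_def)
      finally show "(\<Sum>n\<in>F. 2 * Re (p n l * b l (x n) (y n)))
          \<le> A * Re (b l x0 x0) + (\<Sum>n\<in>F. Re (b l (z n) (z n)))" .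
    qed
    also have "\<dots> = A * (\<Sum>l<N. Re (b l x0 x0)) + (\<Sum>n\<in>F. \<Sum>l<N. Re (b l (z n) (z n)))"
      by (simp add: sum.distrib sum_distrib_left sum.swap[of _ F])
    also have "\<dots> \<le> A * (N * (norm x0)\<^sup>2) + (\<Sum>n\<in>F. N * (norm (z n))\<^sup>2)"
      by (intro add_mono mult_left_mono mass A sum_mono)
    also have "\<dots> = real N * ?Y" by (simp add: sum_distrib_left algebra_simps)
    finally show ?thesis using N0 by (simp only: mult_le_cancel_left_pos)
  qed
  have "err \<longlonglongrightarrow> 0"
    unfolding err_def
  proof (intro tendsto_null_sum tendsto_mult_right_zero)
    fix n k
    show "(\<lambda>M. cinner ((T ^^ M) (x n)) ((T ^^ (M - k)) (y n))) \<longlonglongrightarrow> 0"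
    proof (rule Lim_null_comparison)
      show "(\<lambda>M. norm ((T ^^ M) (x n)) * norm (y n)) \<longlonglongrightarrow> 0"
        using decay by (rule tendsto_mult_left_zero)
      show "\<forall>\<^sub>F M in sequentially. cmod (cinner ((T ^^ M) (x n)) ((T ^^ (M - k)) (y n)))
          \<le> norm ((T ^^ M) (x n)) * norm (y n)"
        by (intro always_eventually allI order_trans[OF cinner_Cauchy_Schwarz] mult_left_mono
            ccontractionD(3)[OF ccontraction_funpow[OF T]]) simp
    qed
  qed
  then have lim: "(\<lambda>M. 2 * Re (?X - err M)) \<longlonglongrightarrow> 2 * Re (?X - 0)"
    by (intro tendsto_intros)
  have "2 * Re (?X - 0) \<le> ?Y"
    by (rule LIMSEQ_le_const2[OF lim]) (use main in \<open>auto intro!: exI[of _ "Suc K"]\<close>)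
  then show ?thesis by simp
qed

text \<open>The contraction \<open>\<rho>T\<close> with \<open>\<rho> < 1\<close> has decaying
  powers, and both sides are continuous as \<open>\<rho>\<close> tends to 1 because only finitely
  many powers occur.\<close>

lemma von_Neumann_poly:
  fixes T :: "'h::chilbert_space \<Rightarrow> 'h"
  assumes T: "ccontraction T" and F: "finite F"
    and bound: "\<And>\<zeta>. cmod \<zeta> = 1 \<Longrightarrow> (\<Sum>n\<in>F. (cmod (\<Sum>k<K. d n k * \<zeta> ^ k))\<^sup>2) \<le> A"
    and xy: "(\<forall>n. x n = x0 \<and> y n = z n) \<or> (\<forall>n. x n = z n \<and> y n = x0)"
  shows "2 * Re (\<Sum>n\<in>F. \<Sum>k<K. d n k * cinner ((T ^^ k) (x n)) (y n))
    \<le> A * (norm x0)\<^sup>2 + (\<Sum>n\<in>F. (norm (z n))\<^sup>2)"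
proof -
  let ?g = "\<lambda>\<rho>::real. 2 * Re (\<Sum>n\<in>F. \<Sum>k<K. d n k * (complex_of_real \<rho> ^ k * cinner ((T ^^ k) (x n)) (y n)))"
  have le: "?g \<rho> \<le> A * (norm x0)\<^sup>2 + (\<Sum>n\<in>F. (norm (z n))\<^sup>2)" if \<rho>: "0 < \<rho>" "\<rho> < 1" for \<rho>
  proof -
    define S where "S x = cscale (complex_of_real \<rho>) (T x)" for x
    have pow: "(S ^^ k) x = cscale (complex_of_real \<rho> ^ k) ((T ^^ k) x)" for k x
      by (induction k) (simp_all add: S_def ccontractionD[OF T] cscale_cscale cscale_one)
    have nT: "norm ((T ^^ k) x) \<le> norm x" for k x
      by (rule ccontractionD(3)[OF ccontraction_funpow[OF T]])
    have S: "ccontraction S"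
    proof -
      have "\<rho> * norm (T x) \<le> norm x" for x
        using mult_mono[of \<rho> 1 "norm (T x)" "norm x"] \<rho> nT[of 1 x] by simp
      then show ?thesis using \<rho>
        by (simp add: ccontraction_def S_def ccontractionD[OF T] cscale_add_right cscale_cscale
            norm_cscale mult.commute)
    qed
    have decay: "(\<lambda>M. norm ((S ^^ M) x)) \<longlonglongrightarrow> 0" for x
    proof (rule Lim_null_comparison)
      show "(\<lambda>M. \<rho> ^ M * norm x) \<longlonglongrightarrow> 0"
        using \<rho> by (intro tendsto_mult_left_zero LIMSEQ_realpow_zero) auto
      show "\<forall>\<^sub>F M in sequentially. norm (norm ((S ^^ M) x)) \<le> \<rho> ^ M * norm x"
        using nT \<rho> by (intro always_eventually allI) (simp add: pow norm_cscale norm_power mult_left_mono)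
    qed
    show ?thesis
      using von_Neumann_poly_decaying[OF S F decay bound xy] by (simp add: pow cinner_simps)
  qed
  have "(?g \<longlongrightarrow> ?g 1) (at_left 1)"
    by (intro tendsto_intros)
  moreover have "\<forall>\<^sub>F \<rho> in at_left 1. ?g \<rho> \<le> A * (norm x0)\<^sup>2 + (\<Sum>n\<in>F. (norm (z n))\<^sup>2)"
    using eventually_at_left_real[OF zero_less_one] by eventually_elim (use le in auto)
  ultimately have "?g 1 \<le> A * (norm x0)\<^sup>2 + (\<Sum>n\<in>F. (norm (z n))\<^sup>2)"
    by (rule tendsto_upperbound) simp
  then show ?thesis by simp
qed

text \<open>Absolute summability makes the partial sums converge uniformly on the circle, so
  truncating at \<open>K\<close> raises the bound \<open>A\<close> by at most \<open>E K\<close>,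
  which tends to 0.\<close>

lemma von_Neumann_form:
  fixes T :: "'h::chilbert_space \<Rightarrow> 'h"
  assumes T: "ccontraction T" and F: "finite F"
    and d: "\<And>n. n \<in> F \<Longrightarrow> summable (\<lambda>k. cmod (d n k))"
    and bound: "\<And>\<zeta>. cmod \<zeta> = 1 \<Longrightarrow> (\<Sum>n\<in>F. (cmod (\<Sum>k. d n k * \<zeta> ^ k))\<^sup>2) \<le> A"
    and xy: "(\<forall>n. x n = x0 \<and> y n = z n) \<or> (\<forall>n. x n = z n \<and> y n = x0)"
  shows "2 * Re (\<Sum>n\<in>F. cinner (pser (d n) T (x n)) (y n)) \<le> A * (norm x0)\<^sup>2 + (\<Sum>n\<in>F. (norm (z n))\<^sup>2)"
proof -
  define C where "C n = (\<Sum>k. cmod (d n k))" for n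
  define \<tau> where "\<tau> n K = C n - (\<Sum>k<K. cmod (d n k))" for n K
  define E where "E K = (\<Sum>n\<in>F. 2 * C n * \<tau> n K + (\<tau> n K)\<^sup>2)" for K
  have "\<tau> n \<longlonglongrightarrow> C n - C n" if "n \<in> F" for n
    unfolding \<tau>_def C_def by (intro tendsto_diff tendsto_const summable_LIMSEQ d that)
  then have \<tau>0: "\<tau> n \<longlonglongrightarrow> 0" if "n \<in> F" for n using that by simp
  have "E \<longlonglongrightarrow> (\<Sum>n\<in>F. 2 * C n * 0 + 0\<^sup>2)"
    unfolding E_def by (intro tendsto_intros \<tau>0)
  then have E0: "E \<longlonglongrightarrow> 0" by simp
  have le: "2 * Re (\<Sum>n\<in>F. \<Sum>k<K. d n k * cinner ((T ^^ k) (x n)) (y n))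
      \<le> (A + E K) * (norm x0)\<^sup>2 + (\<Sum>n\<in>F. (norm (z n))\<^sup>2)" for K
  proof (rule von_Neumann_poly[OF T F _ xy])
    fix \<zeta> :: complex assume \<zeta>: "cmod \<zeta> = 1"
    have "(\<Sum>n\<in>F. (cmod (\<Sum>k<K. d n k * \<zeta> ^ k))\<^sup>2)
        \<le> (\<Sum>n\<in>F. (cmod (\<Sum>k. d n k * \<zeta> ^ k))\<^sup>2 + (2 * C n * \<tau> n K + (\<tau> n K)\<^sup>2))"
    proof (rule sum_mono)
      fix n assume n: "n \<in> F"
      let ?g = "\<Sum>k. d n k * \<zeta> ^ k" and ?p = "\<Sum>k<K. d n k * \<zeta> ^ k"
      have nrm: "cmod (d n k * \<zeta> ^ k) = cmod (d n k)" for k by (simp add: norm_mult norm_power \<zeta>)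
      have s: "summable (\<lambda>k. cmod (d n k * \<zeta> ^ k))" unfolding nrm by (rule d[OF n])
      have g: "cmod ?g \<le> C n" using summable_norm[OF s] by (simp only: nrm C_def)
      have "?g - ?p = (\<Sum>k. d n (k + K) * \<zeta> ^ (k + K))"
        using suminf_minus_initial_segment[OF summable_norm_cancel[OF s], of K] by simp
      also have "cmod \<dots> \<le> (\<Sum>k. cmod (d n (k + K) * \<zeta> ^ (k + K)))"
        by (rule summable_norm) (rule summable_ignore_initial_segment[OF s])
      also have "\<dots> = \<tau> n K"
        unfolding nrm \<tau>_def C_def by (rule suminf_minus_initial_segment[OF d[OF n]])
      finally have diff: "cmod (?g - ?p) \<le> \<tau> n K" .
      then have \<tau>: "\<tau> n K \<ge> 0" by (rule order_trans[OF norm_ge_zero])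
      have "cmod ?p \<le> cmod ?g + \<tau> n K" using diff norm_triangle_ineq2[of ?p ?g] by (simp add: norm_minus_commute)
      then have "(cmod ?p)\<^sup>2 \<le> (cmod ?g + \<tau> n K)\<^sup>2" by (rule power_mono) simp
      also have "\<dots> = (cmod ?g)\<^sup>2 + (2 * cmod ?g * \<tau> n K + (\<tau> n K)\<^sup>2)" by (simp add: power2_sum)
      also have "\<dots> \<le> (cmod ?g)\<^sup>2 + (2 * C n * \<tau> n K + (\<tau> n K)\<^sup>2)"
        using g \<tau> by (intro add_mono mult_right_mono mult_left_mono) auto
      finally show "(cmod ?p)\<^sup>2 \<le> (cmod ?g)\<^sup>2 + (2 * C n * \<tau> n K + (\<tau> n K)\<^sup>2)" .
    qed
    also have "\<dots> \<le> A + E K" using bound[OF \<zeta>] by (simp add: sum.distrib E_def)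
    finally show "(\<Sum>n\<in>F. (cmod (\<Sum>k<K. d n k * \<zeta> ^ k))\<^sup>2) \<le> A + E K" .
  qed
  have lim1: "(\<lambda>K. 2 * Re (\<Sum>n\<in>F. \<Sum>k<K. d n k * cinner ((T ^^ k) (x n)) (y n)))
      \<longlonglongrightarrow> 2 * Re (\<Sum>n\<in>F. cinner (pser (d n) T (x n)) (y n))"
  proof (intro tendsto_intros)
    fix n assume n: "n \<in> F"
    have "(\<lambda>K. cinner (\<Sum>k<K. cscale (d n k) ((T ^^ k) (x n))) (y n)) \<longlonglongrightarrow> cinner (pser (d n) T (x n)) (y n)"
      using pser_sums[OF T d[OF n], of "x n"] by (intro tendsto_cinner tendsto_const) (simp add: sums_def)
    then show "(\<lambda>K. \<Sum>k<K. d n k * cinner ((T ^^ k) (x n)) (y n)) \<longlonglongrightarrow> cinner (pser (d n) T (x n)) (y n)"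
      by (simp add: cinner_sum_left cinner_simps)
  qed
  have "(\<lambda>K. (A + E K) * (norm x0)\<^sup>2 + (\<Sum>n\<in>F. (norm (z n))\<^sup>2))
      \<longlonglongrightarrow> (A + 0) * (norm x0)\<^sup>2 + (\<Sum>n\<in>F. (norm (z n))\<^sup>2)"
    by (intro tendsto_intros E0)
  from LIMSEQ_le[OF lim1 this] le
  have "2 * Re (\<Sum>n\<in>F. cinner (pser (d n) T (x n)) (y n)) \<le> (A + 0) * (norm x0)\<^sup>2 + (\<Sum>n\<in>F. (norm (z n))\<^sup>2)"
    by blast
  then show ?thesis by simp
qed

text \<open>Pairing the column with itself gives \<open>2 S \<le> A * (norm x)^2 + S\<close> for the
  sum of squares \<open>S\<close>, so the constant \<open>A\<close> is recovered without
  loss.\<close>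

lemma von_Neumann_column:
  fixes T :: "'h::chilbert_space \<Rightarrow> 'h"
  assumes T: "ccontraction T" and F: "finite F"
    and d: "\<And>n. n \<in> F \<Longrightarrow> summable (\<lambda>k. cmod (d n k))"
    and bound: "\<And>\<zeta>. cmod \<zeta> = 1 \<Longrightarrow> (\<Sum>n\<in>F. (cmod (\<Sum>k. d n k * \<zeta> ^ k))\<^sup>2) \<le> A"
  shows "(\<Sum>n\<in>F. (norm (pser (d n) T x))\<^sup>2) \<le> A * (norm x)\<^sup>2"
proof -
  have "2 * Re (\<Sum>n\<in>F. cinner (pser (d n) T x) (pser (d n) T x))
      \<le> A * (norm x)\<^sup>2 + (\<Sum>n\<in>F. (norm (pser (d n) T x))\<^sup>2)"
    by (rule von_Neumann_form[OF T F d bound]) auto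
  then show ?thesis by (simp add: Re_cinner_self)
qed

lemma von_Neumann_row:
  fixes T :: "'h::chilbert_space \<Rightarrow> 'h"
  assumes T: "ccontraction T" and F: "finite F"
    and d: "\<And>n. n \<in> F \<Longrightarrow> summable (\<lambda>k. cmod (d n k))"
    and bound: "\<And>\<zeta>. cmod \<zeta> = 1 \<Longrightarrow> (\<Sum>n\<in>F. (cmod (\<Sum>k. d n k * \<zeta> ^ k))\<^sup>2) \<le> A"
    and A: "A > 0"
  shows "(norm (\<Sum>n\<in>F. pser (d n) T (x n)))\<^sup>2 \<le> A * (\<Sum>n\<in>F. (norm (x n))\<^sup>2)"
proof -
  define w where "w = (\<Sum>n\<in>F. pser (d n) T (x n))"
  \<comment> \<open>With the factor \<open>1 / A\<close>, the cost \<open>A * (norm ?y)^2\<close> is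
    exactly half of the pairing and can be absorbed.\<close>
  let ?y = "cscale (complex_of_real (1 / A)) w"
  have "2 * Re (\<Sum>n\<in>F. cinner (pser (d n) T (x n)) ?y) \<le> A * (norm ?y)\<^sup>2 + (\<Sum>n\<in>F. (norm (x n))\<^sup>2)"
    by (rule von_Neumann_form[OF T F d bound]) auto
  moreover have "(\<Sum>n\<in>F. cinner (pser (d n) T (x n)) ?y) = complex_of_real ((norm w)\<^sup>2 / A)"
    unfolding cinner_sum_left[symmetric] w_def[symmetric] by (simp add: cinner_simps cinner_self)
  moreover have "A * (norm ?y)\<^sup>2 = (norm w)\<^sup>2 / A"
    using A by (simp add: norm_cscale power_divide power2_eq_square norm_divide)
  ultimately have "2 * ((norm w)\<^sup>2 / A) \<le> (norm w)\<^sup>2 / A + (\<Sum>n\<in>F. (norm (x n))\<^sup>2)"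
    by (simp only: Re_complex_of_real)
  then have "(norm w)\<^sup>2 / A \<le> (\<Sum>n\<in>F. (norm (x n))\<^sup>2)" by simp
  then show ?thesis using A by (simp add: w_def pos_divide_le_eq mult.commute)
qed

lemma von_Neumann:
  fixes T :: "'h::chilbert_space \<Rightarrow> 'h"
  assumes T: "ccontraction T" and d: "summable (\<lambda>k. cmod (d k))" and C: "C \<ge> 0"
    and bound: "\<And>\<zeta>. cmod \<zeta> = 1 \<Longrightarrow> cmod (\<Sum>k. d k * \<zeta> ^ k) \<le> C"
  shows "norm (pser d T x) \<le> C * norm x"
proof -
  have "(\<Sum>n\<in>{()}. (norm (pser d T x))\<^sup>2) \<le> C\<^sup>2 * (norm x)\<^sup>2"
    using d bound by (intro von_Neumann_column[OF T]) (auto intro: power_mono)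
  then have "(norm (pser d T x))\<^sup>2 \<le> (C * norm x)\<^sup>2" by (simp add: power_mult_distrib)
  from power2_le_imp_le[OF this] C show ?thesis by simp
qed

section \<open>The functional calculus\<close>

definition disc_series :: "(nat \<Rightarrow> complex) \<Rightarrow> (complex \<Rightarrow> complex) \<Rightarrow> bool" where
  "disc_series c g \<longleftrightarrow> (\<forall>z. cmod z < 1 \<longrightarrow> (\<lambda>k. c k * z ^ k) sums g z)"

text \<open>Coefficients of \<open>g(r z)\<close>; for \<open>r < 1\<close>,
  \<open>pser (dilate c r) T\<close> is the operator \<open>g(rT)\<close>.\<close>

definition dilate :: "(nat \<Rightarrow> complex) \<Rightarrow> real \<Rightarrow> nat \<Rightarrow> complex" where
  "dilate c r k = c k * complex_of_real (r ^ k)"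

lemma summable_dilate:
  assumes "disc_series c g" "0 \<le> r" "r < 1"
  shows "summable (\<lambda>k. cmod (dilate c r k))"
proof -
  \<comment> \<open>Convergence at a radius strictly between \<open>r\<close> and 1 forces absolute
    convergence at \<open>r\<close>.\<close>
  define s where "s = (1 + r) / 2"
  have "0 \<le> s" "s < 1" using assms(2,3) by (auto simp: s_def)
  then have "cmod (complex_of_real s) < 1" by simp
  then have "summable (\<lambda>k. c k * complex_of_real s ^ k)"
    using assms(1) unfolding disc_series_def by (blast intro: sums_summable)
  then have "summable (\<lambda>k. norm (c k * complex_of_real r ^ k))"
    by (rule powser_insidea) (use assms(2,3) \<open>0 \<le> s\<close> in \<open>simp add: s_def del: of_real_divide of_real_add\<close>)
  then show ?thesis by (simp add: dilate_def)
qed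

lemma dilate_eval:
  assumes "disc_series c g" "0 \<le> r" "r < 1" "cmod \<zeta> = 1"
  shows "(\<lambda>k. dilate c r k * \<zeta> ^ k) sums g (complex_of_real r * \<zeta>)"
proof -
  have "cmod (complex_of_real r * \<zeta>) < 1" using assms by (simp add: norm_mult)
  then have "(\<lambda>k. c k * (complex_of_real r * \<zeta>) ^ k) sums g (complex_of_real r * \<zeta>)"
    using assms(1) by (simp add: disc_series_def)
  then show ?thesis by (simp add: dilate_def power_mult_distrib mult.assoc)
qed

lemma von_Neumann_column_dilate:
  fixes T :: "'h::chilbert_space \<Rightarrow> 'h"
  assumes T: "ccontraction T" and F: "finite F" and c: "\<And>n. n \<in> F \<Longrightarrow> disc_series (c n) (g n)"
    and bound: "\<And>z. cmod z < 1 \<Longrightarrow> (\<Sum>n\<in>F. (cmod (g n z))\<^sup>2) \<le> A" and r: "0 \<le> r" "r < 1"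
  shows "(\<Sum>n\<in>F. (norm (pser (dilate (c n) r) T x))\<^sup>2) \<le> A * (norm x)\<^sup>2"
proof (rule von_Neumann_column[OF T F summable_dilate[OF c r]])
  fix \<zeta> :: complex assume \<zeta>: "cmod \<zeta> = 1"
  have "(\<Sum>n\<in>F. (cmod (\<Sum>k. dilate (c n) r k * \<zeta> ^ k))\<^sup>2)
      = (\<Sum>n\<in>F. (cmod (g n (complex_of_real r * \<zeta>)))\<^sup>2)"
    using sums_unique[OF dilate_eval[OF c r \<zeta>]] by (intro sum.cong refl) simp
  also have "\<dots> \<le> A" using r \<zeta> by (intro bound) (simp add: norm_mult)
  finally show "(\<Sum>n\<in>F. (cmod (\<Sum>k. dilate (c n) r k * \<zeta> ^ k))\<^sup>2) \<le> A" .
qed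

lemma von_Neumann_row_dilate:
  fixes T :: "'h::chilbert_space \<Rightarrow> 'h"
  assumes T: "ccontraction T" and F: "finite F" and c: "\<And>n. n \<in> F \<Longrightarrow> disc_series (c n) (g n)"
    and bound: "\<And>z. cmod z < 1 \<Longrightarrow> (\<Sum>n\<in>F. (cmod (g n z))\<^sup>2) \<le> A" and r: "0 \<le> r" "r < 1"
    and A: "A > 0"
  shows "(norm (\<Sum>n\<in>F. pser (dilate (c n) r) T (x n)))\<^sup>2 \<le> A * (\<Sum>n\<in>F. (norm (x n))\<^sup>2)"
proof (rule von_Neumann_row[OF T F summable_dilate[OF c r] _ A])
  fix \<zeta> :: complex assume \<zeta>: "cmod \<zeta> = 1"
  have "(\<Sum>n\<in>F. (cmod (\<Sum>k. dilate (c n) r k * \<zeta> ^ k))\<^sup>2)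
      = (\<Sum>n\<in>F. (cmod (g n (complex_of_real r * \<zeta>)))\<^sup>2)"
    using sums_unique[OF dilate_eval[OF c r \<zeta>]] by (intro sum.cong refl) simp
  also have "\<dots> \<le> A" using r \<zeta> by (intro bound) (simp add: norm_mult)
  finally show "(\<Sum>n\<in>F. (cmod (\<Sum>k. dilate (c n) r k * \<zeta> ^ k))\<^sup>2) \<le> A" .
qed

section \<open>Algebra of power series in a contraction\<close>

lemma pser_diff_coeff:
  assumes "ccontraction T" "summable (\<lambda>k. cmod (d k))" "summable (\<lambda>k. cmod (e k))"
  shows "pser (\<lambda>k. d k - e k) T x = pser d T x - pser e T x"
  using sums_diff[OF pser_sums[OF assms(1,2), of x] pser_sums[OF assms(1,3), of x]]
  unfolding pser_def by (intro sums_unique[symmetric]) (simp add: cscale_diff_left)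

lemma pser_mult_coeff:
  assumes "ccontraction T" "summable (\<lambda>k. cmod (d k))"
  shows "pser (\<lambda>k. a * d k) T x = cscale a (pser d T x)"
  using bounded_linear.sums[OF bounded_linear_cscale_right pser_sums[OF assms, of x], of a]
  unfolding pser_def[of "\<lambda>k. a * d k"] by (intro sums_unique[symmetric]) (simp add: cscale_cscale)

lemma pser_add:
  assumes "ccontraction T" "summable (\<lambda>k. cmod (d k))"
  shows "pser d T (x + y) = pser d T x + pser d T y"
  using sums_add[OF pser_sums[OF assms, of x] pser_sums[OF assms, of y]]
  unfolding pser_def[of _ _ "x + y"]
  by (intro sums_unique[symmetric]) (simp add: cscale_add_right ccontractionD[OF ccontraction_funpow[OF assms(1)]])

lemma pser_cscale:
  assumes "ccontraction T" "summable (\<lambda>k. cmod (d k))"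
  shows "pser d T (cscale a x) = cscale a (pser d T x)"
  using bounded_linear.sums[OF bounded_linear_cscale_right pser_sums[OF assms, of x], of a]
  unfolding pser_def[of _ _ "cscale a x"]
  by (intro sums_unique[symmetric])
    (simp add: cscale_cscale ccontractionD[OF ccontraction_funpow[OF assms(1)]] mult.commute)

lemma pser_diff:
  assumes "ccontraction T" "summable (\<lambda>k. cmod (d k))"
  shows "pser d T (x - y) = pser d T x - pser d T y"
  using pser_add[OF assms, of "x - y" y] by simp

lemma pser_commute:
  assumes "ccontraction T" "summable (\<lambda>k. cmod (d k))"
  shows "pser d T (T x) = T (pser d T x)"
  using bounded_linear.sums[OF ccontraction_bounded_linear[OF assms(1)] pser_sums[OF assms, of x]]
  unfolding pser_def[of _ _ "T x"]
  by (intro sums_unique[symmetric]) (simp add: ccontractionD[OF assms(1)] funpow_swap1)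

text \<open>The sequence \<open>case_nat 0 d\<close> belongs to \<open>z g(z)\<close>:
  multiplication by \<open>z\<close> turns into one application of \<open>T\<close>.\<close>

lemma pser_shift:
  assumes "ccontraction T" "summable (\<lambda>k. cmod (d k))"
  shows "pser (case_nat 0 d) T x = T (pser d T x)"
proof -
  have "(\<lambda>k. cscale (case_nat 0 d (Suc k)) ((T ^^ Suc k) x)) sums T (pser d T x)"
    using bounded_linear.sums[OF ccontraction_bounded_linear[OF assms(1)] pser_sums[OF assms, of x]]
    by (simp add: ccontractionD[OF assms(1)])
  then have "(\<lambda>k. cscale (case_nat 0 d k) ((T ^^ k) x)) sums T (pser d T x)"
    by (subst (asm) sums_Suc_iff) simp
  then show ?thesis unfolding pser_def[of "case_nat 0 d"] by (rule sums_unique[symmetric])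
qed

lemma disc_series_shift:
  assumes "disc_series c g" shows "disc_series (case_nat 0 c) (\<lambda>z. z * g z)"
  unfolding disc_series_def
proof (intro allI impI)
  fix z :: complex assume "cmod z < 1"
  then have "(\<lambda>k. z * (c k * z ^ k)) sums (z * g z)"
    using assms by (intro sums_mult) (simp add: disc_series_def)
  then have "(\<lambda>k. case_nat 0 c (Suc k) * z ^ Suc k) sums (z * g z)" by (simp add: mult_ac)
  then show "(\<lambda>k. case_nat 0 c k * z ^ k) sums (z * g z)" by (subst (asm) sums_Suc_iff) simp
qed

lemma disc_series_diff:
  "disc_series c g \<Longrightarrow> disc_series c' g' \<Longrightarrow> disc_series (\<lambda>k. c k - c' k) (\<lambda>z. g z - g' z)"
  unfolding disc_series_def left_diff_distrib by (auto intro: sums_diff)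

lemma dilate_shift: "dilate (case_nat 0 c) r = (\<lambda>k. complex_of_real r * case_nat 0 (dilate c r) k)"
  by (auto simp: dilate_def split: nat.split)

lemma dilate_diff: "dilate (\<lambda>k. c k - c' k) r = (\<lambda>k. dilate c r k - dilate c' r k)"
  by (auto simp: dilate_def left_diff_distrib)

lemma pser_dilate_shift:
  assumes T: "ccontraction T" and c: "disc_series c g" and r: "0 \<le> r" "r < 1"
  shows "pser (dilate (case_nat 0 c) r) T x = cscale (complex_of_real r) (T (pser (dilate c r) T x))"
proof -
  note s = summable_dilate[OF c r]
  have "summable (\<lambda>k. cmod (case_nat 0 (dilate c r) k))"
    by (subst summable_Suc_iff[symmetric]) (simp add: s)
  then show ?thesis unfolding dilate_shift by (simp add: pser_mult_coeff[OF T] pser_shift[OF T s])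
qed

section \<open>Existence of radial limits\<close>

lemma tendsto_at_left_if_Cauchy:
  fixes P :: "real \<Rightarrow> 'a::complete_space"
  assumes C: "\<And>e. e > 0 \<Longrightarrow> \<exists>\<delta><a. \<forall>r s. \<delta> < r \<and> r < a \<and> \<delta> < s \<and> s < a \<longrightarrow> dist (P r) (P s) < e"
  shows "\<exists>l. (P \<longlongrightarrow> l) (at_left a)"
proof -
  define u where "u n = a - 1 / Suc n" for n :: nat
  have u1: "u n < a" for n by (simp add: u_def)
  have "u \<longlonglongrightarrow> a - 0"
    unfolding u_def by (intro tendsto_diff tendsto_const LIMSEQ_Suc[OF lim_1_over_n])
  then have u: "u \<longlonglongrightarrow> a" by simp
  have "Cauchy (\<lambda>n. P (u n))"
  proof (rule metric_CauchyI)
    fix e :: real assume "e > 0"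
    then obtain \<delta> where \<delta>: "\<delta> < a" "\<And>r s. \<delta> < r \<Longrightarrow> r < a \<Longrightarrow> \<delta> < s \<Longrightarrow> s < a \<Longrightarrow> dist (P r) (P s) < e"
      using C by meson
    have "\<forall>\<^sub>F n in sequentially. \<delta> < u n" by (rule order_tendstoD(1)[OF u \<delta>(1)])
    then show "\<exists>N. \<forall>m\<ge>N. \<forall>n\<ge>N. dist (P (u m)) (P (u n)) < e"
      using \<delta>(2) u1 by (metis eventually_sequentially)
  qed
  then obtain l where l: "(\<lambda>n. P (u n)) \<longlonglongrightarrow> l" using Cauchy_convergent_iff convergent_def by blast
  have "(P \<longlongrightarrow> l) (at_left a)"
  proof (rule tendstoI)
    fix e :: real assume "e > 0"
    then have e2: "e / 2 > 0" by simp
    then obtain \<delta> where \<delta>: "\<delta> < a" "\<And>r s. \<delta> < r \<Longrightarrow> r < a \<Longrightarrow> \<delta> < s \<Longrightarrow> s < a \<Longrightarrow> dist (P r) (P s) < e / 2"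
      using C by meson
    have "\<forall>\<^sub>F n in sequentially. \<delta> < u n" by (rule order_tendstoD(1)[OF u \<delta>(1)])
    moreover have "\<forall>\<^sub>F n in sequentially. dist (P (u n)) l < e / 2" by (rule tendstoD[OF l e2])
    ultimately have "\<forall>\<^sub>F n in sequentially. \<delta> < u n \<and> dist (P (u n)) l < e / 2" by (rule eventually_conj)
    then obtain n where n: "\<delta> < u n" "dist (P (u n)) l < e / 2" by (auto simp: eventually_sequentially)
    have "\<forall>\<^sub>F r in at_left a. r \<in> {\<delta><..<a}" by (rule eventually_at_left_real[OF \<delta>(1)])
    then show "\<forall>\<^sub>F r in at_left a. dist (P r) l < e"
    proof eventually_elim
      case (elim r)
      then have "dist (P r) (P (u n)) < e / 2" using \<delta>(2) n u1 by auto
      then show ?case using n(2) dist_triangle[of "P r" l "P (u n)"] by simp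
    qed
  qed
  then show ?thesis by blast
qed

lemma disc_algebra_radial_uniform:
  assumes G: "continuous_on (cball (0::complex) 1) G" and e: "e > 0"
  shows "\<exists>\<delta><1. 0 < \<delta> \<and> (\<forall>r s \<zeta>. \<delta> < r \<and> r < 1 \<and> \<delta> < s \<and> s < 1 \<and> cmod \<zeta> = 1 \<longrightarrow>
    cmod (G (complex_of_real r * \<zeta>) - G (complex_of_real s * \<zeta>)) < (e::real))"
proof -
  have "uniformly_continuous_on (cball (0::complex) 1) G"
    using G by (intro compact_uniformly_continuous) auto
  then obtain d where d: "d > 0"
    "\<And>z w. z \<in> cball 0 1 \<Longrightarrow> w \<in> cball 0 1 \<Longrightarrow> dist w z < d \<Longrightarrow> dist (G w) (G z) < e"
    unfolding uniformly_continuous_on_def using e by metis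
  \<comment> \<open>The term \<open>1 - d\<close> brings the two radii within \<open>d\<close> of
    each other; the term \<open>1 / 2\<close> keeps them positive, so that both points lie in the
    disc.\<close>
  define \<delta> where "\<delta> = max (1 - d) (1 / 2)"
  have "cmod (G (complex_of_real r * \<zeta>) - G (complex_of_real s * \<zeta>)) < e"
    if "\<delta> < r" "r < 1" "\<delta> < s" "s < 1" "cmod \<zeta> = 1" for r s \<zeta>
  proof -
    have "dist (complex_of_real r * \<zeta>) (complex_of_real s * \<zeta>) = \<bar>r - s\<bar>"
      using that(5) by (simp add: dist_norm norm_mult flip: left_diff_distrib of_real_diff)
    also have "\<dots> < d" using that unfolding \<delta>_def by linarith
    finally have "dist (G (complex_of_real r * \<zeta>)) (G (complex_of_real s * \<zeta>)) < e"
      using that by (intro d(2)) (auto simp: norm_mult \<delta>_def)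
    then show ?thesis by (simp add: dist_norm)
  qed
  moreover have "\<delta> < 1" "0 < \<delta>" using d(1) by (auto simp: \<delta>_def)
  ultimately show ?thesis by blast
qed

text \<open>On the dense range of \<open>I - T\<close> the limit is that of \<open>(1 - z) g(z)\<close>, which is in the disc
  algebra; the uniform bound extends convergence to the closure.\<close>
lemma pser_dilate_convergent:
  fixes T :: "'h::chilbert_space \<Rightarrow> 'h"
  assumes T: "ccontraction T" and dense: "closure (range (\<lambda>x. x - T x)) = UNIV"
    and c: "disc_series c g" and bound: "\<And>z. cmod z < 1 \<Longrightarrow> cmod (g z) \<le> B"
    and G: "continuous_on (cball 0 1) G" "\<And>z. cmod z < 1 \<Longrightarrow> G z = g z - z * g z"
  shows "\<exists>l. ((\<lambda>r. pser (dilate c r) T x) \<longlongrightarrow> l) (at_left 1)"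
proof (rule tendsto_at_left_if_Cauchy)
  fix e :: real assume e: "e > 0"
  let ?P = "\<lambda>r. pser (dilate c r) T"
  \<comment> \<open>Coefficients of \<open>(1 - z) g(z)\<close>, the function that \<open>G\<close>
    extends to the closed disc.\<close>
  define q where "q k = c k - case_nat 0 c k" for k
  have q: "disc_series q G"
    using disc_series_diff[OF c disc_series_shift[OF c]] G(2) unfolding disc_series_def q_def by simp
  have B: "B \<ge> 0" using bound[of 0] by (simp add: order_trans[OF norm_ge_zero])
  have vN: "norm (?P r x) \<le> B * norm x" if "0 \<le> r" "r < 1" for r x
  proof (rule von_Neumann[OF T summable_dilate[OF c that] B])
    fix \<zeta> :: complex assume \<zeta>: "cmod \<zeta> = 1"
    show "cmod (\<Sum>k. dilate c r k * \<zeta> ^ k) \<le> B"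
      unfolding sums_unique[OF dilate_eval[OF c that \<zeta>], symmetric]
      using that \<zeta> by (intro bound) (simp add: norm_mult)
  qed
  \<comment> \<open>Error budget: less than \<open>e / 4\<close> for each of the two terms in
    \<open>x - v\<close>, at most \<open>e / 4\<close> for the disc algebra part, and
    \<open>e / 8\<close> for each of the two corrections by \<open>1 - t\<close>.\<close>
  define \<eta> where "\<eta> = e / (4 * (B + 1))"
  have \<eta>: "\<eta> > 0" using e B by (simp add: \<eta>_def)
  obtain y where y: "dist (y - T y) x < \<eta>"
  proof -
    have "x \<in> closure (range (\<lambda>x. x - T x))" using dense by simp
    then show ?thesis using \<eta> that unfolding closure_approachable by blast
  qed
  define v where "v = y - T y"
  define E where "E = e / (4 * (norm y + 1))"
  have E: "E > 0" using e by (simp add: E_def add_nonneg_pos)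
  obtain \<delta>1 where \<delta>1: "\<delta>1 < 1" "0 < \<delta>1" "\<And>r s \<zeta>. \<delta>1 < r \<Longrightarrow> r < 1 \<Longrightarrow> \<delta>1 < s \<Longrightarrow> s < 1 \<Longrightarrow> cmod \<zeta> = 1 \<Longrightarrow>
      cmod (G (complex_of_real r * \<zeta>) - G (complex_of_real s * \<zeta>)) < E"
    using disc_algebra_radial_uniform[OF G(1) E] by blast
  define \<epsilon> where "\<epsilon> = e / (8 * (B * norm y + 1))"
  have \<epsilon>: "\<epsilon> > 0" using e B by (simp add: \<epsilon>_def add_nonneg_pos)
  define \<delta> where "\<delta> = max \<delta>1 (1 - \<epsilon>)"
  have "dist (?P r x) (?P s x) < e" if rs: "\<delta> < r" "r < 1" "\<delta> < s" "s < 1" for r s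
  proof -
    have r: "0 \<le> r" "r < 1" "\<delta>1 < r" "1 - r < \<epsilon>" and s: "0 \<le> s" "s < 1" "\<delta>1 < s" "1 - s < \<epsilon>"
      using rs \<delta>1 by (auto simp: \<delta>_def)
    have sr: "summable (\<lambda>k. cmod (dilate c r k))" and ss: "summable (\<lambda>k. cmod (dilate c s k))"
      by (rule summable_dilate[OF c r(1,2)], rule summable_dilate[OF c s(1,2)])
    \<comment> \<open>Dilation turns \<open>(1 - z) g(z)\<close> into
      \<open>(1 - t z) g(t z)\<close>, whereas \<open>v\<close> calls for
      \<open>(1 - z) g(t z)\<close>. The discrepancy \<open>(1 - t) z g(t z)\<close> is bounded by a
      multiple of \<open>1 - t\<close>.\<close>
    have Pv: "?P t v = pser (dilate q t) T y - cscale (complex_of_real (1 - t)) (?P t (T y))"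
      if t: "0 \<le> t" "t < 1" for t
    proof -
      note st = summable_dilate[OF c t]
      have "pser (dilate q t) T y = ?P t y - cscale (complex_of_real t) (T (?P t y))"
        unfolding q_def dilate_diff
        by (subst pser_diff_coeff[OF T st summable_dilate[OF disc_series_shift[OF c] t]])
          (simp add: pser_dilate_shift[OF T c t])
      moreover have "?P t v = ?P t y - T (?P t y)"
        by (simp only: v_def pser_diff[OF T st] pser_commute[OF T st])
      moreover have "cscale (complex_of_real (1 - t)) (?P t (T y)) = T (?P t y) - cscale (complex_of_real t) (T (?P t y))"
        by (simp only: pser_commute[OF T st] of_real_diff of_real_1 cscale_diff_left cscale_one)
      ultimately show ?thesis by simp
    qed
    have small: "norm (cscale (complex_of_real (1 - t)) (?P t (T y))) \<le> e / 8"
      if t: "0 \<le> t" "t < 1" "1 - t < \<epsilon>" for t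
    proof -
      have "norm (cscale (complex_of_real (1 - t)) (?P t (T y))) = (1 - t) * norm (?P t (T y))"
        using t unfolding norm_cscale norm_of_real by simp
      also have "\<dots> \<le> \<epsilon> * (B * norm y + 1)"
      proof (rule mult_mono)
        have "norm (?P t (T y)) \<le> B * norm (T y)" by (rule vN[OF t(1,2)])
        also have "\<dots> \<le> B * norm y" by (intro mult_left_mono ccontractionD(3)[OF T] B)
        finally show "norm (?P t (T y)) \<le> B * norm y + 1" by simp
      qed (use t \<epsilon> in auto)
      also have "\<dots> = e / 8"
      proof -
        have "B * norm y + 1 > 0" using B by (simp add: add_nonneg_pos)
        then show ?thesis by (simp add: \<epsilon>_def field_simps)
      qed
      finally show ?thesis .
    qed
    have Q: "norm (pser (dilate q r) T y - pser (dilate q s) T y) \<le> e / 4"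
    proof -
      note qr = summable_dilate[OF q r(1,2)] and qs = summable_dilate[OF q s(1,2)]
      have "norm (pser (\<lambda>k. dilate q r k - dilate q s k) T y) \<le> E * norm y"
      proof (rule von_Neumann[OF T])
        show "summable (\<lambda>k. cmod (dilate q r k - dilate q s k))"
          by (rule summable_comparison_test'[OF summable_add[OF qr qs]]) (simp add: norm_triangle_ineq4)
        fix \<zeta> :: complex assume \<zeta>: "cmod \<zeta> = 1"
        have "(\<lambda>k. (dilate q r k - dilate q s k) * \<zeta> ^ k) sums
            (G (complex_of_real r * \<zeta>) - G (complex_of_real s * \<zeta>))"
          unfolding left_diff_distrib
          by (intro sums_diff dilate_eval[OF q r(1,2) \<zeta>] dilate_eval[OF q s(1,2) \<zeta>])
        from sums_unique[OF this] show "cmod (\<Sum>k. (dilate q r k - dilate q s k) * \<zeta> ^ k) \<le> E"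
          using \<delta>1(3)[OF r(3,2) s(3,2) \<zeta>] by simp
      qed (use E in simp)
      also have "\<dots> \<le> E * (norm y + 1)" using E by (intro mult_left_mono) auto
      also have "\<dots> = e / 4"
      proof -
        have "norm y + 1 > 0" by (simp add: add_nonneg_pos)
        then show ?thesis by (simp add: E_def field_simps)
      qed
      finally show ?thesis by (simp add: pser_diff_coeff[OF T qr qs])
    qed
    have v: "norm (?P r v - ?P s v) \<le> e / 4 + (e / 8 + e / 8)"
    proof -
      let ?a = "cscale (complex_of_real (1 - r)) (?P r (T y))" and ?b = "cscale (complex_of_real (1 - s)) (?P s (T y))"
      have eq: "?P r v - ?P s v = (pser (dilate q r) T y - pser (dilate q s) T y) - (?a - ?b)"
        unfolding Pv[OF r(1,2)] Pv[OF s(1,2)] by simp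
      show ?thesis unfolding eq
        using norm_triangle_ineq4[of "pser (dilate q r) T y - pser (dilate q s) T y" "?a - ?b"]
          norm_triangle_ineq4[of ?a ?b] Q small[OF r(1,2,4)] small[OF s(1,2,4)] by linarith
    qed
    have xv: "norm (?P t (x - v)) < e / 4" if t: "0 \<le> t" "t < 1" for t
    proof -
      have "norm (?P t (x - v)) \<le> B * norm (x - v)" by (rule vN[OF t])
      also have "\<dots> \<le> (B + 1) * norm (x - v)" by (intro mult_right_mono) auto
      also have "\<dots> < (B + 1) * \<eta>"
        using y B by (intro mult_strict_left_mono) (auto simp: v_def dist_norm norm_minus_commute)
      also have "\<dots> = e / 4" using B by (simp add: \<eta>_def field_simps)
      finally show ?thesis .
    qed
    have eq: "?P r x - ?P s x = (?P r (x - v) - ?P s (x - v)) + (?P r v - ?P s v)"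
      by (simp add: pser_diff[OF T sr] pser_diff[OF T ss])
    have "norm (?P r x - ?P s x) < e" unfolding eq
      using norm_triangle_ineq[of "?P r (x - v) - ?P s (x - v)" "?P r v - ?P s v"]
        norm_triangle_ineq4[of "?P r (x - v)" "?P s (x - v)"] xv[OF r(1,2)] xv[OF s(1,2)] v by linarith
    then show ?thesis by (simp add: dist_norm)
  qed
  moreover have "\<delta> < 1" using \<delta>1 \<epsilon> by (simp add: \<delta>_def)
  ultimately show "\<exists>\<delta><1. \<forall>r s. \<delta> < r \<and> r < 1 \<and> \<delta> < s \<and> s < 1 \<longrightarrow> dist (?P r x) (?P s x) < e" by blast
qed

section \<open>Transfer between the disc and the half-plane\<close>

lemma Im_omega: "\<zeta> \<noteq> 1 \<Longrightarrow> Im (omega \<zeta>) = (1 - (cmod \<zeta>)\<^sup>2) / (cmod (1 - \<zeta>))\<^sup>2"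
  unfolding omega_def Im_divide cmod_power2 by (simp add: power2_eq_square algebra_simps)

lemma omega_in_cuhp: "cmod \<zeta> < 1 \<Longrightarrow> omega \<zeta> \<in> cuhp"
proof -
  assume *: "cmod \<zeta> < 1"
  then have "\<zeta> \<noteq> 1" by auto
  moreover have "(cmod \<zeta>)\<^sup>2 < 1" using * by (simp add: power_less_one_iff)
  ultimately show ?thesis by (simp add: cuhp_def Im_omega)
qed

lemma omega_in_cuhp_clos: "cmod \<zeta> \<le> 1 \<Longrightarrow> \<zeta> \<noteq> 1 \<Longrightarrow> omega \<zeta> \<in> cuhp_clos"
  by (simp add: cuhp_clos_def Im_omega power_le_one_iff)

lemma disc_series_taylor:
  assumes "g holomorphic_on cuhp"
  shows "disc_series (taylor_coeff (g \<circ> omega)) (g \<circ> omega)"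
proof -
  have "omega holomorphic_on ball 0 1" unfolding omega_def
    by (intro holomorphic_intros) auto
  then have hol: "(g \<circ> omega) holomorphic_on ball 0 1"
    using assms omega_in_cuhp by (intro holomorphic_on_compose_gen[of omega _ g cuhp]) auto
  show ?thesis unfolding disc_series_def taylor_coeff_def
    using holomorphic_power_series[OF hol] by (simp add: dist_norm)
qed

lemma closure_cuhp: "closure cuhp = cuhp_clos"
  using closure_halfspace_gt[of \<i> 0] by (simp add: cuhp_def cuhp_clos_def inner_complex_def)

text \<open>The calculus is defined through \<open>Lim\<close>, which carries information only if a
  limit exists. Boundedness and continuity of \<open>g\<close> supply it; no limit of
  \<open>g\<close> at infinity enters.\<close>

lemma fcalc_tendsto:
  fixes D :: "'h::chilbert_space set"
  assumes max: "max_dissipative D L" and hol: "g holomorphic_on cuhp"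
    and cont: "continuous_on cuhp_clos g" and bound: "\<And>z. z \<in> cuhp \<Longrightarrow> cmod (g z) \<le> B"
  shows "((\<lambda>r. pser (dilate (taylor_coeff (g \<circ> omega)) r) (cayley D L) x) \<longlongrightarrow> fcalc g D L x) (at_left 1)"
proof -
  have bound': "cmod (g z) \<le> B" if "z \<in> cuhp_clos" for z
    using continuous_on_closure_norm_le[of cuhp g B z] cont bound that by (simp add: closure_cuhp)
  \<comment> \<open>The factor \<open>1 - \<zeta>\<close> beats the bounded function
    \<open>g (omega \<zeta>)\<close> near 1, so 0 is the continuous value there.\<close>
  define G where "G \<zeta> = (if \<zeta> = 1 then 0 else g (omega \<zeta>) - \<zeta> * g (omega \<zeta>))" for \<zeta>
  have "continuous_on (cball 0 1) G"
    unfolding continuous_on_eq_continuous_within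
  proof
    fix \<zeta> :: complex assume \<zeta>: "\<zeta> \<in> cball 0 1"
    show "continuous (at \<zeta> within cball 0 1) G"
    proof (cases "\<zeta> = 1")
      case True
      have "(G \<longlongrightarrow> 0) (at 1 within cball 0 1)"
      proof (rule Lim_null_comparison)
        show "\<forall>\<^sub>F \<zeta> in at 1 within cball 0 1. norm (G \<zeta>) \<le> cmod (1 - \<zeta>) * B"
        proof -
          have "norm (G \<zeta>) \<le> cmod (1 - \<zeta>) * B" if "\<zeta> \<in> cball 0 1" "\<zeta> \<noteq> 1" for \<zeta>
          proof -
            have "G \<zeta> = (1 - \<zeta>) * g (omega \<zeta>)" using that by (simp add: G_def left_diff_distrib)
            then show ?thesis
              using that by (simp add: norm_mult mult_left_mono bound' omega_in_cuhp_clos)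
          qed
          then show ?thesis by (auto simp: eventually_at_filter)
        qed
        have "((\<lambda>\<zeta>. cmod (1 - \<zeta>) * B) \<longlongrightarrow> cmod (1 - 1) * B) (at 1 within cball 0 1)"
          by (intro tendsto_intros)
        then show "((\<lambda>\<zeta>. cmod (1 - \<zeta>) * B) \<longlongrightarrow> 0) (at 1 within cball 0 1)" by simp
      qed
      then show ?thesis using True by (simp add: continuous_within G_def)
    next
      case False
      let ?S = "cball (0::complex) 1 - {1}"
      have om: "continuous_on ?S omega" unfolding omega_def by (intro continuous_intros) auto
      have "continuous_on ?S (\<lambda>\<zeta>. g (omega \<zeta>))"
        by (rule continuous_on_compose2[OF cont om]) (auto intro: omega_in_cuhp_clos)
      then have "continuous_on ?S (\<lambda>\<zeta>. g (omega \<zeta>) - \<zeta> * g (omega \<zeta>))" by (intro continuous_intros)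
      then have "continuous_on ?S G" by (rule continuous_on_eq) (simp add: G_def)
      then have "continuous (at \<zeta> within ?S) G"
        using \<zeta> False by (simp add: continuous_on_eq_continuous_within)
      moreover have "at \<zeta> within ?S = at \<zeta> within cball 0 1"
      proof (rule at_within_nhd[of _ "- {1}"])
        show "open (- {1::complex})" by (simp add: open_Compl)
      qed (use False in auto)
      ultimately show ?thesis by (simp only: continuous_within)
    qed
  qed
  moreover have "G z = (g \<circ> omega) z - z * (g \<circ> omega) z" if "cmod z < 1" for z
    using that by (auto simp: G_def)
  ultimately have "\<exists>l. ((\<lambda>r. pser (dilate (taylor_coeff (g \<circ> omega)) r) (cayley D L) x) \<longlongrightarrow> l) (at_left 1)"
    using bound omega_in_cuhp
    by (intro pser_dilate_convergent[OF ccontraction_cayley[OF max] dense_range_one_minus_cayley[OF max]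
          disc_series_taylor[OF hol], of B G]) auto
  then obtain l where l: "((\<lambda>r. pser (dilate (taylor_coeff (g \<circ> omega)) r) (cayley D L) x) \<longlongrightarrow> l) (at_left 1)" ..
  have "fcalc g D L x = l"
    unfolding fcalc_def snf_calc_def
    using tendsto_Lim[OF _ l] by (simp add: pser_def dilate_def)
  then show ?thesis using l by simp
qed

section \<open>Interchange of limits\<close>

text \<open>Moore-Osgood: tails that are small uniformly near the limit of the filter stay small for
  the limiting terms, and a finite head converges termwise. No absolute convergence is involved, so
  orthogonality-type tail bounds suffice.\<close>

lemma series_limit_interchange:
  fixes f :: "nat \<Rightarrow> 's \<Rightarrow> 'b::banach"
  assumes lim: "\<And>n. (f n \<longlongrightarrow> l n) F" and F: "F \<noteq> bot"
    and sm: "\<forall>\<^sub>F s in F. summable (\<lambda>n. f n s)"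
    and tail: "\<And>e. e > 0 \<Longrightarrow> \<exists>M. \<forall>\<^sub>F s in F. \<forall>N\<ge>M. norm (\<Sum>n=M..<N. f n s) \<le> e"
  shows "summable l" "((\<lambda>s. \<Sum>n. f n s) \<longlongrightarrow> suminf l) F"
proof -
  have ltail: "norm (\<Sum>n=M..<N. l n) \<le> e"
    if "\<forall>\<^sub>F s in F. \<forall>N\<ge>M. norm (\<Sum>n=M..<N. f n s) \<le> e" "N \<ge> M" for M N e
  proof (rule tendsto_upperbound[OF _ _ F])
    show "((\<lambda>s. norm (\<Sum>n=M..<N. f n s)) \<longlongrightarrow> norm (\<Sum>n=M..<N. l n)) F"
      by (intro tendsto_intros lim)
    show "\<forall>\<^sub>F s in F. norm (\<Sum>n=M..<N. f n s) \<le> e"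
      using that(1) by eventually_elim (use that(2) in blast)
  qed
  have rest: "norm (suminf g - (\<Sum>n<M. g n)) \<le> e"
    if "summable g" "\<And>N. N \<ge> M \<Longrightarrow> norm (\<Sum>n=M..<N. g n) \<le> e" for g :: "nat \<Rightarrow> 'b" and M e
  proof (rule LIMSEQ_le_const2)
    show "(\<lambda>N. norm ((\<Sum>n<N. g n) - (\<Sum>n<M. g n))) \<longlonglongrightarrow> norm (suminf g - (\<Sum>n<M. g n))"
      by (intro tendsto_intros summable_LIMSEQ that(1))
    have "(\<Sum>n<N. g n) - (\<Sum>n<M. g n) = (\<Sum>n=M..<N. g n)" if "N \<ge> M" for N
      using sum_diff_nat_ivl[of 0 M N g] that by (simp add: atLeast0LessThan)
    then show "\<exists>N0. \<forall>N\<ge>N0. norm ((\<Sum>n<N. g n) - (\<Sum>n<M. g n)) \<le> e"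
      using that(2) by (intro exI[of _ M]) simp
  qed
  show l: "summable l"
    unfolding summable_Cauchy
  proof (intro allI impI)
    fix e :: real assume "e > 0"
    then obtain M where M: "\<forall>\<^sub>F s in F. \<forall>N\<ge>M. norm (\<Sum>n=M..<N. f n s) \<le> e / 3"
      using tail[of "e / 3"] by auto
    have "norm (\<Sum>n=m..<n. l n) < e" if "m \<ge> M" for m n
    proof (cases "m \<le> n")
      case True
      \<comment> \<open>The tail assumption only speaks of segments starting at \<open>M\<close>;
        any later segment is a difference of two of these.\<close>
      have eq: "(\<Sum>n=m..<n. l n) = (\<Sum>n=M..<n. l n) - (\<Sum>n=M..<m. l n)"
        using sum_diff_nat_ivl[of M m n l] that True by simp
      have "norm (\<Sum>n=M..<n. l n) \<le> e / 3" "norm (\<Sum>n=M..<m. l n) \<le> e / 3"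
        using ltail[OF M] that True by auto
      then show ?thesis unfolding eq
        using norm_triangle_ineq4[of "\<Sum>n=M..<n. l n" "\<Sum>n=M..<m. l n"] \<open>e > 0\<close> by linarith
    qed (use \<open>e > 0\<close> in simp)
    then show "\<exists>N. \<forall>m\<ge>N. \<forall>n. norm (sum l {m..<n}) < e" by blast
  qed
  show "((\<lambda>s. \<Sum>n. f n s) \<longlongrightarrow> suminf l) F"
  proof (rule tendstoI)
    fix e :: real assume "e > 0"
    then obtain M where M: "\<forall>\<^sub>F s in F. \<forall>N\<ge>M. norm (\<Sum>n=M..<N. f n s) \<le> e / 4"
      using tail[of "e / 4"] by auto
    have "((\<lambda>s. \<Sum>n<M. f n s) \<longlongrightarrow> (\<Sum>n<M. l n)) F" by (intro tendsto_intros lim)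
    then have "\<forall>\<^sub>F s in F. dist (\<Sum>n<M. f n s) (\<Sum>n<M. l n) < e / 4"
      using \<open>e > 0\<close> by (intro tendstoD) auto
    then show "\<forall>\<^sub>F s in F. dist (\<Sum>n. f n s) (suminf l) < e"
      using M sm
    proof eventually_elim
      case (elim s)
      have 1: "norm ((\<Sum>n. f n s) - (\<Sum>n<M. f n s)) \<le> e / 4"
        using elim by (intro rest) auto
      have 2: "norm (suminf l - (\<Sum>n<M. l n)) \<le> e / 4"
        using ltail[OF M] by (intro rest[OF l]) auto
      have eq: "(\<Sum>n. f n s) - suminf l = ((\<Sum>n. f n s) - (\<Sum>n<M. f n s))
          + ((\<Sum>n<M. f n s) - (\<Sum>n<M. l n)) - (suminf l - (\<Sum>n<M. l n))" by simp
      show ?case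
        unfolding dist_norm eq
        using norm_triangle_ineq4[of "((\<Sum>n. f n s) - (\<Sum>n<M. f n s)) + ((\<Sum>n<M. f n s) - (\<Sum>n<M. l n))"
            "suminf l - (\<Sum>n<M. l n)"]
          norm_triangle_ineq[of "(\<Sum>n. f n s) - (\<Sum>n<M. f n s)" "(\<Sum>n<M. f n s) - (\<Sum>n<M. l n)"]
          1 2 elim(1) \<open>e > 0\<close> unfolding dist_norm by linarith
    qed
  qed
qed

text \<open>The preceding interchange, applied to the partial sums over \<open>n\<close> as
  \<open>N\<close> grows. Each single term is a difference of two partial sums, hence bounded by
  \<open>M j + M j\<close>.\<close>

lemma sums_swap_dominated:
  fixes e :: "nat \<Rightarrow> nat \<Rightarrow> 'b::banach"
  assumes dom: "\<And>N j. norm (\<Sum>n<N. e n j) \<le> M j" and M: "summable M"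
    and E: "\<And>j. (\<lambda>n. e n j) sums E j"
  shows "summable E" "(\<lambda>n. \<Sum>j. e n j) sums (\<Sum>j. E j)"
proof -
  have sm: "summable (\<lambda>j. e n j)" for n
  proof (rule summable_comparison_test')
    show "summable (\<lambda>j. M j + M j)" by (intro summable_add M)
    fix j
    have "norm (e n j) = norm ((\<Sum>n<Suc n. e n j) - (\<Sum>n<n. e n j))" by simp
    then show "norm (e n j) \<le> M j + M j"
      using norm_triangle_ineq4[of "\<Sum>n<Suc n. e n j" "\<Sum>n<n. e n j"] dom[of j "Suc n"] dom[of j n] by linarith
  qed
  have "\<exists>J. \<forall>\<^sub>F N in sequentially. \<forall>K\<ge>J. norm (\<Sum>j=J..<K. \<Sum>n<N. e n j) \<le> \<epsilon>" if "\<epsilon> > 0" for \<epsilon>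
  proof -
    obtain J where J: "\<And>m n. m \<ge> J \<Longrightarrow> norm (sum M {m..<n}) < \<epsilon>"
      using M \<open>\<epsilon> > 0\<close> unfolding summable_Cauchy by blast
    have "norm (\<Sum>j=J..<K. \<Sum>n<N. e n j) \<le> \<epsilon>" for K N
    proof -
      have "norm (\<Sum>j=J..<K. \<Sum>n<N. e n j) \<le> (\<Sum>j=J..<K. M j)" by (rule sum_norm_le) (rule dom)
      also have "\<dots> \<le> \<epsilon>" using J[of J K] by simp
      finally show ?thesis .
    qed
    then show ?thesis by (intro exI[of _ J] always_eventually allI impI)
  qed
  note * = series_limit_interchange[of "\<lambda>j N. \<Sum>n<N. e n j" E sequentially, OF _ _ _ this]
  have lim: "(\<lambda>N. \<Sum>n<N. e n j) \<longlonglongrightarrow> E j" for j using E[of j] by (simp add: sums_def)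
  have sm': "\<forall>\<^sub>F N in sequentially. summable (\<lambda>j. \<Sum>n<N. e n j)"
    by (intro always_eventually allI summable_sum sm)
  show "summable E" by (rule *(1)[OF lim _ sm']) auto
  have "(\<lambda>N. \<Sum>j. \<Sum>n<N. e n j) \<longlonglongrightarrow> (\<Sum>j. E j)" by (rule *(2)[OF lim _ sm']) auto
  then show "(\<lambda>n. \<Sum>j. e n j) sums (\<Sum>j. E j)"
    by (simp add: sums_def suminf_sum[OF sm])
qed

section \<open>Taylor coefficients of square-summable families\<close>

lemma disc_series_unique:
  assumes "disc_series c g" "disc_series c' g"
  shows "c = c'"
proof
  fix m
  define a where "a k = c k - c' k" for k
  have a: "(\<lambda>k. a k * z ^ k) sums 0" if "cmod z < 1" for z
    using disc_series_diff[OF assms] that by (simp add: disc_series_def a_def)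
  have "a m = 0"
  proof (cases "m = 0")
    case True
    then show ?thesis using a[of 0] by simp
  next
    case False
    show ?thesis
    proof (rule ccontr)
      assume "a m \<noteq> 0"
      \<comment> \<open>A nonzero coefficient of positive index would make the zero at 0 isolated,
        whereas the sum is identically 0 in the disc.\<close>
      then obtain s where s: "0 < s" "\<And>z::complex. z \<in> cball 0 s - {0} \<Longrightarrow> (0::complex) \<noteq> 0"
        using powser_0_nonzero[of 1 0 a "\<lambda>_. 0" m] a False by auto
      then show False using s(2)[of "complex_of_real s"] by simp
    qed
  qed
  then show "c m = c' m" by (simp add: a_def)
qed

text \<open>Cauchy's estimate on circles of radius \<open>r < 1\<close>, with \<open>r\<close> then
  tending to 1.\<close>

lemma disc_series_coeff_bound:
  assumes c: "disc_series c g" and bound: "\<And>z. cmod z < 1 \<Longrightarrow> cmod (g z) \<le> B"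
  shows "cmod (c k) \<le> B"
proof -
  have hol: "g holomorphic_on ball 0 1"
    by (rule power_series_holomorphic[of _ _ c]) (use c in \<open>auto simp: disc_series_def\<close>)
  have "disc_series (\<lambda>n. (deriv ^^ n) g 0 / fact n) g"
    unfolding disc_series_def using holomorphic_power_series[OF hol] by simp
  from disc_series_unique[OF c this] have ck: "c k = (deriv ^^ k) g 0 / fact k" by simp
  have "cmod (c k) * r ^ k \<le> B" if r: "0 < r" "r < 1" for r
  proof -
    have "cmod ((deriv ^^ k) g 0) \<le> fact k * B / r ^ k"
    proof (rule Cauchy_inequality)
      show "g holomorphic_on ball 0 r" using hol r by (auto intro: holomorphic_on_subset)
      have "cball (0::complex) r \<subseteq> ball 0 1" using r by auto
      then show "continuous_on (cball 0 r) g"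
        using hol holomorphic_on_imp_continuous_on continuous_on_subset by blast
      show "cmod (g x) \<le> B" if "cmod (0 - x) = r" for x using that r by (intro bound) simp
    qed (rule r)
    then show ?thesis using r by (simp add: ck norm_divide field_simps)
  qed
  then have "\<forall>\<^sub>F r in at_left 1. cmod (c k) * r ^ k \<le> B"
    using eventually_at_left_real[OF zero_less_one] by (auto elim: eventually_mono)
  moreover have "((\<lambda>r. cmod (c k) * r ^ k) \<longlongrightarrow> cmod (c k) * 1 ^ k) (at_left 1)"
    by (intro tendsto_intros)
  ultimately have "cmod (c k) * 1 ^ k \<le> B" by (intro tendsto_upperbound) auto
  then show ?thesis by simp
qed

lemma mult_le_half_squares: "a * b \<le> (a\<^sup>2 + b\<^sup>2) / (2::real)"
  using sum_squares_bound[of a b] by simp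

text \<open>The arithmetic-geometric mean inequality replaces Cauchy-Schwarz:
  \<open>(A + B) / 2\<close> avoids square roots, and where sharpness matters the factors are
  rescaled first.\<close>

lemma norm_sum_mult_le:
  fixes a b :: "nat \<Rightarrow> complex"
  assumes "(\<Sum>n\<in>F. (cmod (a n))\<^sup>2) \<le> A" "(\<Sum>n\<in>F. (cmod (b n))\<^sup>2) \<le> B"
  shows "cmod (\<Sum>n\<in>F. a n * b n) \<le> (A + B) / 2"
proof -
  have "cmod (\<Sum>n\<in>F. a n * b n) \<le> (\<Sum>n\<in>F. ((cmod (a n))\<^sup>2 + (cmod (b n))\<^sup>2) / 2)"
    by (intro sum_norm_le) (simp only: norm_mult mult_le_half_squares)
  also have "\<dots> \<le> (A + B) / 2"
    using assms by (simp add: sum.distrib flip: sum_divide_distrib)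
  finally show ?thesis .
qed

lemma norm_sum_cscale_le:
  fixes u :: "nat \<Rightarrow> 'h::cinner_space"
  assumes "(\<Sum>n\<in>F. (cmod (a n))\<^sup>2) \<le> A" "(\<Sum>n\<in>F. (norm (u n))\<^sup>2) \<le> B"
  shows "norm (\<Sum>n\<in>F. cscale (a n) (u n)) \<le> (A + B) / 2"
proof -
  have "norm (\<Sum>n\<in>F. cscale (a n) (u n)) \<le> (\<Sum>n\<in>F. ((cmod (a n))\<^sup>2 + (norm (u n))\<^sup>2) / 2)"
    by (intro sum_norm_le) (simp only: norm_cscale mult_le_half_squares)
  also have "\<dots> \<le> (A + B) / 2"
    using assms by (simp add: sum.distrib flip: sum_divide_distrib)
  finally show ?thesis .
qed

lemma summable_squares_if_bounded:
  assumes "\<And>N. (\<Sum>n<N. (a n :: real)\<^sup>2) \<le> A" shows "summable (\<lambda>n. (a n)\<^sup>2)"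
  by (rule summableI_nonneg_bounded[of _ A]) (use assms in auto)

lemma disc_series_sum:
  "finite F \<Longrightarrow> (\<And>n. n \<in> F \<Longrightarrow> disc_series (c n) (g n)) \<Longrightarrow>
    disc_series (\<lambda>k. \<Sum>n\<in>F. a n * c n k) (\<lambda>z. \<Sum>n\<in>F. a n * g n z)"
  unfolding disc_series_def sum_distrib_right mult.assoc by (auto intro!: sums_sum sums_mult)

text \<open>Duality: the combination of the \<open>g n\<close> with weights
  \<open>cnj (c n k)\<close> has \<open>S\<close> as its k-th coefficient and is bounded by
  \<open>(S + A) / 2\<close>, whence \<open>S \<le> A\<close>.\<close>

lemma disc_series_coeff_square_bound:
  assumes c: "\<And>n. disc_series (c n) (g n)"
    and bound: "\<And>z. cmod z < 1 \<Longrightarrow> (\<Sum>n<N. (cmod (g n z))\<^sup>2) \<le> A"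
  shows "(\<Sum>n<(N::nat). (cmod (c n k))\<^sup>2) \<le> A"
proof -
  define S where "S = (\<Sum>n<N. (cmod (c n k))\<^sup>2)"
  have S: "(\<Sum>n<N. cnj (c n k) * c n k) = complex_of_real S"
    unfolding S_def of_real_sum complex_norm_square by (simp add: mult.commute)
  have "cmod (\<Sum>n<N. cnj (c n k) * c n k) \<le> (S + A) / 2"
  proof (rule disc_series_coeff_bound[of "\<lambda>j. \<Sum>n<N. cnj (c n k) * c n j"])
    show "disc_series (\<lambda>j. \<Sum>n<N. cnj (c n k) * c n j) (\<lambda>z. \<Sum>n<N. cnj (c n k) * g n z)"
      by (intro disc_series_sum c) simp
    show "cmod (\<Sum>n<N. cnj (c n k) * g n z) \<le> (S + A) / 2" if "cmod z < 1" for z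
      by (rule norm_sum_mult_le) (use bound[OF that] in \<open>simp_all add: S_def\<close>)
  qed
  moreover have "S \<ge> 0" unfolding S_def by (intro sum_nonneg) simp
  ultimately have "S \<le> (S + A) / 2" unfolding S by simp
  then show ?thesis unfolding S_def by simp
qed

section \<open>The double series for a pair of contractions\<close>

definition unit_coeff :: "nat \<Rightarrow> complex" where
  "unit_coeff k = (if k = 0 then 1 else 0)"

definition one_minus_coeff :: "nat \<Rightarrow> complex" where
  "one_minus_coeff k = unit_coeff k - case_nat 0 unit_coeff k"

lemma disc_series_unit: "disc_series unit_coeff (\<lambda>_. 1)"
  unfolding disc_series_def unit_coeff_def using sums_If_finite[of "\<lambda>k. k = 0" "\<lambda>_. 1::complex"]
  by (auto simp: if_distrib if_distribR cong: if_cong)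

lemma disc_series_one_minus: "disc_series one_minus_coeff (\<lambda>z. 1 - z)"
  using disc_series_diff[OF disc_series_unit disc_series_shift[OF disc_series_unit]]
  by (simp add: one_minus_coeff_def[abs_def])

lemma disc_series_mult: "disc_series c g \<Longrightarrow> disc_series (\<lambda>k. a * c k) (\<lambda>z. a * g z)"
  unfolding disc_series_def mult.assoc by (auto intro: sums_mult)

lemma disc_series_mult2: "disc_series c g \<Longrightarrow> disc_series (\<lambda>k. c k * a) (\<lambda>z. g z * a)"
  using disc_series_mult[of c g a] by (simp add: mult.commute)

lemma pser_dilate_unit: "pser (dilate unit_coeff r) T x = x"
proof -
  have "(\<lambda>k. cscale (dilate unit_coeff r k) ((T ^^ k) x)) = (\<lambda>k. if k = 0 then x else 0)"
    by (auto simp: dilate_def unit_coeff_def cscale_one)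
  then show ?thesis
    unfolding pser_def using sums_single[of 0 "\<lambda>_. x"] by (simp add: sums_iff)
qed

lemma pser_dilate_one_minus:
  assumes T: "ccontraction T" and r: "0 \<le> r" "r < 1"
  shows "pser (dilate one_minus_coeff r) T x = x - cscale (complex_of_real r) (T x)"
  unfolding one_minus_coeff_def dilate_diff
  by (subst pser_diff_coeff[OF T summable_dilate[OF disc_series_unit r]
        summable_dilate[OF disc_series_shift[OF disc_series_unit] r]])
    (simp add: pser_dilate_shift[OF T disc_series_unit r] pser_dilate_unit)

lemma dilate_mult: "dilate (\<lambda>k. a * c k) r = (\<lambda>k. a * dilate c r k)"
  by (simp add: dilate_def fun_eq_iff)

lemma pser_dilate_mult:
  assumes "ccontraction T" "disc_series c g" "0 \<le> r" "r < 1"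
  shows "pser (dilate (\<lambda>k. a * c k) r) T x = cscale a (pser (dilate c r) T x)"
  unfolding dilate_mult by (rule pser_mult_coeff[OF assms(1) summable_dilate[OF assms(2-4)]])

lemma pser_dilate_diff:
  assumes "ccontraction T" "disc_series c g" "disc_series c' g'" "0 \<le> r" "r < 1"
  shows "pser (dilate (\<lambda>k. c k - c' k) r) T x = pser (dilate c r) T x - pser (dilate c' r) T x"
  unfolding dilate_diff
  by (rule pser_diff_coeff[OF assms(1) summable_dilate[OF assms(2,4,5)] summable_dilate[OF assms(3,4,5)]])

text \<open>The identity is the divided difference relation after the substitution
  \<open>omega\<close>, with denominators cleared: \<open>h(z) = f(omega z) (1 - z) / (2i)\<close>
  and \<open>omega z - omega w = 2i (z - w) / ((1 - z)(1 - w))\<close>.\<close>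

locale disc_factorization =
  fixes \<phi> \<psi> :: "nat \<Rightarrow> complex \<Rightarrow> complex" and \<phi>c \<psi>c :: "nat \<Rightarrow> nat \<Rightarrow> complex"
    and h :: "complex \<Rightarrow> complex" and hc :: "nat \<Rightarrow> complex" and A B :: real
  assumes \<phi>: "\<And>n. disc_series (\<phi>c n) (\<phi> n)" and \<psi>: "\<And>n. disc_series (\<psi>c n) (\<psi> n)"
    and h: "disc_series hc h" and A: "A > 0" and B: "B > 0"
    and \<phi>_bound: "\<And>z N. cmod z < 1 \<Longrightarrow> (\<Sum>n<N. (cmod (\<phi> n z))\<^sup>2) \<le> A"
    and \<psi>_bound: "\<And>z N. cmod z < 1 \<Longrightarrow> (\<Sum>n<N. (cmod (\<psi> n z))\<^sup>2) \<le> B"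
    and identity: "\<And>z w. cmod z < 1 \<Longrightarrow> cmod w < 1 \<Longrightarrow>
      (\<lambda>n. (z - w) * (\<phi> n z * \<psi> n w)) sums (h z * (1 - w) - (1 - z) * h w)"
begin

lemma \<phi>c_bound: "(\<Sum>n<N. (cmod (\<phi>c n k))\<^sup>2) \<le> A"
  by (rule disc_series_coeff_square_bound[OF \<phi> \<phi>_bound])

lemma \<psi>c_bound: "(\<Sum>n<N. (cmod (\<psi>c n k))\<^sup>2) \<le> B"
  by (rule disc_series_coeff_square_bound[OF \<psi> \<psi>_bound])

lemma \<phi>c_mult_summable:
  assumes "\<And>N. (\<Sum>n<N. (cmod (b n))\<^sup>2) \<le> B'"
  shows "summable (\<lambda>n. \<phi>c n j * b n)"
proof (rule summable_norm_cancel, rule summable_comparison_test')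
  show "summable (\<lambda>n. ((cmod (\<phi>c n j))\<^sup>2 + (cmod (b n))\<^sup>2) / 2)"
    by (intro summable_divide summable_add summable_squares_if_bounded[OF \<phi>c_bound] summable_squares_if_bounded[OF assms])
  show "norm (norm (\<phi>c n j * b n)) \<le> ((cmod (\<phi>c n j))\<^sup>2 + (cmod (b n))\<^sup>2) / 2" for n
    unfolding norm_mult real_norm_def abs_mult abs_norm_cancel by (rule mult_le_half_squares)
qed

text \<open>\<open>a j k\<close> is the coefficient of \<open>z^j w^k\<close> in
  \<open>\<Sum>\<^sub>n \<phi>\<^sub>n(z) \<psi>\<^sub>n(w)\<close>, and \<open>C j w\<close> that
  of \<open>z^j\<close> for fixed \<open>w\<close>. Passing through \<open>C\<close> reduces the
  comparison to power series in one variable.\<close>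

definition a :: "nat \<Rightarrow> nat \<Rightarrow> complex" where "a j k = (\<Sum>n. \<phi>c n j * \<psi>c n k)"

definition C :: "nat \<Rightarrow> complex \<Rightarrow> complex" where "C j w = (\<Sum>n. \<phi>c n j * \<psi> n w)"

lemma a_sums: "(\<lambda>n. \<phi>c n j * \<psi>c n k) sums a j k"
  unfolding a_def by (intro summable_sums \<phi>c_mult_summable[OF \<psi>c_bound])

lemma C_sums: "cmod w < 1 \<Longrightarrow> (\<lambda>n. \<phi>c n j * \<psi> n w) sums C j w"
  unfolding C_def by (intro summable_sums \<phi>c_mult_summable[OF \<psi>_bound])

lemma C_series: "disc_series (a j) (C j)"
  unfolding disc_series_def
proof (intro allI impI)
  fix w :: complex assume w: "cmod w < 1"
  have dom: "cmod (\<Sum>n<N. \<phi>c n j * \<psi>c n k * w ^ k) \<le> (A + B) / 2 * cmod w ^ k" for N k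
    unfolding sum_distrib_right[symmetric] norm_mult norm_power
    by (intro mult_right_mono norm_sum_mult_le \<phi>c_bound \<psi>c_bound) simp
  have sm: "summable (\<lambda>k. (A + B) / 2 * cmod w ^ k)" using w by (intro summable_mult summable_geometric) simp
  note * = sums_swap_dominated[OF dom sm sums_mult2[OF a_sums]]
  have "(\<Sum>k. \<phi>c n j * \<psi>c n k * w ^ k) = \<phi>c n j * \<psi> n w" for n
    using \<psi>[of n] w unfolding disc_series_def mult.assoc
    by (intro sums_unique[symmetric] sums_mult) auto
  with *(2) have "(\<lambda>n. \<phi>c n j * \<psi> n w) sums (\<Sum>k. a j k * w ^ k)" by simp
  then have "(\<Sum>k. a j k * w ^ k) = C j w" using C_sums[OF w] sums_unique2 by blast
  then show "(\<lambda>k. a j k * w ^ k) sums C j w" using summable_sums[OF *(1)] by simp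
qed

text \<open>Coefficient of \<open>z^j\<close> in the factorization identity at fixed
  \<open>w\<close>; multiplication by \<open>z\<close> shifts the index, which
  \<open>case_nat\<close> expresses with the value 0 at \<open>j = 0\<close>.\<close>

lemma C_identity:
  assumes w: "cmod w < 1"
  shows "case_nat 0 (\<lambda>j. C j w) j - w * C j w = hc j * (1 - w) - one_minus_coeff j * h w"
proof -
  define G where "G z = (\<Sum>n. \<phi> n z * \<psi> n w)" for z
  have G: "disc_series (\<lambda>j. C j w) G"
    unfolding disc_series_def
  proof (intro allI impI)
    fix z :: complex assume z: "cmod z < 1"
    have dom: "cmod (\<Sum>n<N. \<phi>c n j * \<psi> n w * z ^ j) \<le> (A + B) / 2 * cmod z ^ j" for N j
      unfolding sum_distrib_right[symmetric] norm_mult norm_power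
      by (intro mult_right_mono norm_sum_mult_le \<phi>c_bound \<psi>_bound w) simp
    have sm: "summable (\<lambda>k. (A + B) / 2 * cmod z ^ k)" using z by (intro summable_mult summable_geometric) simp
    note * = sums_swap_dominated[OF dom sm sums_mult2[OF C_sums[OF w]]]
    have "(\<Sum>j. \<phi>c n j * \<psi> n w * z ^ j) = \<phi> n z * \<psi> n w" for n
    proof -
      have "(\<lambda>j. \<phi>c n j * z ^ j * \<psi> n w) sums (\<phi> n z * \<psi> n w)"
        using \<phi>[of n] z unfolding disc_series_def by (intro sums_mult2) auto
      then show ?thesis by (intro sums_unique[symmetric]) (simp add: mult_ac)
    qed
    with *(2) have "(\<lambda>n. \<phi> n z * \<psi> n w) sums (\<Sum>j. C j w * z ^ j)" by simp
    then have "G z = (\<Sum>j. C j w * z ^ j)" unfolding G_def by (rule sums_unique[symmetric])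
    then show "(\<lambda>j. C j w * z ^ j) sums G z" using summable_sums[OF *(1)] by simp
  qed
  have Gsums: "(z - w) * G z = h z * (1 - w) - (1 - z) * h w" if z: "cmod z < 1" for z
  proof -
    have "summable (\<lambda>n. \<phi> n z * \<psi> n w)"
    proof (rule summable_norm_cancel, rule summable_comparison_test')
      show "summable (\<lambda>n. ((cmod (\<phi> n z))\<^sup>2 + (cmod (\<psi> n w))\<^sup>2) / 2)"
        by (intro summable_divide summable_add summable_squares_if_bounded[OF \<phi>_bound[OF z]]
            summable_squares_if_bounded[OF \<psi>_bound[OF w]])
      show "norm (norm (\<phi> n z * \<psi> n w)) \<le> ((cmod (\<phi> n z))\<^sup>2 + (cmod (\<psi> n w))\<^sup>2) / 2" for n
        unfolding norm_mult real_norm_def abs_mult abs_norm_cancel by (rule mult_le_half_squares)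
    qed
    then have "(\<lambda>n. (z - w) * (\<phi> n z * \<psi> n w)) sums ((z - w) * G z)"
      unfolding G_def by (intro sums_mult summable_sums)
    then show ?thesis using identity[OF z w] sums_unique2 by blast
  qed
  have "disc_series (\<lambda>j. case_nat 0 (\<lambda>j. C j w) j - w * C j w) (\<lambda>z. z * G z - w * G z)"
    by (intro disc_series_diff disc_series_shift disc_series_mult G)
  moreover have "disc_series (\<lambda>j. hc j * (1 - w) - one_minus_coeff j * h w) (\<lambda>z. h z * (1 - w) - (1 - z) * h w)"
    by (intro disc_series_diff disc_series_mult2 h disc_series_one_minus)
  then have "disc_series (\<lambda>j. hc j * (1 - w) - one_minus_coeff j * h w) (\<lambda>z. z * G z - w * G z)"
    using Gsums unfolding disc_series_def by (simp add: left_diff_distrib)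
  ultimately show ?thesis using disc_series_unique by (metis (mono_tags, lifting))
qed

lemma shift_a_series: "disc_series (case_nat (\<lambda>_. 0) a j) (\<lambda>w. case_nat 0 (\<lambda>j. C j w) j)"
  by (cases j) (auto simp: C_series, simp add: disc_series_def)

text \<open>The left side is \<open>a (j - 1) k - a j (k - 1)\<close> with terms of negative index
  read as 0, that is, the coefficient of \<open>z^j w^k\<close> in
  \<open>(z - w) \<Sum>\<^sub>n \<phi>\<^sub>n(z) \<psi>\<^sub>n(w)\<close>.\<close>

lemma a_identity:
  "(\<lambda>k. case_nat (\<lambda>_. 0) a j k - case_nat 0 (a j) k) = (\<lambda>k. hc j * one_minus_coeff k - one_minus_coeff j * hc k)"
proof (rule disc_series_unique)
  let ?g = "\<lambda>w. hc j * (1 - w) - one_minus_coeff j * h w"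
  show "disc_series (\<lambda>k. hc j * one_minus_coeff k - one_minus_coeff j * hc k) ?g"
    by (intro disc_series_diff disc_series_mult h disc_series_one_minus)
  have "disc_series (\<lambda>k. case_nat (\<lambda>_. 0) a j k - case_nat 0 (a j) k) (\<lambda>w. case_nat 0 (\<lambda>j. C j w) j - w * C j w)"
    by (intro disc_series_diff shift_a_series disc_series_shift C_series)
  then show "disc_series (\<lambda>k. case_nat (\<lambda>_. 0) a j k - case_nat 0 (a j) k) ?g"
    unfolding disc_series_def using C_identity by simp
qed

end

text \<open>Here \<open>v n\<close> stands for \<open>\<psi>\<^sub>n(T\<^sub>2) x\<close> and
  \<open>hv\<close> for \<open>h(T\<^sub>2) x\<close>. They enter only as radial limits, so the
  argument concerns an arbitrary pair of contractions.\<close>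

locale disc_factorization_ops = disc_factorization \<phi> \<psi> \<phi>c \<psi>c h hc A B
  for \<phi> \<psi> :: "nat \<Rightarrow> complex \<Rightarrow> complex" and \<phi>c \<psi>c :: "nat \<Rightarrow> nat \<Rightarrow> complex"
    and h :: "complex \<Rightarrow> complex" and hc :: "nat \<Rightarrow> complex" and A B :: real +
  fixes T1 T2 :: "'h::chilbert_space \<Rightarrow> 'h" and x :: 'h and v :: "nat \<Rightarrow> 'h" and hv :: 'h
  assumes T1: "ccontraction T1" and T2: "ccontraction T2"
    and v: "\<And>n. ((\<lambda>s. pser (dilate (\<psi>c n) s) T2 x) \<longlongrightarrow> v n) (at_left 1)"
    and hv: "((\<lambda>s. pser (dilate hc s) T2 x) \<longlongrightarrow> hv) (at_left 1)"
begin

lemma ev_unit: "\<forall>\<^sub>F s in at_left (1::real). 0 \<le> s \<and> s < 1"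
  using eventually_at_left_real[OF zero_less_one] by eventually_elim auto

lemma u_bound: "0 \<le> s \<Longrightarrow> s < 1 \<Longrightarrow> (\<Sum>n<N. (norm (pser (dilate (\<psi>c n) s) T2 x))\<^sup>2) \<le> B * (norm x)\<^sup>2"
  by (rule von_Neumann_column_dilate[OF T2 _ \<psi> \<psi>_bound]) auto

lemma v_bound: "(\<Sum>n<N. (norm (v n))\<^sup>2) \<le> B * (norm x)\<^sup>2"
proof (rule tendsto_upperbound)
  show "((\<lambda>s. \<Sum>n<N. (norm (pser (dilate (\<psi>c n) s) T2 x))\<^sup>2) \<longlongrightarrow> (\<Sum>n<N. (norm (v n))\<^sup>2)) (at_left 1)"
    by (intro tendsto_intros v)
  show "\<forall>\<^sub>F s in at_left 1. (\<Sum>n<N. (norm (pser (dilate (\<psi>c n) s) T2 x))\<^sup>2) \<le> B * (norm x)\<^sup>2"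
    using ev_unit by eventually_elim (use u_bound in auto)
qed simp

text \<open>The vector \<open>C j (T\<^sub>2) x\<close>: the coefficient of \<open>z^j\<close> after
  \<open>w\<close> has been replaced by the second contraction.\<close>

definition w :: "nat \<Rightarrow> 'h" where "w j = (\<Sum>n. cscale (\<phi>c n j) (v n))"

lemma pser_a_sums:
  assumes s: "0 \<le> s" "s < 1"
  shows "(\<lambda>n. cscale (\<phi>c n j) (pser (dilate (\<psi>c n) s) T2 x)) sums pser (dilate (a j) s) T2 x"
proof -
  let ?e = "\<lambda>n k. cscale (\<phi>c n j * \<psi>c n k * complex_of_real (s ^ k)) ((T2 ^^ k) x)"
  have part: "(\<Sum>n<N. ?e n k) = cscale ((\<Sum>n<N. \<phi>c n j * \<psi>c n k) * complex_of_real (s ^ k)) ((T2 ^^ k) x)" for N k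
    by (simp only: sum_distrib_right bounded_bilinear.sum_left[OF bounded_bilinear_cscale])
  have dom: "norm (\<Sum>n<N. ?e n k) \<le> (A + B) / 2 * (s ^ k * norm x)" for N k
  proof -
    have "norm (\<Sum>n<N. ?e n k) = cmod (\<Sum>n<N. \<phi>c n j * \<psi>c n k) * (s ^ k * norm ((T2 ^^ k) x))"
      unfolding part using s by (simp add: norm_cscale norm_mult norm_power)
    also have "\<dots> \<le> (A + B) / 2 * (s ^ k * norm x)"
      using s A B by (intro mult_mono norm_sum_mult_le \<phi>c_bound \<psi>c_bound
          ccontractionD(3)[OF ccontraction_funpow[OF T2]]) auto
    finally show ?thesis .
  qed
  have sm: "summable (\<lambda>k. (A + B) / 2 * (s ^ k * norm x))"
    using s by (intro summable_mult summable_mult2 summable_geometric) auto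
  have E: "(\<lambda>n. ?e n k) sums cscale (dilate (a j) s k) ((T2 ^^ k) x)" for k
    unfolding dilate_def
    by (intro bounded_linear.sums[OF bounded_bilinear.bounded_linear_left[OF bounded_bilinear_cscale]]
        sums_mult2 a_sums)
  have "(\<Sum>k. ?e n k) = cscale (\<phi>c n j) (pser (dilate (\<psi>c n) s) T2 x)" for n
    using pser_mult_coeff[OF T2 summable_dilate[OF \<psi> s], of "\<phi>c n j" n x]
    by (simp add: pser_def dilate_def mult.assoc)
  with sums_swap_dominated(2)[OF dom sm E] show ?thesis by (simp add: pser_def)
qed

text \<open>The interchange is uniform in \<open>s\<close> because the Taylor coefficients \<open>(\<phi>c n j)\<^sub>n\<close> are square
  summable while the columns \<open>(\<psi>\<^sub>n(s T\<^sub>2) x)\<^sub>n\<close> stay bounded in \<open>\<ell>\<^sup>2\<close>.\<close>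
lemma w_limit:
  "(\<lambda>n. cscale (\<phi>c n j) (v n)) sums w j"
  "((\<lambda>s. pser (dilate (a j) s) T2 x) \<longlongrightarrow> w j) (at_left 1)"
proof -
  let ?f = "\<lambda>n s. cscale (\<phi>c n j) (pser (dilate (\<psi>c n) s) T2 x)"
  have lim: "(?f n \<longlongrightarrow> cscale (\<phi>c n j) (v n)) (at_left 1)" for n
    by (intro tendsto_cscale tendsto_const v)
  have sm: "\<forall>\<^sub>F s in at_left 1. summable (\<lambda>n. ?f n s)"
    using ev_unit by eventually_elim (use pser_a_sums sums_summable in blast)
  have tail: "\<exists>M. \<forall>\<^sub>F s in at_left 1. \<forall>N\<ge>M. norm (\<Sum>n=M..<N. ?f n s) \<le> e" if "e > 0" for e
  proof -
    define K where "K = B * (norm x)\<^sup>2 + 1"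
    have K: "K > 0" using B by (simp add: K_def add_nonneg_pos)
    \<comment> \<open>Weight that balances the two factors: the coefficient tail is taken below
      \<open>e / t\<^sup>2\<close>, and the column, bounded by \<open>K\<close>, contributes
      \<open>K / t\<^sup>2 = e\<close>. The summand 1 in \<open>K\<close> keeps it positive for
      \<open>x = 0\<close>.\<close>
    define t where "t = sqrt (K / e)"
    have t: "t > 0" using K that by (simp add: t_def)
    have t2: "t\<^sup>2 = K / e" using K that by (simp add: t_def)
    have "summable (\<lambda>n. (cmod (\<phi>c n j))\<^sup>2)" by (rule summable_squares_if_bounded[OF \<phi>c_bound])
    moreover have "e / t\<^sup>2 > 0" using t that by simp
    ultimately obtain M where M: "\<And>m n. m \<ge> M \<Longrightarrow> norm (\<Sum>n=m..<n. (cmod (\<phi>c n j))\<^sup>2) < e / t\<^sup>2"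
      unfolding summable_Cauchy by blast
    have "norm (\<Sum>n=M..<N. ?f n s) \<le> e" if s: "0 \<le> s" "s < 1" for s N
    proof -
      let ?u = "\<lambda>n. pser (dilate (\<psi>c n) s) T2 x"
      have "(\<Sum>n=M..<N. ?f n s) = (\<Sum>n=M..<N. cscale (complex_of_real t * \<phi>c n j) (cscale (complex_of_real (1 / t)) (?u n)))"
        using t by (intro sum.cong refl) (simp add: cscale_cscale)
      also have "norm \<dots> \<le> (e + e) / 2"
      proof (rule norm_sum_cscale_le)
        have "(\<Sum>n=M..<N. (cmod (complex_of_real t * \<phi>c n j))\<^sup>2) = t\<^sup>2 * (\<Sum>n=M..<N. (cmod (\<phi>c n j))\<^sup>2)"
          by (simp add: norm_mult power_mult_distrib sum_distrib_left)
        also have "\<dots> \<le> t\<^sup>2 * (e / t\<^sup>2)"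
          using M[of M N] by (intro mult_left_mono) auto
        finally show "(\<Sum>n=M..<N. (cmod (complex_of_real t * \<phi>c n j))\<^sup>2) \<le> e" using t by simp
        have "(\<Sum>n=M..<N. (norm (cscale (complex_of_real (1 / t)) (?u n)))\<^sup>2) = (\<Sum>n=M..<N. (norm (?u n))\<^sup>2) / t\<^sup>2"
          by (simp add: norm_cscale norm_divide power_divide sum_divide_distrib)
        also have "\<dots> \<le> K / t\<^sup>2"
        proof (rule divide_right_mono)
          have "(\<Sum>n=M..<N. (norm (?u n))\<^sup>2) \<le> (\<Sum>n<N. (norm (?u n))\<^sup>2)" by (intro sum_mono2) auto
          then show "(\<Sum>n=M..<N. (norm (?u n))\<^sup>2) \<le> K" using u_bound[OF s, of N] by (simp add: K_def)
        qed simp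
        also have "\<dots> = e" using K that \<open>e > 0\<close> by (simp add: t2)
        finally show "(\<Sum>n=M..<N. (norm (cscale (complex_of_real (1 / t)) (?u n)))\<^sup>2) \<le> e" .
      qed
      finally show ?thesis by simp
    qed
    then have "\<forall>\<^sub>F s in at_left 1. \<forall>N\<ge>M. norm (\<Sum>n=M..<N. ?f n s) \<le> e"
      using ev_unit by (auto elim: eventually_mono)
    then show ?thesis ..
  qed
  note * = series_limit_interchange[of ?f "\<lambda>n. cscale (\<phi>c n j) (v n)" "at_left 1",
      OF lim trivial_limit_at_left_real sm tail]
  show "(\<lambda>n. cscale (\<phi>c n j) (v n)) sums w j" unfolding w_def by (rule summable_sums[OF *(1)])
  have "\<forall>\<^sub>F s in at_left 1. (\<Sum>n. ?f n s) = pser (dilate (a j) s) T2 x"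
    using ev_unit by eventually_elim (blast intro: sums_unique[OF pser_a_sums, symmetric])
  from Lim_transform_eventually[OF *(2) this]
  show "((\<lambda>s. pser (dilate (a j) s) T2 x) \<longlongrightarrow> w j) (at_left 1)" unfolding w_def .
qed

text \<open>Row \<open>j\<close> of the coefficient identity evaluated at \<open>sT2\<close> and
  \<open>x\<close>, in the limit as \<open>s\<close> tends to 1. For fixed \<open>j\<close> only one
  contraction is involved.\<close>

lemma w_identity:
  "case_nat 0 w j - T2 (w j) = cscale (hc j) (x - T2 x) - cscale (one_minus_coeff j) hv"
proof -
  interpret T2: bounded_linear T2 by (rule ccontraction_bounded_linear[OF T2])
  let ?P = "\<lambda>c s. pser (dilate c s) T2 x"
  have eq: "?P (case_nat (\<lambda>_. 0) a j) s - cscale (complex_of_real s) (T2 (?P (a j) s))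
      = cscale (hc j) (x - cscale (complex_of_real s) (T2 x)) - cscale (one_minus_coeff j) (?P hc s)"
    if s: "0 \<le> s \<and> s < 1" for s
  proof -
    have s: "0 \<le> s" "s < 1" using s by auto
    have "?P (\<lambda>k. case_nat (\<lambda>_. 0) a j k - case_nat 0 (a j) k) s
        = ?P (case_nat (\<lambda>_. 0) a j) s - cscale (complex_of_real s) (T2 (?P (a j) s))"
      by (subst pser_dilate_diff[OF T2 shift_a_series disc_series_shift[OF C_series] s])
        (simp add: pser_dilate_shift[OF T2 C_series s])
    moreover have "?P (\<lambda>k. hc j * one_minus_coeff k - one_minus_coeff j * hc k) s
        = cscale (hc j) (x - cscale (complex_of_real s) (T2 x)) - cscale (one_minus_coeff j) (?P hc s)"
      by (subst pser_dilate_diff[OF T2 disc_series_mult[OF disc_series_one_minus] disc_series_mult[OF h] s])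
        (simp add: pser_dilate_mult[OF T2 disc_series_one_minus s] pser_dilate_mult[OF T2 h s]
          pser_dilate_one_minus[OF T2 s])
    ultimately show ?thesis by (simp add: a_identity)
  qed
  have "((\<lambda>s. ?P (case_nat (\<lambda>_. 0) a j) s) \<longlongrightarrow> case_nat 0 w j) (at_left 1)"
  proof (cases j)
    case 0
    have "?P (\<lambda>_. 0) s = 0" for s by (simp add: pser_def dilate_def)
    then show ?thesis using 0 by simp
  qed (use w_limit(2) in simp)
  then have 1: "((\<lambda>s. ?P (case_nat (\<lambda>_. 0) a j) s - cscale (complex_of_real s) (T2 (?P (a j) s)))
      \<longlongrightarrow> case_nat 0 w j - cscale (complex_of_real 1) (T2 (w j))) (at_left 1)"
    by (intro tendsto_intros tendsto_cscale T2.tendsto w_limit(2))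
  have 2: "((\<lambda>s. cscale (hc j) (x - cscale (complex_of_real s) (T2 x)) - cscale (one_minus_coeff j) (?P hc s))
      \<longlongrightarrow> cscale (hc j) (x - cscale (complex_of_real 1) (T2 x)) - cscale (one_minus_coeff j) hv) (at_left 1)"
    by (intro tendsto_intros tendsto_cscale hv)
  have "\<forall>\<^sub>F s in at_left 1. ?P (case_nat (\<lambda>_. 0) a j) s - cscale (complex_of_real s) (T2 (?P (a j) s))
      = cscale (hc j) (x - cscale (complex_of_real s) (T2 x)) - cscale (one_minus_coeff j) (?P hc s)"
    using ev_unit by eventually_elim (rule eq)
  from Lim_transform_eventually[OF 1 this] 2
  have "case_nat 0 w j - cscale (complex_of_real 1) (T2 (w j))
      = cscale (hc j) (x - cscale (complex_of_real 1) (T2 x)) - cscale (one_minus_coeff j) hv"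
    by (rule tendsto_unique[rotated]) simp
  then show ?thesis by (simp add: cscale_one)
qed

lemma w_bound: "norm (w j) \<le> (A + B * (norm x)\<^sup>2) / 2"
proof (rule LIMSEQ_le_const2)
  show "(\<lambda>N. norm (\<Sum>n<N. cscale (\<phi>c n j) (v n))) \<longlonglongrightarrow> norm (w j)"
    using w_limit(1)[of j] by (intro tendsto_norm) (simp add: sums_def)
  show "\<exists>N0. \<forall>N\<ge>N0. norm (\<Sum>n<N. cscale (\<phi>c n j) (v n)) \<le> (A + B * (norm x)\<^sup>2) / 2"
    using norm_sum_cscale_le[OF \<phi>c_bound v_bound] by blast
qed

text \<open>The variable \<open>z\<close> is replaced by \<open>rT1\<close> through multiplying row
  \<open>j\<close> by \<open>(rT1)^j\<close> and adding up. The uniform bound on \<open>w j\<close>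
  and the factor \<open>r^j\<close> justify the interchange of the sums over \<open>n\<close> and
  \<open>j\<close>.\<close>

lemma double_series_dilated:
  assumes r: "0 \<le> r" "r < 1"
  shows "(\<lambda>n. pser (dilate (\<phi>c n) r) T1 (cscale (complex_of_real r) (T1 (v n)) - T2 (v n)))
    sums (pser (dilate hc r) T1 (x - T2 x) - (hv - cscale (complex_of_real r) (T1 hv)))"
proof -
  define X where "X z = cscale (complex_of_real r) (T1 z) - T2 z" for z
  define Q where "Q = (A + B * (norm x)\<^sup>2) / 2"
  have Q0: "Q \<ge> 0" using A B by (simp add: Q_def)
  define Y where "Y j z = cscale (complex_of_real (r ^ j)) ((T1 ^^ j) z)" for j z
  have X_add: "X (z + z') = X z + X z'" and X_scale: "X (cscale b z) = cscale b (X z)" for z z' b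
    by (simp_all add: X_def ccontractionD[OF T1] ccontractionD[OF T2] cscale_add_right cscale_diff_right
        cscale_cscale mult.commute)
  have X_norm: "norm (X z) \<le> 2 * norm z" for z
  proof -
    have "r * norm (T1 z) \<le> norm z"
      using mult_mono[of r 1 "norm (T1 z)" "norm z"] r ccontractionD(3)[OF T1] by simp
    then show ?thesis
      using norm_triangle_ineq4[of "cscale (complex_of_real r) (T1 z)" "T2 z"] r ccontractionD(3)[OF T2, of z]
      by (simp add: X_def norm_cscale)
  qed
  have X: "bounded_linear X"
    by (rule bounded_linear_intro[of _ 2]) (use X_add X_scale X_norm in \<open>auto simp: scaleR_cscale mult.commute\<close>)
  have Y: "bounded_linear (Y j)" for j
    unfolding Y_def
    by (rule bounded_linear_compose[OF bounded_linear_cscale_right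
          ccontraction_bounded_linear[OF ccontraction_funpow[OF T1]]])
  have Y_norm: "norm (Y j z) \<le> r ^ j * norm z" for j z
    unfolding Y_def using r ccontractionD(3)[OF ccontraction_funpow[OF T1]]
    by (simp add: norm_cscale norm_power mult_left_mono)
  have Y_scale: "Y j (cscale b z) = cscale b (Y j z)" for j b z
    unfolding Y_def by (simp add: ccontractionD[OF ccontraction_funpow[OF T1]] cscale_cscale mult.commute)
  have YX: "bounded_linear (\<lambda>z. Y j (X z))" for j by (rule bounded_linear_compose[OF Y X])
  let ?e = "\<lambda>n j. Y j (X (cscale (\<phi>c n j) (v n)))"
  have dom: "norm (\<Sum>n<N. ?e n j) \<le> r ^ j * (2 * Q)" for N j
  proof -
    have "(\<Sum>n<N. ?e n j) = Y j (X (\<Sum>n<N. cscale (\<phi>c n j) (v n)))"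
      by (rule linear_sum[OF bounded_linear.linear[OF YX], symmetric])
    also have "norm \<dots> \<le> r ^ j * (2 * Q)"
    proof (rule order_trans[OF Y_norm mult_left_mono])
      show "norm (X (\<Sum>n<N. cscale (\<phi>c n j) (v n))) \<le> 2 * Q"
        using X_norm[of "\<Sum>n<N. cscale (\<phi>c n j) (v n)"] norm_sum_cscale_le[OF \<phi>c_bound v_bound, of j N]
        unfolding Q_def by linarith
    qed (use r in simp)
    finally show ?thesis .
  qed
  have sm: "summable (\<lambda>j. r ^ j * K)" for K
    using r by (intro summable_mult2 summable_geometric) simp
  have E: "(\<lambda>n. ?e n j) sums Y j (X (w j))" for j
    by (rule bounded_linear.sums[OF YX w_limit(1)])
  have inner: "(\<Sum>j. ?e n j) = pser (dilate (\<phi>c n) r) T1 (X (v n))" for n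
    by (simp add: pser_def dilate_def X_scale Y_scale) (simp add: Y_def cscale_cscale)
  have "(\<lambda>n. pser (dilate (\<phi>c n) r) T1 (X (v n))) sums (\<Sum>j. Y j (X (w j)))"
    using sums_swap_dominated(2)[OF dom sm E] by (simp add: inner)
  moreover have "(\<lambda>j. Y j (X (w j))) sums (pser (dilate hc r) T1 (x - T2 x) - (hv - cscale (complex_of_real r) (T1 hv)))"
  proof -
    have bdd: "summable (\<lambda>j. Y j (g j))" if "\<And>j. norm (g j) \<le> K" for g K
      by (rule summable_comparison_test'[OF sm]) (rule order_trans[OF Y_norm mult_left_mono[OF that]], use r in simp)
    have wQ: "norm (w j) \<le> Q" for j unfolding Q_def by (rule w_bound)
    have s1: "summable (\<lambda>j. Y j (case_nat 0 w j))"
      by (rule bdd[of _ Q]) (auto simp: wQ Q0 split: nat.split)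
    have s2: "summable (\<lambda>j. Y j (T2 (w j)))"
      by (rule bdd[of _ Q]) (rule order_trans[OF ccontractionD(3)[OF T2] wQ])
    \<comment> \<open>Since \<open>Y j\<close> after \<open>rT1\<close> is \<open>Y (Suc j)\<close>,
      the term with \<open>rT1\<close> in \<open>X\<close> is the shifted series; the index-0 term
      is \<open>Y 0\<close> of 0, so the shift costs nothing.\<close>
    have "(\<lambda>j. Y (Suc j) (case_nat 0 w (Suc j))) sums (\<Sum>j. Y j (case_nat 0 w j))"
      using summable_sums[OF s1] by (subst sums_Suc_iff) (simp add: linear_0[OF bounded_linear.linear[OF Y]])
    then have "(\<lambda>j. Y (Suc j) (w j) - Y j (T2 (w j))) sums ((\<Sum>j. Y j (case_nat 0 w j)) - (\<Sum>j. Y j (T2 (w j))))"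
      using summable_sums[OF s2] by (intro sums_diff) simp_all
    moreover have "Y j (X (w j)) = Y (Suc j) (w j) - Y j (T2 (w j))" for j
      unfolding X_def linear_diff[OF bounded_linear.linear[OF Y]] Y_scale
      by (simp add: Y_def cscale_cscale funpow_swap1)
    ultimately have lhs: "(\<lambda>j. Y j (X (w j))) sums ((\<Sum>j. Y j (case_nat 0 w j)) - (\<Sum>j. Y j (T2 (w j))))"
      by simp
    have "(\<lambda>j. Y j (case_nat 0 w j - T2 (w j))) sums ((\<Sum>j. Y j (case_nat 0 w j)) - (\<Sum>j. Y j (T2 (w j))))"
      unfolding linear_diff[OF bounded_linear.linear[OF Y]]
      by (intro sums_diff summable_sums s1 s2)
    moreover have "(\<lambda>j. Y j (case_nat 0 w j - T2 (w j))) sums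
        (pser (dilate hc r) T1 (x - T2 x) - pser (dilate one_minus_coeff r) T1 hv)"
    proof -
      have "Y j (case_nat 0 w j - T2 (w j)) = cscale (dilate hc r j) ((T1 ^^ j) (x - T2 x))
          - cscale (dilate one_minus_coeff r j) ((T1 ^^ j) hv)" for j
        unfolding w_identity linear_diff[OF bounded_linear.linear[OF Y]] Y_scale
        by (simp add: Y_def dilate_def cscale_diff_right cscale_cscale
            ccontractionD(4)[OF ccontraction_funpow[OF T1]])
      then show ?thesis
        using sums_diff[OF pser_sums[OF T1 summable_dilate[OF h r], of "x - T2 x"]
            pser_sums[OF T1 summable_dilate[OF disc_series_one_minus r], of hv]] by simp
    qed
    ultimately have "(\<Sum>j. Y j (case_nat 0 w j)) - (\<Sum>j. Y j (T2 (w j)))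
        = pser (dilate hc r) T1 (x - T2 x) - (hv - cscale (complex_of_real r) (T1 hv))"
      using sums_unique2 pser_dilate_one_minus[OF T1 r, of hv] by metis
    then show ?thesis using lhs by simp
  qed
  ultimately show ?thesis by (simp add: sums_iff X_def)
qed

text \<open>Now the vectors \<open>v n\<close> are fixed and square summable, so the row inequality
  makes the tails small uniformly in \<open>r\<close>.\<close>

lemma double_series:
  assumes \<Phi>: "\<And>n z. ((\<lambda>r. pser (dilate (\<phi>c n) r) T1 z) \<longlongrightarrow> \<Phi> n z) (at_left 1)"
    and H: "((\<lambda>r. pser (dilate hc r) T1 (x - T2 x)) \<longlongrightarrow> H) (at_left 1)"
  shows "(\<lambda>n. \<Phi> n (T1 (v n)) - \<Phi> n (T2 (v n))) sums (H - (hv - T1 hv))"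
proof -
  let ?f = "\<lambda>n r. pser (dilate (\<phi>c n) r) T1 (cscale (complex_of_real r) (T1 (v n)) - T2 (v n))"
  have lim: "(?f n \<longlongrightarrow> \<Phi> n (T1 (v n)) - \<Phi> n (T2 (v n))) (at_left 1)" for n
  proof -
    have "((\<lambda>r. cscale (complex_of_real r) (pser (dilate (\<phi>c n) r) T1 (T1 (v n))) - pser (dilate (\<phi>c n) r) T1 (T2 (v n)))
        \<longlongrightarrow> cscale (complex_of_real 1) (\<Phi> n (T1 (v n))) - \<Phi> n (T2 (v n))) (at_left 1)"
      by (intro tendsto_intros tendsto_cscale \<Phi>)
    moreover have "\<forall>\<^sub>F r in at_left 1. cscale (complex_of_real r) (pser (dilate (\<phi>c n) r) T1 (T1 (v n)))
        - pser (dilate (\<phi>c n) r) T1 (T2 (v n)) = ?f n r"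
      using ev_unit
    proof eventually_elim
      case (elim r)
      then have s: "summable (\<lambda>k. cmod (dilate (\<phi>c n) r k))" using summable_dilate[OF \<phi>] by blast
      show ?case by (simp add: pser_diff[OF T1 s] pser_cscale[OF T1 s])
    qed
    ultimately show ?thesis by (simp add: cscale_one Lim_transform_eventually)
  qed
  have sm: "\<forall>\<^sub>F r in at_left 1. summable (\<lambda>n. ?f n r)"
    using ev_unit by eventually_elim (use double_series_dilated sums_summable in blast)
  have tail: "\<exists>M. \<forall>\<^sub>F r in at_left 1. \<forall>N\<ge>M. norm (\<Sum>n=M..<N. ?f n r) \<le> e" if "e > 0" for e
  proof -
    have "summable (\<lambda>n. (norm (v n))\<^sup>2)" by (rule summable_squares_if_bounded[OF v_bound])
    \<comment> \<open>The row inequality costs the factor \<open>A\<close>, and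
      \<open>rT1 - T2\<close> has norm at most 2, which is squared.\<close>
    moreover have "e\<^sup>2 / (4 * A) > 0" using that A by simp
    ultimately obtain M where M: "\<And>m n. m \<ge> M \<Longrightarrow> norm (\<Sum>n=m..<n. (norm (v n))\<^sup>2) < e\<^sup>2 / (4 * A)"
      unfolding summable_Cauchy by blast
    have "norm (\<Sum>n=M..<N. ?f n r) \<le> e" if r: "0 \<le> r" "r < 1" for r N
    proof (rule power2_le_imp_le)
      have X_norm: "norm (cscale (complex_of_real r) (T1 z) - T2 z) \<le> 2 * norm z" for z
      proof -
        have "r * norm (T1 z) \<le> norm z"
          using mult_mono[of r 1 "norm (T1 z)" "norm z"] r ccontractionD(3)[OF T1] by simp
        then show ?thesis
          using norm_triangle_ineq4[of "cscale (complex_of_real r) (T1 z)" "T2 z"] r ccontractionD(3)[OF T2, of z]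
          by (simp add: norm_cscale)
      qed
      have "(norm (\<Sum>n=M..<N. ?f n r))\<^sup>2 \<le> A * (\<Sum>n=M..<N. (norm (cscale (complex_of_real r) (T1 (v n)) - T2 (v n)))\<^sup>2)"
      proof (rule von_Neumann_row_dilate[OF T1 _ \<phi> _ r A])
        fix z :: complex assume z: "cmod z < 1"
        have "(\<Sum>n=M..<N. (cmod (\<phi> n z))\<^sup>2) \<le> (\<Sum>n<N. (cmod (\<phi> n z))\<^sup>2)" by (intro sum_mono2) auto
        then show "(\<Sum>n=M..<N. (cmod (\<phi> n z))\<^sup>2) \<le> A" using \<phi>_bound[OF z, of N] by linarith
      qed simp
      also have "\<dots> \<le> A * (\<Sum>n=M..<N. (2 * norm (v n))\<^sup>2)"
        using A by (intro mult_left_mono sum_mono power_mono X_norm) auto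
      also have "\<dots> = 4 * A * (\<Sum>n=M..<N. (norm (v n))\<^sup>2)"
        by (simp add: power_mult_distrib sum_distrib_left mult_ac)
      also have "\<dots> \<le> 4 * A * (e\<^sup>2 / (4 * A))"
        using M[of M N] A by (intro mult_left_mono) auto
      also have "\<dots> = e\<^sup>2" using A by simp
      finally show "(norm (\<Sum>n=M..<N. ?f n r))\<^sup>2 \<le> e\<^sup>2" .
    qed (use \<open>e > 0\<close> in simp)
    then have "\<forall>\<^sub>F r in at_left 1. \<forall>N\<ge>M. norm (\<Sum>n=M..<N. ?f n r) \<le> e"
      using ev_unit by (auto elim: eventually_mono)
    then show ?thesis ..
  qed
  note * = series_limit_interchange[of ?f "\<lambda>n. \<Phi> n (T1 (v n)) - \<Phi> n (T2 (v n))" "at_left 1",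
      OF lim trivial_limit_at_left_real sm tail]
  have "\<forall>\<^sub>F r in at_left 1. (\<Sum>n. ?f n r)
      = pser (dilate hc r) T1 (x - T2 x) - (hv - cscale (complex_of_real r) (T1 hv))"
    using ev_unit by eventually_elim (blast intro: sums_unique[OF double_series_dilated, symmetric])
  from Lim_transform_eventually[OF *(2) this]
  have "((\<lambda>r. pser (dilate hc r) T1 (x - T2 x) - (hv - cscale (complex_of_real r) (T1 hv)))
      \<longlongrightarrow> (\<Sum>n. \<Phi> n (T1 (v n)) - \<Phi> n (T2 (v n)))) (at_left 1)" .
  moreover have "((\<lambda>r. pser (dilate hc r) T1 (x - T2 x) - (hv - cscale (complex_of_real r) (T1 hv)))
      \<longlongrightarrow> H - (hv - cscale (complex_of_real 1) (T1 hv))) (at_left 1)"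
    by (intro tendsto_intros tendsto_cscale H)
  ultimately have "(\<Sum>n. \<Phi> n (T1 (v n)) - \<Phi> n (T2 (v n))) = H - (hv - cscale (complex_of_real 1) (T1 hv))"
    by (rule tendsto_unique[rotated]) simp
  then show ?thesis using summable_sums[OF *(1)] by (simp add: cscale_one)
qed

end

section \<open>The theorem for maximal dissipative operators\<close>

text \<open>The class on which \<open>fcalc\<close> is a genuine limit. Unlike \<open>CA\<close> it
  asks only for boundedness at infinity, as is suitable for \<open>f_i f\<close>.\<close>

definition admissible :: "(complex \<Rightarrow> complex) \<Rightarrow> bool" where
  "admissible g \<longleftrightarrow> g holomorphic_on cuhp \<and> continuous_on cuhp_clos g \<and> (\<exists>B. \<forall>z\<in>cuhp. cmod (g z) \<le> B)"

lemma admissible_tendsto: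
  fixes D :: "'h::chilbert_space set"
  assumes "max_dissipative D L" "admissible g"
  shows "((\<lambda>r. pser (dilate (taylor_coeff (g \<circ> omega)) r) (cayley D L) x) \<longlongrightarrow> fcalc g D L x) (at_left 1)"
  using assms fcalc_tendsto unfolding admissible_def by blast

lemma fcalc_linear:
  fixes D :: "'h::chilbert_space set"
  assumes max: "max_dissipative D L" and g: "admissible g"
  shows "fcalc g D L (x - y) = fcalc g D L x - fcalc g D L y"
    and "fcalc g D L (cscale b x) = cscale b (fcalc g D L x)"
    and "fcalc g D L (cayley D L x) = cayley D L (fcalc g D L x)"
proof -
  let ?T = "cayley D L"
  let ?P = "\<lambda>r. pser (dilate (taylor_coeff (g \<circ> omega)) r) ?T"
  note T = ccontraction_cayley[OF max]
  note lim = admissible_tendsto[OF max g]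
  have ev: "\<forall>\<^sub>F r in at_left (1::real). summable (\<lambda>k. cmod (dilate (taylor_coeff (g \<circ> omega)) r k))"
    using eventually_at_left_real[OF zero_less_one]
    by eventually_elim (use g in \<open>auto intro!: summable_dilate[OF disc_series_taylor] simp: admissible_def\<close>)
  have uniq: "l = l'" if "(F \<longlongrightarrow> l) (at_left (1::real))" "(F' \<longlongrightarrow> l') (at_left 1)" "\<forall>\<^sub>F r in at_left 1. F r = F' r"
    for F F' and l l' :: 'h
    using tendsto_unique[OF _ Lim_transform_eventually[OF that(1,3)] that(2)] by simp
  show "fcalc g D L (x - y) = fcalc g D L x - fcalc g D L y"
    using ev by (intro uniq[OF lim tendsto_diff[OF lim lim]]) (auto elim!: eventually_mono simp: pser_diff[OF T])
  show "fcalc g D L (cscale b x) = cscale b (fcalc g D L x)"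
    using ev by (intro uniq[OF lim tendsto_cscale[OF tendsto_const lim]])
      (auto elim!: eventually_mono simp: pser_cscale[OF T])
  show "fcalc g D L (?T x) = ?T (fcalc g D L x)"
    using ev by (intro uniq[OF lim bounded_linear.tendsto[OF ccontraction_bounded_linear[OF T] lim]])
      (auto elim!: eventually_mono simp: pser_commute[OF T])
qed

lemma fcalc_res_i:
  fixes D :: "'h::chilbert_space set"
  assumes "max_dissipative D L" "admissible g"
  shows "fcalc g D L (res_i D L x) = res_i D L (fcalc g D L x)"
  by (simp add: res_i_eq_cayley fcalc_linear[OF assms])

text \<open>\<open>f_i(L)\<close> commutes with the resolvent, hence maps the range \<open>D\<close>
  of the resolvent into \<open>D\<close>, and \<open>L + iI\<close> then cancels the
  resolvent.\<close>

lemma fop_res_i: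
  fixes D :: "'h::chilbert_space set"
  assumes "max_dissipative D L" "admissible (f_i f)"
  shows "res_i D L x \<in> fop_dom f D L" "fop f D L (res_i D L x) = fcalc (f_i f) D L x"
  using res_i_works(1,2)[OF assms(1), of "fcalc (f_i f) D L x"]
  by (simp_all add: fop_dom_def fop_def fcalc_res_i[OF assms])

text \<open>A Lipschitz function grows at most linearly, and the denominator absorbs this: in the
  upper half-plane \<open>cmod (z - \<i>)\<close> and 1 are both at most
  \<open>cmod (z + \<i>)\<close>, so comparison with the value at \<open>\<i>\<close> gives the
  bound.\<close>

lemma admissible_f_i:
  assumes hol: "f holomorphic_on cuhp" and cont: "continuous_on cuhp_clos f"
    and lip: "\<And>z w. z \<in> cuhp \<Longrightarrow> w \<in> cuhp \<Longrightarrow> cmod (f z - f w) \<le> K * cmod (z - w)"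
  shows "admissible (f_i f)"
  unfolding admissible_def
proof (intro conjI exI ballI)
  have nz: "z + \<i> \<noteq> 0" if "Im z \<ge> 0" for z using that by (auto simp: complex_eq_iff)
  show "f_i f holomorphic_on cuhp"
    unfolding f_i_def[abs_def] by (intro holomorphic_intros hol) (auto simp: cuhp_def nz)
  show "continuous_on cuhp_clos (f_i f)"
    unfolding f_i_def[abs_def] by (intro continuous_intros cont) (auto simp: cuhp_clos_def nz)
  fix z assume z: "z \<in> cuhp"
  have i: "\<i> \<in> cuhp" by (simp add: cuhp_def)
  have K: "K \<ge> 0"
  proof -
    have "0 \<le> K * cmod (\<i> - 2 * \<i>)"
      using lip[OF i, of "2 * \<i>"] by (intro order_trans[OF norm_ge_zero]) (simp add: cuhp_def)
    then show ?thesis by simp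
  qed
  have Im: "Im z > 0" using z by (simp add: cuhp_def)
  have ge1: "cmod (z + \<i>) \<ge> 1" using abs_Im_le_cmod[of "z + \<i>"] Im by simp
  have le: "cmod (z - \<i>) \<le> cmod (z + \<i>)"
    unfolding cmod_def using Im by (simp add: power2_eq_square algebra_simps)
  have "cmod (f z) \<le> cmod (f \<i>) + cmod (f z - f \<i>)" using norm_triangle_sub[of "f z" "f \<i>"] by simp
  also have "\<dots> \<le> cmod (f \<i>) * cmod (z + \<i>) + K * cmod (z + \<i>)"
  proof (rule add_mono)
    show "cmod (f \<i>) \<le> cmod (f \<i>) * cmod (z + \<i>)" using mult_left_mono[OF ge1, of "cmod (f \<i>)"] by simp
    show "cmod (f z - f \<i>) \<le> K * cmod (z + \<i>)" using lip[OF z i] mult_left_mono[OF le K] by linarith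
  qed
  finally have "cmod (f z) \<le> (cmod (f \<i>) + K) * cmod (z + \<i>)" by (simp add: distrib_right)
  then show "cmod (f_i f z) \<le> cmod (f \<i>) + K"
    unfolding f_i_def norm_divide using ge1 by (subst pos_divide_le_eq) auto
qed

lemma omega_plus_i: "\<zeta> \<noteq> 1 \<Longrightarrow> omega \<zeta> + \<i> = 2 * \<i> / (1 - \<zeta>)"
  by (simp add: omega_def field_simps)

theorem theorem4p1:
  fixes D1 D2 :: "'h::chilbert_space set"
    and L1 L2 :: "'h \<Rightarrow> 'h"
    and f :: "complex \<Rightarrow> complex"
    and \<phi> \<psi> :: "nat \<Rightarrow> complex \<Rightarrow> complex"
  assumes L1: "max_dissipative D1 L1"
    and L2: "max_dissipative D2 L2"
    and fOL: "OLA TYPE('h) f"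
    and \<phi>CA: "\<And>n. \<phi> n \<in> CA"
    and \<psi>CA: "\<And>n. \<psi> n \<in> CA"
    and decomp: "\<And>z w. z \<in> cuhp_clos \<Longrightarrow> w \<in> cuhp_clos \<Longrightarrow> z \<noteq> w \<Longrightarrow>
                   (\<lambda>n. \<phi> n z * \<psi> n w) sums ((f z - f w) / (z - w))"
    and decomp_diag: "\<And>z. z \<in> cuhp_clos \<Longrightarrow>
                   (f has_field_derivative (\<Sum>n. \<phi> n z * \<psi> n z)) (at z within cuhp_clos) \<and>
                   summable (\<lambda>n. \<phi> n z * \<psi> n z)"
    and \<phi>bd: "\<exists>A. \<forall>z\<in>cuhp. summable (\<lambda>n. (cmod (\<phi> n z))\<^sup>2) \<and> (\<Sum>n. (cmod (\<phi> n z))\<^sup>2) \<le> A"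
    and \<psi>bd: "\<exists>B. \<forall>w\<in>cuhp. summable (\<lambda>n. (cmod (\<psi> n w))\<^sup>2) \<and> (\<Sum>n. (cmod (\<psi> n w))\<^sup>2) \<le> B"
  shows "\<forall>x. res_i D1 L1 (res_i D2 L2 x) \<in> fop_dom f D1 L1 \<and> res_i D2 L2 x \<in> fop_dom f D2 L2 \<and>
           fcalc (f_i f) D1 L1 (res_i D2 L2 x) - res_i D1 L1 (fcalc (f_i f) D2 L2 x)
             = fop f D1 L1 (res_i D1 L1 (res_i D2 L2 x)) - res_i D1 L1 (fop f D2 L2 (res_i D2 L2 x)) \<and>
           (\<forall>y. (\<lambda>n. cinner (fcalc (\<phi> n) D1 L1
                          (res_i D2 L2 (fcalc (\<psi> n) D2 L2 x) - res_i D1 L1 (fcalc (\<psi> n) D2 L2 x))) y)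
                 sums cinner (fcalc (f_i f) D1 L1 (res_i D2 L2 x) - res_i D1 L1 (fcalc (f_i f) D2 L2 x)) y)"
proof -
  obtain A0 where A0: "\<forall>z\<in>cuhp. summable (\<lambda>n. (cmod (\<phi> n z))\<^sup>2) \<and> (\<Sum>n. (cmod (\<phi> n z))\<^sup>2) \<le> A0"
    using \<phi>bd ..
  obtain B0 where B0: "\<forall>z\<in>cuhp. summable (\<lambda>n. (cmod (\<psi> n z))\<^sup>2) \<and> (\<Sum>n. (cmod (\<psi> n z))\<^sup>2) \<le> B0"
    using \<psi>bd ..
  \<comment> \<open>Strict positivity is wanted because the row inequality divides by its
    constant.\<close>
  define A where "A = \<bar>A0\<bar> + 1"
  define B where "B = \<bar>B0\<bar> + 1"
  have A: "A > 0" and B: "B > 0" by (auto simp: A_def B_def)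
  have \<phi>A: "(\<Sum>n<N. (cmod (\<phi> n z))\<^sup>2) \<le> A" if "z \<in> cuhp" for z N
    using sum_le_suminf[of "\<lambda>n. (cmod (\<phi> n z))\<^sup>2" "{..<N}"] bspec[OF A0 that] by (auto simp: A_def)
  have \<psi>B: "(\<Sum>n<N. (cmod (\<psi> n z))\<^sup>2) \<le> B" if "z \<in> cuhp" for z N
    using sum_le_suminf[of "\<lambda>n. (cmod (\<psi> n z))\<^sup>2" "{..<N}"] bspec[OF B0 that] by (auto simp: B_def)
  have single: "cmod (g n) \<le> C + 1" if "\<And>N. (\<Sum>n<N. (cmod (g n))\<^sup>2) \<le> C" for g :: "nat \<Rightarrow> complex" and C n
  proof -
    have "(cmod (g n))\<^sup>2 \<le> (\<Sum>n<Suc n. (cmod (g n))\<^sup>2)" by (simp add: sum_nonneg)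
    also have "\<dots> \<le> C" by (rule that)
    finally have "(cmod (g n))\<^sup>2 \<le> C" .
    then have "2 * cmod (g n) \<le> 1 + C" using mult_le_half_squares[of "cmod (g n)" 1] by simp
    moreover have "cmod (g n) \<ge> 0" by simp
    ultimately show ?thesis by linarith
  qed
  have adm\<phi>: "admissible (\<phi> n)" for n
    unfolding admissible_def using \<phi>CA[of n] single[OF \<phi>A] by (auto simp: CA_def)
  have adm\<psi>: "admissible (\<psi> n)" for n
    unfolding admissible_def using \<psi>CA[of n] single[OF \<psi>B] by (auto simp: CA_def)
  have sub: "cuhp \<subseteq> cuhp_clos" by (auto simp: cuhp_def cuhp_clos_def)
  \<comment> \<open>The partial sums of the factorization are bounded by \<open>(A + B) / 2\<close>,
    hence so are the difference quotients of \<open>f\<close>.\<close>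
  have lip: "cmod (f z - f w) \<le> (A + B) / 2 * cmod (z - w)" if zw: "z \<in> cuhp" "w \<in> cuhp" for z w
  proof (cases "z = w")
    case False
    have "cmod ((f z - f w) / (z - w)) \<le> (A + B) / 2"
    proof (rule LIMSEQ_le_const2)
      show "(\<lambda>N. cmod (\<Sum>n<N. \<phi> n z * \<psi> n w)) \<longlonglongrightarrow> cmod ((f z - f w) / (z - w))"
        using decomp[of z w] zw sub False by (intro tendsto_norm) (auto simp: sums_def)
      show "\<exists>N0. \<forall>N\<ge>N0. cmod (\<Sum>n<N. \<phi> n z * \<psi> n w) \<le> (A + B) / 2"
        using norm_sum_mult_le[OF \<phi>A[OF zw(1)] \<psi>B[OF zw(2)]] by blast
    qed
    then show ?thesis using False by (simp add: norm_divide pos_divide_le_eq)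
  qed simp
  have fhol: "f holomorphic_on cuhp" and fcont: "continuous_on cuhp_clos f" using fOL by (auto simp: OLA_def)
  have admf: "admissible (f_i f)" by (rule admissible_f_i[OF fhol fcont lip])
  define hc where "hc = taylor_coeff (f_i f \<circ> omega)"
  define \<phi>c where "\<phi>c n = taylor_coeff (\<phi> n \<circ> omega)" for n
  define \<psi>c where "\<psi>c n = taylor_coeff (\<psi> n \<circ> omega)" for n
  interpret disc_factorization "\<lambda>n. \<phi> n \<circ> omega" "\<lambda>n. \<psi> n \<circ> omega" \<phi>c \<psi>c "f_i f \<circ> omega" hc A B
  proof
    show "disc_series (\<phi>c n) (\<phi> n \<circ> omega)" "disc_series (\<psi>c n) (\<psi> n \<circ> omega)" "disc_series hc (f_i f \<circ> omega)" for n
      unfolding \<phi>c_def \<psi>c_def hc_def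
      using adm\<phi> adm\<psi> admf by (auto intro!: disc_series_taylor simp: admissible_def)
    show "0 < A" "0 < B" by (fact A, fact B)
    fix z :: complex assume z: "cmod z < 1"
    show "(\<Sum>n<N. (cmod ((\<phi> n \<circ> omega) z))\<^sup>2) \<le> A" "(\<Sum>n<N. (cmod ((\<psi> n \<circ> omega) z))\<^sup>2) \<le> B" for N
      using \<phi>A[OF omega_in_cuhp[OF z]] \<psi>B[OF omega_in_cuhp[OF z]] by auto
    fix w :: complex assume w: "cmod w < 1"
    let ?h = "f_i f \<circ> omega"
    have z1: "z \<noteq> 1" and w1: "w \<noteq> 1" using z w by auto
    show "(\<lambda>n. (z - w) * ((\<phi> n \<circ> omega) z * (\<psi> n \<circ> omega) w)) sums (?h z * (1 - w) - (1 - z) * ?h w)"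
    \<comment> \<open>On the diagonal both sides of the cleared identity vanish, so only distinct
      points call for the factorization.\<close>
    proof (cases "z = w")
      case False
      have hz: "?h z = f (omega z) * (1 - z) / (2 * \<i>)" "?h w = f (omega w) * (1 - w) / (2 * \<i>)"
        using z1 w1 by (simp_all add: f_i_def omega_plus_i)
      have "omega z - omega w = (omega z + \<i>) - (omega w + \<i>)" by simp
      also have "\<dots> = 2 * \<i> * (z - w) / ((1 - z) * (1 - w))"
        unfolding omega_plus_i[OF z1] omega_plus_i[OF w1] using z1 w1 by (simp add: field_simps)
      finally have diff: "omega z - omega w = 2 * \<i> * (z - w) / ((1 - z) * (1 - w))" .
      then have "omega z - omega w \<noteq> 0" using False z1 w1 by simp
      then have "omega z \<noteq> omega w" by auto
      then have "(\<lambda>n. (z - w) * (\<phi> n (omega z) * \<psi> n (omega w))) sums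
          ((z - w) * ((f (omega z) - f (omega w)) / (omega z - omega w)))"
        using omega_in_cuhp[OF z] omega_in_cuhp[OF w] sub by (intro sums_mult decomp) auto
      moreover have "(z - w) * ((f (omega z) - f (omega w)) / (omega z - omega w))
          = ?h z * (1 - w) - (1 - z) * ?h w"
        unfolding diff hz using False z1 w1 by (simp add: field_simps)
      ultimately show ?thesis by simp
    qed simp
  qed
  show ?thesis
  proof
    fix x
    let ?T1 = "cayley D1 L1" and ?T2 = "cayley D2 L2"
    let ?c = "1 / (2 * \<i>)"
    let ?v = "\<lambda>n. fcalc (\<psi> n) D2 L2 x"
    interpret disc_factorization_ops "\<lambda>n. \<phi> n \<circ> omega" "\<lambda>n. \<psi> n \<circ> omega" \<phi>c \<psi>c "f_i f \<circ> omega" hc A B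
      ?T1 ?T2 x ?v "fcalc (f_i f) D2 L2 x"
    proof
      show "ccontraction ?T1" "ccontraction ?T2"
        by (fact ccontraction_cayley[OF L1], fact ccontraction_cayley[OF L2])
    qed (unfold \<psi>c_def hc_def, fact admissible_tendsto[OF L2 adm\<psi>], fact admissible_tendsto[OF L2 admf])
    have "(\<lambda>n. fcalc (\<phi> n) D1 L1 (?T1 (?v n)) - fcalc (\<phi> n) D1 L1 (?T2 (?v n))) sums
        (fcalc (f_i f) D1 L1 (x - ?T2 x) - (fcalc (f_i f) D2 L2 x - ?T1 (fcalc (f_i f) D2 L2 x)))"
      by (rule double_series) (unfold \<phi>c_def hc_def, fact admissible_tendsto[OF L1 adm\<phi>], fact admissible_tendsto[OF L1 admf])
    \<comment> \<open>Division by \<open>2i\<close> turns \<open>T1 - T2\<close> into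
      \<open>(L2 + iI)^-1 - (L1 + iI)^-1\<close>; on the right-hand side it turns
      \<open>I - T2\<close> and \<open>I - T1\<close> into the two resolvents.\<close>
    then have "(\<lambda>n. cscale ?c (fcalc (\<phi> n) D1 L1 (?T1 (?v n)) - fcalc (\<phi> n) D1 L1 (?T2 (?v n)))) sums
        cscale ?c (fcalc (f_i f) D1 L1 (x - ?T2 x) - (fcalc (f_i f) D2 L2 x - ?T1 (fcalc (f_i f) D2 L2 x)))"
      by (rule bounded_linear.sums[OF bounded_linear_cscale_right])
    moreover have "cscale ?c (fcalc (\<phi> n) D1 L1 (?T1 (?v n)) - fcalc (\<phi> n) D1 L1 (?T2 (?v n)))
        = fcalc (\<phi> n) D1 L1 (res_i D2 L2 (?v n) - res_i D1 L1 (?v n))" for n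
      unfolding res_i_eq_cayley cscale_diff_right[symmetric] fcalc_linear[OF L1 adm\<phi>, symmetric] by simp
    moreover have "cscale ?c (fcalc (f_i f) D1 L1 (x - ?T2 x) - (fcalc (f_i f) D2 L2 x - ?T1 (fcalc (f_i f) D2 L2 x)))
        = fcalc (f_i f) D1 L1 (res_i D2 L2 x) - res_i D1 L1 (fcalc (f_i f) D2 L2 x)"
      by (simp only: res_i_eq_cayley cscale_diff_right fcalc_linear[OF L1 admf])
    \<comment> \<open>This is convergence in norm at \<open>x\<close>; continuity of the inner
      product then gives the weak statement.\<close>
    ultimately have series: "(\<lambda>n. fcalc (\<phi> n) D1 L1 (res_i D2 L2 (?v n) - res_i D1 L1 (?v n))) sums
        (fcalc (f_i f) D1 L1 (res_i D2 L2 x) - res_i D1 L1 (fcalc (f_i f) D2 L2 x))"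
      by simp
    show "res_i D1 L1 (res_i D2 L2 x) \<in> fop_dom f D1 L1 \<and> res_i D2 L2 x \<in> fop_dom f D2 L2 \<and>
           fcalc (f_i f) D1 L1 (res_i D2 L2 x) - res_i D1 L1 (fcalc (f_i f) D2 L2 x)
             = fop f D1 L1 (res_i D1 L1 (res_i D2 L2 x)) - res_i D1 L1 (fop f D2 L2 (res_i D2 L2 x)) \<and>
           (\<forall>y. (\<lambda>n. cinner (fcalc (\<phi> n) D1 L1 (res_i D2 L2 (?v n) - res_i D1 L1 (?v n))) y)
                 sums cinner (fcalc (f_i f) D1 L1 (res_i D2 L2 x) - res_i D1 L1 (fcalc (f_i f) D2 L2 x)) y)"
      using fop_res_i[OF L1 admf] fop_res_i[OF L2 admf]
      by (auto intro!: bounded_linear.sums[OF bounded_linear_cinner_left series])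
  qed
qed

end
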